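(* Let $G(x,y;\lambda)$ be the Green's function of $\mathcal{T}(\lambda)=\frac{\mathrm{d}}{\mathrm{d}x}-A(x;\lambda)$, that is, the solution of $\mathcal{T}(\lambda)G(x,y;\lambda)=\delta(x-y)\,\mathrm{id}$, defined initially for $\lambda$ in the region where $\mathcal{T}(\lambda)$ is invertible. Then, for arbitrary fixed $x,y\in\mathbb{R}$, $G(x,y;\lambda)$ possesses an analytic extension in $\lambda$ into the region where $\iota(\lambda)^{-1}$ possesses an analytic extension. On the other hand, $G(x,y;\lambda)$ is not analytic at $\lambda$ when (i) $E^{\mathrm{u}}_-(0;\lambda)$ or $E^{\mathrm{s}}_+(0;\lambda)$ is not analytic at $\lambda$, or when (ii) $E^{\mathrm{u}}_-(0;\lambda)$ and $E^{\mathrm{s}}_+(0;\lambda)$ intersect nontrivially.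
   Context: Setting. $A(x;\lambda)\in\mathbb{C}^{N\times N}$ is continuous in $x\in\mathbb{R}$ and analytic in $\lambda$, with limits $A_\pm(\lambda)=\lim_{x\to\pm\infty}A(x;\lambda)$; $\mathcal{T}(\lambda)$ acts on $L^2(\mathbb{R},\mathbb{C}^N)$ with domain $H^1(\mathbb{R},\mathbb{C}^N)$. It is assumed that $\mathcal{T}(\lambda)$ is invertible for $\mathrm{Re}\,\lambda\gg1$, and that there $A_\pm(\lambda)$ are hyperbolic (no purely imaginary eigenvalues) with the same number $i_{\mathrm{M}}$ of eigenvalues of positive real part (counted with multiplicity). The initial region is the set of $\lambda$ connected to this one where hyperbolicity and this eigenvalue count persist. Subspaces. In the initial region, $E^{\mathrm{s}}_+(\lambda)$ (resp. $E^{\mathrm{u}}_-(\lambda)$) is the generalized eigenspace of $A_+(\lambda)$ to eigenvalues with negative real part (resp. of $A_-(\lambda)$ to eigenvalues with positive real part). $E^{\mathrm{s}}_+(x;\lambda)$, $E^{\mathrm{u}}_-(x;\lambda)$ are the unique families of subspaces, continuous in $x$, transported by the flow of $u_x=A(x;\lambda)u$, converging to $E^{\mathrm{s}}_+(\lambda)$ as $x\to+\infty$ and to $E^{\mathrm{u}}_-(\lambda)$ as $x\to-\infty$, respectively; they are analytic in $\lambda$ as maps into the Grassmannian. Outside the initial region the symbols $E^{\mathrm{s}}_+(0;\lambda)$, $E^{\mathrm{u}}_-(0;\lambda)$ denote their analytic continuations. The pencil $\iota$. Let $w^{\mathrm{u}}_j(\lambda)$, $1\le j\le i_{\mathrm{M}}$,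 and $w^{\mathrm{s}}_j(\lambda)$, $i_{\mathrm{M}}+1\le j\le N$, be analytic bases of $E^{\mathrm{u}}_-(0;\lambda)$ and $E^{\mathrm{s}}_+(0;\lambda)$, and set $\iota(\lambda)u=\sum_{j=1}^{i_{\mathrm{M}}}u_jw^{\mathrm{u}}_j(\lambda)-\sum_{j=i_{\mathrm{M}}+1}^{N}u_jw^{\mathrm{s}}_j(\lambda)$ for $u\in\mathbb{C}^N$. The analytic function $\iota$ (with these analytic bases) is considered on an open set $\Omega\subset\mathbb{C}$ to which it extends analytically, possibly past the essential spectrum; $\iota(\lambda)^{-1}$ is considered in $\Omega$. Conventions. "Analytic at $\lambda$" for $G(x,y;\cdot)$, for $\iota^{-1}$, and for the subspaces is always understood for the analytic continuation from the initial region: a function is not analytic at $\lambda$ if its continuation does not extend analytically to a neighborhood of $\lambda$. For $x=y$, $G(x,y;\lambda)$ is understood through its one-sided limits $x\to y\pm$. *)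

theory Defs
  imports "HOL-Complex_Analysis.Complex_Analysis"
begin

text \<open>Vectors in \<open>C\<^sup>N\<close> are of type \<open>complex ^ 'n\<close>, with \<open>N = CARD('n)\<close>. Complex subspaces, spans and
  dimensions are those of the vector space structure \<open>vec\<close> (scalar multiplication \<open>*s\<close>); the
  unqualified \<open>span\<close> and \<open>dim\<close> would refer to real scalars.\<close>

definition is_eigenvalue :: "complex ^ 'n ^ 'n \<Rightarrow> complex \<Rightarrow> bool" where
  "is_eigenvalue M \<mu> \<longleftrightarrow> (\<exists>v. v \<noteq> 0 \<and> M *v v = \<mu> *s v)"

definition hyperbolic :: "complex ^ 'n ^ 'n \<Rightarrow> bool" where
  "hyperbolic M \<longleftrightarrow> (\<forall>\<mu>. is_eigenvalue M \<mu> \<longrightarrow> Re \<mu> \<noteq> 0)"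

definition gen_eigenspace :: "complex ^ 'n ^ 'n \<Rightarrow> complex set \<Rightarrow> (complex ^ 'n) set" where
  "gen_eigenspace M S = vec.span {v. \<exists>\<mu>\<in>S. \<exists>k::nat. ((\<lambda>w. M *v w - \<mu> *s w) ^^ k) v = 0}"

definition alg_multiplicity :: "complex ^ 'n ^ 'n \<Rightarrow> complex \<Rightarrow> nat" where
  "alg_multiplicity M \<mu> = vec.dim (gen_eigenspace M {\<mu>})"

definition morse_index :: "complex ^ 'n ^ 'n \<Rightarrow> nat" where
  "morse_index M = (\<Sum>\<mu> | is_eigenvalue M \<mu> \<and> Re \<mu> > 0. alg_multiplicity M \<mu>)"

definition stable_space :: "complex ^ 'n ^ 'n \<Rightarrow> (complex ^ 'n) set" where
  "stable_space M = gen_eigenspace M {\<mu>. Re \<mu> < 0}"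

definition unstable_space :: "complex ^ 'n ^ 'n \<Rightarrow> (complex ^ 'n) set" where
  "unstable_space M = gen_eigenspace M {\<mu>. Re \<mu> > 0}"

definition vec_holomorphic_on :: "(complex \<Rightarrow> complex ^ 'n) \<Rightarrow> complex set \<Rightarrow> bool" where
  "vec_holomorphic_on f D \<longleftrightarrow> (\<forall>i. (\<lambda>z. f z $ i) holomorphic_on D)"

definition mat_holomorphic_on :: "(complex \<Rightarrow> complex ^ 'n ^ 'm) \<Rightarrow> complex set \<Rightarrow> bool" where
  "mat_holomorphic_on f D \<longleftrightarrow> (\<forall>i j. (\<lambda>z. f z $ i $ j) holomorphic_on D)"

definition basis_of :: "'n set \<Rightarrow> ('n \<Rightarrow> complex ^ 'n) \<Rightarrow> (complex ^ 'n) set \<Rightarrow> bool" where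
  "basis_of I b V \<longleftrightarrow> inj_on b I \<and> \<not> vec.dependent (b ` I) \<and> vec.span (b ` I) = V"

text \<open>The Grassmannian carries the quotient structure of the manifold of frames, so convergence and
  analyticity of a map into it mean convergence and analyticity of a suitable local frame.\<close>

definition grass_tendsto ::
  "('a \<Rightarrow> (complex ^ 'n) set) \<Rightarrow> (complex ^ 'n) set \<Rightarrow> 'a filter \<Rightarrow> bool" where
  "grass_tendsto E V F \<longleftrightarrow>
     (\<exists>(I::'n set) b b0. basis_of I b0 V \<and> (\<forall>j\<in>I. ((\<lambda>x. b x j) \<longlongrightarrow> b0 j) F) \<and>
        eventually (\<lambda>x. basis_of I (b x) (E x)) F)"

definition grass_analytic_on :: "(complex \<Rightarrow> (complex ^ 'n) set) \<Rightarrow> complex set \<Rightarrow> bool" where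
  "grass_analytic_on E D \<longleftrightarrow>
     (\<forall>z0\<in>D. \<exists>U (I::'n set) b. open U \<and> z0 \<in> U \<and> U \<subseteq> D \<and>
        (\<forall>j\<in>I. vec_holomorphic_on (\<lambda>z. b z j) U) \<and> (\<forall>z\<in>U. basis_of I (b z) (E z)))"

text \<open>\<open>continues_to AN U f \<gamma> v\<close>: the function \<open>f\<close>, given on \<open>U\<close>, can be continued along the path \<open>\<gamma>\<close>,
  and \<open>v\<close> is the value of the continuation at the end point of \<open>\<gamma>\<close>. The elements of the
  continuation are functions \<open>g t\<close> on discs \<open>ball (\<gamma> t) (r t)\<close> which are analytic in the sense of \<open>AN\<close>;
  the first disc has to lie in \<open>U\<close>. Since the last disc is a neighbourhood of the end point,
  \<open>continuable AN U f \<gamma>\<close> says that the continuation is analytic at the end point.\<close>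

definition continues_to ::
  "((complex \<Rightarrow> 'a) \<Rightarrow> complex set \<Rightarrow> bool) \<Rightarrow> complex set \<Rightarrow> (complex \<Rightarrow> 'a) \<Rightarrow>
   (real \<Rightarrow> complex) \<Rightarrow> 'a \<Rightarrow> bool" where
  "continues_to AN U f \<gamma> v \<longleftrightarrow>
     (\<exists>(g :: real \<Rightarrow> complex \<Rightarrow> 'a) r.
        (\<forall>t\<in>{0..1}. r t > 0 \<and> AN (g t) (ball (\<gamma> t) (r t))) \<and>
        ball (\<gamma> 0) (r 0) \<subseteq> U \<and> (\<forall>z\<in>ball (\<gamma> 0) (r 0). g 0 z = f z) \<and>
        (\<forall>t\<in>{0..1}. \<exists>\<epsilon>>0. \<forall>s\<in>{0..1}. \<bar>s - t\<bar> < \<epsilon> \<longrightarrow>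
           (\<forall>z\<in>ball (\<gamma> s) (r s) \<inter> ball (\<gamma> t) (r t). g s z = g t z)) \<and>
        g 1 (\<gamma> 1) = v)"

definition continuable ::
  "((complex \<Rightarrow> 'a) \<Rightarrow> complex set \<Rightarrow> bool) \<Rightarrow> complex set \<Rightarrow> (complex \<Rightarrow> 'a) \<Rightarrow>
   (real \<Rightarrow> complex) \<Rightarrow> bool" where
  "continuable AN U f \<gamma> \<longleftrightarrow> (\<exists>v. continues_to AN U f \<gamma> v)"

definition L2 :: "(real \<Rightarrow> 'b::euclidean_space) set" where
  "L2 = {u. u \<in> borel_measurable lborel \<and> integrable lborel (\<lambda>x. (norm (u x))\<^sup>2)}"

definition test_fun :: "(real \<Rightarrow> real) \<Rightarrow> bool" where
  "test_fun \<phi> \<longleftrightarrow> (\<forall>k x. (deriv ^^ k) \<phi> field_differentiable at x) \<and> bounded {x. \<phi> x \<noteq> 0}"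

definition weak_deriv :: "(real \<Rightarrow> 'b::euclidean_space) \<Rightarrow> (real \<Rightarrow> 'b) \<Rightarrow> bool" where
  "weak_deriv u v \<longleftrightarrow>
     (\<forall>\<phi>. test_fun \<phi> \<longrightarrow> (LINT x|lborel. deriv \<phi> x *\<^sub>R u x) = - (LINT x|lborel. \<phi> x *\<^sub>R v x))"

text \<open>\<open>T_graph A z u f\<close>: \<open>u\<close> lies in \<open>H\<^sup>1\<close> and \<open>T(z) u = f\<close> in \<open>L\<^sup>2\<close>. Elements of \<open>L2\<close> are functions, so
  equality in \<open>L\<^sup>2\<close> is equality almost everywhere.\<close>

definition T_graph ::
  "(real \<Rightarrow> complex \<Rightarrow> complex ^ 'n ^ 'n) \<Rightarrow> complex \<Rightarrow> (real \<Rightarrow> complex ^ 'n) \<Rightarrow>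
   (real \<Rightarrow> complex ^ 'n) \<Rightarrow> bool" where
  "T_graph A z u f \<longleftrightarrow> u \<in> L2 \<and> f \<in> L2 \<and>
     (\<exists>v\<in>L2. weak_deriv u v \<and> (AE x in lborel. f x = v x - A x z *v u x))"

text \<open>Bijectivity of \<open>T(z)\<close> from \<open>H\<^sup>1\<close> to \<open>L\<^sup>2\<close>; as \<open>T(z)\<close> is closed, the inverse is then bounded.\<close>

definition T_invertible :: "(real \<Rightarrow> complex \<Rightarrow> complex ^ 'n ^ 'n) \<Rightarrow> complex \<Rightarrow> bool" where
  "T_invertible A z \<longleftrightarrow>
     (\<forall>f\<in>L2. (\<exists>u. T_graph A z u f) \<and>
        (\<forall>u1 u2. T_graph A z u1 f \<and> T_graph A z u2 f \<longrightarrow> (AE x in lborel. u1 x = u2 x)))"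

text \<open>\<open>K = G(\<cdot>, y; z)\<close> is the \<open>L\<^sup>2\<close> solution of \<open>T(z) K = \<delta>(\<cdot> - y) id\<close> in the sense of distributions,
  represented by a function that is continuous off \<open>y\<close>. The value \<open>K y\<close> is irrelevant.\<close>

definition is_green ::
  "(real \<Rightarrow> complex \<Rightarrow> complex ^ 'n ^ 'n) \<Rightarrow> complex \<Rightarrow> real \<Rightarrow> (real \<Rightarrow> complex ^ 'n ^ 'n) \<Rightarrow> bool" where
  "is_green A z y K \<longleftrightarrow> K \<in> L2 \<and> continuous_on (- {y}) K \<and>
     (\<forall>\<phi>. test_fun \<phi> \<longrightarrow>
        (LINT x|lborel. - (deriv \<phi> x *\<^sub>R K x) - \<phi> x *\<^sub>R (A x z ** K x)) = \<phi> y *\<^sub>R mat 1)"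

text \<open>The functions of the spectral parameter meant by \<open>G(x, y; \<cdot>)\<close>: for \<open>x = y\<close> these are the two
  one-sided limits.\<close>

definition green_values ::
  "(real \<Rightarrow> real \<Rightarrow> complex \<Rightarrow> complex ^ 'n ^ 'n) \<Rightarrow> real \<Rightarrow> real \<Rightarrow>
   (complex \<Rightarrow> complex ^ 'n ^ 'n) set" where
  "green_values G x y =
     (if x \<noteq> y then {G x y}
      else {\<lambda>z. Lim (at_right y) (\<lambda>\<xi>. G \<xi> y z), \<lambda>z. Lim (at_left y) (\<lambda>\<xi>. G \<xi> y z)})"

definition same_morse_set ::
  "(complex \<Rightarrow> complex ^ 'n ^ 'n) \<Rightarrow> (complex \<Rightarrow> complex ^ 'n ^ 'n) \<Rightarrow> nat \<Rightarrow> complex set" where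
  "same_morse_set Ap Am iM =
     {z. hyperbolic (Ap z) \<and> hyperbolic (Am z) \<and> morse_index (Ap z) = iM \<and> morse_index (Am z) = iM}"

definition initial_region ::
  "(complex \<Rightarrow> complex ^ 'n ^ 'n) \<Rightarrow> (complex \<Rightarrow> complex ^ 'n ^ 'n) \<Rightarrow> nat \<Rightarrow> real \<Rightarrow> complex set" where
  "initial_region Ap Am iM \<rho> =
     {z. \<exists>z0. Re z0 > \<rho> \<and> connected_component (same_morse_set Ap Am iM) z0 z}"

definition transported_family ::
  "(real \<Rightarrow> complex \<Rightarrow> complex ^ 'n ^ 'n) \<Rightarrow> complex \<Rightarrow> (real \<Rightarrow> (complex ^ 'n) set) \<Rightarrow>
   (complex ^ 'n) set \<Rightarrow> real filter \<Rightarrow> bool" where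
  "transported_family A z E V F \<longleftrightarrow>
     (\<forall>x. vec.subspace (E x)) \<and>
     (\<forall>u. (\<forall>x. (u has_vector_derivative (A x z *v u x)) (at x)) \<longrightarrow>
        (\<forall>x y. u x \<in> E x \<longrightarrow> u y \<in> E y)) \<and>
     (\<forall>x0. grass_tendsto E (E x0) (at x0)) \<and> grass_tendsto E V F"

text \<open>The indices in \<open>I\<close> play the role of \<open>1, \<dots>, i\<^sub>M\<close>, those in \<open>- I\<close> of \<open>i\<^sub>M + 1, \<dots>, N\<close>.\<close>

definition iota :: "'n set \<Rightarrow> ('n \<Rightarrow> complex \<Rightarrow> complex ^ 'n) \<Rightarrow> complex \<Rightarrow> complex ^ 'n \<Rightarrow> complex ^ 'n" where
  "iota I w z u = (\<Sum>j\<in>I. (u $ j) *s w j z) - (\<Sum>j\<in>- I. (u $ j) *s w j z)"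

end

theory Submission
  imports Defs "HOL-Computational_Algebra.Fundamental_Theorem_Algebra"
begin

text \<open>The Green's function is a spectral projection in disguise. Let \<open>\<Phi>(x; z)\<close> be the fundamental matrix of
  \<open>u' = A(x; z) u\<close> with \<open>\<Phi>(0; z) = 1\<close>; it is invertible and entire in \<open>z\<close>. Where \<open>T(z)\<close> is invertible
  and \<open>z\<close> lies in the initial region, \<open>C\<^sup>N\<close> is the direct sum of the spaces \<open>E\<^sup>s\<close> and \<open>E\<^sup>u\<close> at \<open>x = 0\<close>,
  and with \<open>P(z)\<close> the projection onto \<open>E\<^sup>s\<close> along \<open>E\<^sup>u\<close> one has (\<open>green_formula\<close>)
  \<open>G(x, y; z) = \<Phi>(x; z) P(z) \<Phi>(y; z)\<^sup>-\<^sup>1\<close> for \<open>y < x\<close> and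
  \<open>G(x, y; z) = \<Phi>(x; z) (P(z) - 1) \<Phi>(y; z)\<^sup>-\<^sup>1\<close> for \<open>x < y\<close>. For fixed \<open>x\<close> and \<open>y\<close>, continuing \<open>G\<close>
  analytically in \<open>z\<close> is therefore the same as continuing \<open>P\<close>.

  If \<open>\<iota>\<close> is invertible, \<open>P(z) c\<close> is the part of \<open>c = \<iota>(z) u\<close> that belongs to \<open>E\<^sup>s\<close>, a polynomial
  expression in the basis vectors and the entries of \<open>\<iota>(z)\<^sup>-\<^sup>1\<close>; so \<open>P\<close> extends wherever \<open>\<iota>\<^sup>-\<^sup>1\<close> does
  (\<open>projects_from_iota_inverse\<close>). Conversely, let \<open>G\<close> continue along a path. Then so does \<open>P\<close>, and by
  the identity theorem the continuation consists of idempotent matrices. Range and kernel of a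
  holomorphic family of idempotents are analytic as maps into the Grassmannian
  (\<open>idempotent_grass_analytic\<close>), and they always meet in \<open>0\<close> only. Since analytic continuation of subspaces
  is unique (\<open>grass_continuation_unique\<close>), the range and the kernel are the continuations of \<open>E\<^sup>s\<close> and
  \<open>E\<^sup>u\<close>. Hence both subspaces continue, which excludes (i), and their continuations intersect
  trivially, which excludes (ii).

  The formula for \<open>G\<close> rests on three facts. First, the distributional equation for \<open>G(\<cdot>, y; z)\<close> means
  that its columns are classical solutions on both sides of \<open>y\<close> with jump \<open>1\<close> at \<open>y\<close>
  (\<open>green_structure\<close>); test functions approximating the indicator function of an interval show this.
  Secondly, by hyperbolicity at infinity a solution is square integrable on a half line exactly if it
  takes values in the transported family of subspaces (\<open>half_line_characterization\<close>). This comes from a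
  Lyapunov function: a hyperbolic matrix \<open>M\<close> admits a symmetric form \<open>h\<close> with \<open>h(v, M v) \<ge> c |v|\<^sup>2\<close>
  (\<open>hyperbolic_form_exists\<close>), negative on the stable and positive on the unstable space, and \<open>h(u, u)\<close>
  increases along solutions \<open>u\<close> near infinity. Thirdly, a common vector of \<open>E\<^sup>s\<close> and \<open>E\<^sup>u\<close> starts
  a solution in the kernel of \<open>T(z)\<close>, so that injectivity makes the sum direct
  (\<open>kernel_of_finite_energy\<close>).\<close>

text \<open>In this theory \<open>$\<close> always denotes the component of a vector.\<close>

unbundle no fps_syntax

section \<open>Linear systems with a holomorphic parameter\<close>

lemma bounded_bilinear_matrix_vector_mult: "bounded_bilinear ((*v) :: complex^'n^'m \<Rightarrow> complex^'n \<Rightarrow> complex^'m)"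
proof -
  have "bilinear ((*v) :: complex^'n^'m \<Rightarrow> complex^'n \<Rightarrow> complex^'m)"
    unfolding bilinear_def linear_iff
    by (auto simp: vec_eq_iff matrix_vector_mult_def algebra_simps sum.distrib sum_distrib_left scaleR_sum_right)
  then show ?thesis by (simp add: bilinear_conv_bounded_bilinear)
qed

lemma bounded_bilinear_matrix_matrix_mult: "bounded_bilinear ((**) :: complex^'n^'m \<Rightarrow> complex^'k^'n \<Rightarrow> complex^'k^'m)"
proof -
  have "bilinear ((**) :: complex^'n^'m \<Rightarrow> complex^'k^'n \<Rightarrow> complex^'k^'m)"
    unfolding bilinear_def linear_iff
    by (auto simp: vec_eq_iff matrix_matrix_mult_def algebra_simps sum.distrib sum_distrib_left scaleR_sum_right)
  then show ?thesis by (simp add: bilinear_conv_bounded_bilinear)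
qed

interpretation mvm: bounded_bilinear "(*v) :: complex^'n^'m \<Rightarrow> complex^'n \<Rightarrow> complex^'m"
  by (rule bounded_bilinear_matrix_vector_mult)
interpretation mmm: bounded_bilinear "(**) :: complex^'n^'m \<Rightarrow> complex^'k^'n \<Rightarrow> complex^'k^'m"
  by (rule bounded_bilinear_matrix_matrix_mult)

lemma mat_holomorphic_on_mult:
  assumes "mat_holomorphic_on f D" "mat_holomorphic_on g D"
  shows "mat_holomorphic_on (\<lambda>z. f z ** g z) D"
  using assms unfolding mat_holomorphic_on_def matrix_matrix_mult_def
  by (auto intro!: holomorphic_intros)

definition antideriv :: "(real \<Rightarrow> 'a::banach) \<Rightarrow> real \<Rightarrow> 'a" where
  "antideriv f x = (if 0 \<le> x then integral {0..x} f else - integral {x..0} f)"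

lemma antideriv_0 [simp]: "antideriv f 0 = 0"
  by (simp add: antideriv_def)

lemma antideriv_deriv:
  fixes f :: "real \<Rightarrow> 'a::banach"
  assumes "continuous_on UNIV f"
  shows "(antideriv f has_vector_derivative f x) (at x)"
proof -
  define R where "R = \<bar>x\<bar> + 1"
  have int: "f integrable_on {a..b}" for a b
    using assms by (meson continuous_on_subset integrable_continuous_interval subset_UNIV)
  have eq: "antideriv f t = integral {-R..t} f - integral {-R..0} f" if "t \<in> {-R<..<R}" for t
  proof (cases "0 \<le> t")
    case True
    then show ?thesis
      using Henstock_Kurzweil_Integration.integral_combine[of "-R" 0 t f] int that
      by (simp add: antideriv_def R_def algebra_simps)
  next
    case False
    then show ?thesis
      using Henstock_Kurzweil_Integration.integral_combine[of "-R" t 0 f] int that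
      by (simp add: antideriv_def R_def algebra_simps)
  qed
  have "((\<lambda>t. integral {-R..t} f) has_vector_derivative f x) (at x within {-R..R})"
    by (rule integral_has_vector_derivative) (use assms continuous_on_subset R_def in auto)
  moreover have "at x within {-R..R} = at x"
    by (rule at_within_interior) (auto simp: R_def abs_if)
  ultimately have "((\<lambda>t. integral {-R..t} f - integral {-R..0} f) has_vector_derivative f x) (at x)"
    by (auto intro!: derivative_eq_intros)
  then show ?thesis
    by (rule has_vector_derivative_transform_within_open[where S="{-R<..<R}"])
       (use eq in \<open>auto simp: R_def\<close>)
qed

lemma antideriv_bound:
  fixes f :: "real \<Rightarrow> 'a::banach"
  assumes "continuous_on UNIV f" and b: "\<And>s. \<bar>s\<bar> \<le> \<bar>x\<bar> \<Longrightarrow> norm (f s) \<le> C * \<bar>s\<bar> ^ k"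
  shows "norm (antideriv f x) \<le> C * \<bar>x\<bar> ^ Suc k / Suc k"
proof -
  have int: "f integrable_on {a..b}" for a b
    using assms(1) by (meson continuous_on_subset integrable_continuous_interval subset_UNIV)
  have pw: "((\<lambda>s. C * s ^ k) has_integral C * a ^ Suc k / Suc k) {0..a}" if "0 \<le> a" for a :: real
  proof -
    have "((\<lambda>s. C * s ^ k) has_integral C * a ^ Suc k / Suc k - C * 0 ^ Suc k / Suc k) {0..a}"
    proof (rule fundamental_theorem_of_calculus)
      show "((\<lambda>a. C * a ^ Suc k / real (Suc k)) has_vector_derivative C * s ^ k) (at s within {0..a})" for s
        unfolding has_real_derivative_iff_has_vector_derivative[symmetric]
        by (rule derivative_eq_intros refl | simp)+
    qed (use that in auto)
    then show ?thesis by simp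
  qed
  have bp: "norm (f s) \<le> C * s ^ k" if "s \<in> {0..x}" for s
    using b[of s] that by simp
  have bn: "norm (f s) \<le> C * (- s) ^ k" if "s \<in> {x..0}" for s
    using b[of s] that by simp
  show ?thesis
  proof (cases "0 \<le> x")
    case True
    then have "norm (integral {0..x} f) \<le> integral {0..x} (\<lambda>s. C * s ^ k)"
      using int pw[OF True] bp by (intro integral_norm_bound_integral) auto
    also have "\<dots> = C * x ^ Suc k / Suc k"
      using pw[OF True] by blast
    finally show ?thesis using True by (simp add: antideriv_def)
  next
    case False
    then have x: "0 \<le> -x" by simp
    have pw': "((\<lambda>s. C * (-s) ^ k) has_integral C * (-x) ^ Suc k / Suc k) {x..0}"
      using has_integral_reflect_real[of "\<lambda>s. C * s ^ k" _ "-x" 0] pw[OF x] by simp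
    have "norm (integral {x..0} f) \<le> integral {x..0} (\<lambda>s. C * (-s) ^ k)"
      using int pw' bn by (intro integral_norm_bound_integral) auto
    also have "\<dots> = C * (-x) ^ Suc k / Suc k"
      using pw' by blast
    finally show ?thesis using False by (simp add: antideriv_def)
  qed
qed

text \<open>Scaling to the fixed interval \<open>[0, 1]\<close> turns \<open>x\<close> into a parameter, so
  that the theorems on parameter-dependent integrals apply to both signs of \<open>x\<close> and
  give joint continuity.\<close>

lemma antideriv_unit_integral:
  fixes f :: "real \<Rightarrow> 'a::euclidean_space"
  assumes "continuous_on UNIV f"
  shows "antideriv f x = integral {0..1} (\<lambda>t. x *\<^sub>R f (t * x))"
proof -
  have "((\<lambda>t. x *\<^sub>R f (t * x)) has_integral antideriv f (1 * x) - antideriv f (0 * x)) {0..1}"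
  proof (rule fundamental_theorem_of_calculus)
    fix t :: real
    have "((antideriv f \<circ> (\<lambda>t. t * x)) has_vector_derivative x *\<^sub>R f (t * x)) (at t)"
      by (rule vector_diff_chain_at) (use antideriv_deriv[OF assms] in \<open>auto intro!: derivative_eq_intros\<close>)
    then show "((\<lambda>t. antideriv f (t * x)) has_vector_derivative x *\<^sub>R f (t * x)) (at t within {0..1})"
      by (simp add: o_def has_vector_derivative_at_within)
  qed auto
  then show ?thesis by (simp only: mult_1 mult_zero_left antideriv_0 diff_zero integral_unique)
qed

lemma continuous_on_curried:
  assumes "continuous_on UNIV (\<lambda>p. f (fst p) (snd p))" "continuous_on S g" "continuous_on S h"
  shows "continuous_on S (\<lambda>x. f (g x) (h x))"
  using continuous_on_compose2[OF assms(1), of S "\<lambda>x. (g x, h x)"] assms(2,3)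
  by (simp add: continuous_on_Pair)

lemma continuous_on_antideriv_param:
  fixes f :: "real \<Rightarrow> 'b::topological_space \<Rightarrow> 'a::euclidean_space"
  assumes f: "continuous_on UNIV (\<lambda>p. f (fst p) (snd p))"
  shows "continuous_on UNIV (\<lambda>p. antideriv (\<lambda>s. f s (snd p)) (fst p))"
proof -
  have 1: "continuous_on UNIV (\<lambda>s. f s z)" for z
    by (intro continuous_on_curried[OF f] continuous_intros)
  have "continuous_on UNIV (\<lambda>p. integral (cbox 0 1) (\<lambda>t. fst p *\<^sub>R f (t * fst p) (snd p)))"
  proof (rule integral_continuous_on_param)
    have "continuous_on UNIV (\<lambda>q::(real \<times> 'b) \<times> real. f (snd q * fst (fst q)) (snd (fst q)))"
      by (intro continuous_on_curried[OF f] continuous_intros)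
    then have "continuous_on UNIV (\<lambda>q::(real \<times> 'b) \<times> real. fst (fst q) *\<^sub>R f (snd q * fst (fst q)) (snd (fst q)))"
      by (intro continuous_intros)
    then show "continuous_on (UNIV \<times> cbox 0 1) (\<lambda>(p, t). fst p *\<^sub>R f (t * fst p) (snd p))"
      by (auto simp: case_prod_unfold intro: continuous_on_subset)
  qed
  then show ?thesis using antideriv_unit_integral[OF 1] by simp
qed

text \<open>Morera's theorem: the integral over a triangle may be interchanged with the integral over
  \<open>t\<close>, and for each fixed \<open>t\<close> it vanishes by Cauchy's theorem.\<close>

lemma holomorphic_on_integral_param:
  fixes f :: "real \<Rightarrow> complex \<Rightarrow> complex"
  assumes f: "continuous_on UNIV (\<lambda>p. f (fst p) (snd p))"
    and hol: "\<And>t. f t holomorphic_on UNIV"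
  shows "(\<lambda>z. integral {0..1} (\<lambda>t. f t z)) holomorphic_on UNIV"
proof -
  let ?F = "\<lambda>z. integral (cbox 0 1) (\<lambda>t. f t z)"
  let ?C = "\<lambda>a b g. integral (cbox 0 1) (\<lambda>s. g (linepath a b s) * (b - a))"
  have c: "continuous_on UNIV ?F"
  proof (rule integral_continuous_on_param)
    have "continuous_on UNIV (\<lambda>q. f (snd q) (fst q))"
      by (intro continuous_on_curried[OF f] continuous_intros)
    then show "continuous_on (UNIV \<times> cbox 0 1) (\<lambda>(z, t). f t z)"
      by (auto simp: case_prod_unfold intro: continuous_on_subset)
  qed
  have ci: "contour_integral (linepath a b) g = ?C a b g" for a b g
    by (simp add: contour_integral_integral)
  have cont2: "continuous_on UNIV (\<lambda>q. f (snd q) (linepath a b (fst q)) * (b - a))" for a b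
    unfolding linepath_def by (intro continuous_on_curried[OF f] continuous_intros)
  have sw: "contour_integral (linepath a b) ?F =
      integral (cbox 0 1) (\<lambda>t. contour_integral (linepath a b) (f t))" for a b
  proof -
    have "contour_integral (linepath a b) ?F = integral (cbox 0 1) (\<lambda>s. ?F (linepath a b s) * (b - a))"
      by (rule ci)
    also have "\<dots> = integral (cbox 0 1) (\<lambda>s. integral (cbox 0 1) (\<lambda>t. f t (linepath a b s) * (b - a)))"
      by simp
    also have "\<dots> = integral (cbox 0 1) (\<lambda>t. integral (cbox 0 1) (\<lambda>s. f t (linepath a b s) * (b - a)))"
      by (rule integral_swap_continuous)
         (use cont2[of a b] in \<open>auto simp: case_prod_unfold intro: continuous_on_subset\<close>)
    finally show ?thesis by (simp only: ci)
  qed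
  have cont3: "continuous_on (cbox 0 1) (\<lambda>t. contour_integral (linepath a b) (f t))" for a b
    unfolding ci
  proof (rule integral_continuous_on_param)
    have "continuous_on UNIV (\<lambda>q. f (fst q) (linepath a b (snd q)) * (b - a))"
      unfolding linepath_def by (intro continuous_on_curried[OF f] continuous_intros)
    then show "continuous_on (cbox 0 1 \<times> cbox 0 1) (\<lambda>(t, s). f t (linepath a b s) * (b - a))"
      by (auto simp: case_prod_unfold intro: continuous_on_subset)
  qed
  have int3: "(\<lambda>t. contour_integral (linepath a b) (f t)) integrable_on (cbox 0 1)" for a b
    using cont3 by (rule integrable_continuous)
  have "?F analytic_on UNIV"
  proof (rule Morera_triangle[OF c])
    fix a b d :: complex
    have zero: "contour_integral (linepath a b) (f t) + contour_integral (linepath b d) (f t)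
       + contour_integral (linepath d a) (f t) = 0" for t
      using hol[of t]
      by (metis Cauchy_theorem_triangle contour_integral_unique has_chain_integral_chain_integral3 holomorphic_on_subset subset_UNIV)
    have "contour_integral (linepath a b) ?F + contour_integral (linepath b d) ?F + contour_integral (linepath d a) ?F
      = integral (cbox 0 1) (\<lambda>t. contour_integral (linepath a b) (f t) + contour_integral (linepath b d) (f t)
       + contour_integral (linepath d a) (f t))"
      unfolding sw using int3 by (simp add: integral_add integrable_add)
    also have "\<dots> = 0" unfolding zero by simp
    finally show "convex hull {a, b, d} \<subseteq> UNIV \<longrightarrow> contour_integral (linepath a b) ?F
       + contour_integral (linepath b d) ?F + contour_integral (linepath d a) ?F = 0" by simp
  qed auto
  then show ?thesis by (simp add: analytic_imp_holomorphic)
qed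

text \<open>The terms of the Picard (Dyson) series, whose sum solves \<open>\<Phi>' = A \<Phi>\<close>,
  \<open>\<Phi>(0) = 1\<close>. A series of iterated integrals is used because each term is visibly
  entire in \<open>z\<close>.\<close>

primrec picard :: "(real \<Rightarrow> complex \<Rightarrow> complex ^ 'n ^ 'n) \<Rightarrow> nat \<Rightarrow> real \<Rightarrow> complex \<Rightarrow> complex ^ 'n ^ 'n" where
  "picard A 0 x z = mat 1"
| "picard A (Suc k) x z = antideriv (\<lambda>s. A s z ** picard A k s z) x"

definition fundamental ::
  "(real \<Rightarrow> complex \<Rightarrow> complex ^ 'n ^ 'n) \<Rightarrow> real \<Rightarrow> complex \<Rightarrow> complex ^ 'n ^ 'n" where
  "fundamental A x z = (\<Sum>k. picard A k x z)"

lemma picard_continuous: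
  assumes "continuous_on UNIV (\<lambda>p. A (fst p) (snd p))"
  shows "continuous_on UNIV (\<lambda>p. picard A k (fst p) (snd p))"
proof (induction k)
  case (Suc k)
  show ?case
    using continuous_on_antideriv_param[of "\<lambda>s z. A s z ** picard A k s z"]
      mmm.continuous_on[OF assms Suc] by simp
qed simp

lemma continuous_on_nth2:
  fixes f :: "'a::topological_space \<Rightarrow> complex ^ 'n ^ 'm"
  assumes "continuous_on S f" shows "continuous_on S (\<lambda>x. f x $ i $ j)"
  by (intro continuous_on_component assms)

lemma integral_nth2:
  fixes f :: "real \<Rightarrow> complex ^ 'n ^ 'm"
  assumes "f integrable_on S"
  shows "integral S f $ i $ j = integral S (\<lambda>t. f t $ i $ j)"
proof -
  have "bounded_linear (\<lambda>M::complex ^ 'n ^ 'm. M $ i $ j)"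
    using bounded_linear_compose[OF bounded_linear_vec_nth bounded_linear_vec_nth] .
  from integral_linear[OF assms this] show ?thesis by (simp add: o_def)
qed

lemma picard_holomorphic:
  fixes A :: "real \<Rightarrow> complex \<Rightarrow> complex ^ 'n ^ 'n"
  assumes c: "continuous_on UNIV (\<lambda>p. A (fst p) (snd p))"
    and h: "\<And>x. mat_holomorphic_on (A x) UNIV"
  shows "mat_holomorphic_on (picard A k x) UNIV"
proof (induction k arbitrary: x)
  case 0
  then show ?case by (simp add: mat_holomorphic_on_def mat_def)
next
  case (Suc k)
  define f where "f = (\<lambda>s z. A s z ** picard A k s z)"
  have fc: "continuous_on UNIV (\<lambda>p. f (fst p) (snd p))"
    unfolding f_def by (rule mmm.continuous_on[OF c picard_continuous[OF c]])
  have fh: "mat_holomorphic_on (f s) UNIV" for s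
    unfolding f_def by (intro mat_holomorphic_on_mult h Suc)
  have f1: "continuous_on UNIV (\<lambda>s. f s z)" for z
    by (intro continuous_on_curried[OF fc] continuous_intros)
  have "(\<lambda>z. picard A (Suc k) x z $ i $ j) holomorphic_on UNIV" for i j
  proof -
    have "picard A (Suc k) x z $ i $ j = integral {0..1} (\<lambda>t. x *\<^sub>R f (t * x) z $ i $ j)" for z
    proof -
      have "continuous_on UNIV (\<lambda>t. x *\<^sub>R f (t * x) z)"
        by (intro continuous_intros continuous_on_curried[OF fc])
      then have "(\<lambda>t. x *\<^sub>R f (t * x) z) integrable_on {0..1}"
        by (meson continuous_on_subset integrable_continuous_interval subset_UNIV)
      then have "integral {0..1} (\<lambda>t. x *\<^sub>R f (t * x) z) $ i $ j
          = integral {0..1} (\<lambda>t. (x *\<^sub>R f (t * x) z) $ i $ j)"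
        by (rule integral_nth2)
      then show ?thesis
        using antideriv_unit_integral[OF f1, of z x] by (simp add: f_def)
    qed
    moreover have "(\<lambda>z. integral {0..1} (\<lambda>t. x *\<^sub>R f (t * x) z $ i $ j)) holomorphic_on UNIV"
    proof (rule holomorphic_on_integral_param)
      show "continuous_on UNIV (\<lambda>p. x *\<^sub>R f (fst p * x) (snd p) $ i $ j)"
        by (intro continuous_intros continuous_on_nth2 continuous_on_curried[OF fc])
      show "(\<lambda>z. x *\<^sub>R f (t * x) z $ i $ j) holomorphic_on UNIV" for t
        using fh[of "t * x"] unfolding mat_holomorphic_on_def scaleR_conv_of_real
        by (auto intro!: holomorphic_intros)
    qed
    ultimately show ?thesis by simp
  qed
  then show ?case by (simp add: mat_holomorphic_on_def)
qed

text \<open>Each integration contributes a factor \<open>C K |x|\<close> and the factorial comes from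
  integrating powers of \<open>|s|\<close>; \<open>K\<close> is a bound for matrix multiplication as
  a bilinear map.\<close>

lemma picard_bound:
  fixes A :: "real \<Rightarrow> complex \<Rightarrow> complex ^ 'n ^ 'n"
  assumes c: "continuous_on UNIV (\<lambda>p. A (fst p) (snd p))"
    and K: "\<And>(a :: complex ^ 'n ^ 'n) (b :: complex ^ 'n ^ 'n). norm (a ** b) \<le> norm a * norm b * K" "0 \<le> K"
    and C: "\<And>s. \<bar>s\<bar> \<le> R \<Longrightarrow> norm (A s z) \<le> C" "0 \<le> C"
    and x: "\<bar>x\<bar> \<le> R"
  shows "norm (picard A k x z) \<le> norm (mat 1 :: complex ^ 'n ^ 'n) * (C * K) ^ k / fact k * \<bar>x\<bar> ^ k"
  using x
proof (induction k arbitrary: x)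
  case (Suc k)
  let ?m = "norm (mat 1 :: complex ^ 'n ^ 'n)"
  have "norm (antideriv (\<lambda>s. A s z ** picard A k s z) x)
      \<le> (?m * (C * K) ^ Suc k / fact k) * \<bar>x\<bar> ^ Suc k / Suc k"
  proof (rule antideriv_bound)
    show "continuous_on UNIV (\<lambda>s. A s z ** picard A k s z)"
      by (intro mmm.continuous_on continuous_on_curried[OF c] continuous_on_curried[OF picard_continuous[OF c]]
          continuous_intros)
    fix s assume s: "\<bar>s\<bar> \<le> \<bar>x\<bar>"
    have "norm (A s z ** picard A k s z) \<le> norm (A s z) * norm (picard A k s z) * K"
      using K(1)[of "A s z" "picard A k s z"] by simp
    also have "\<dots> \<le> C * (?m * (C * K) ^ k / fact k * \<bar>s\<bar> ^ k) * K"
      using s Suc.prems by (intro mult_mono Suc.IH C K) (auto simp: C K)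
    also have "\<dots> = (?m * (C * K) ^ Suc k / fact k) * \<bar>s\<bar> ^ k"
      by (simp add: algebra_simps)
    finally show "norm (A s z ** picard A k s z) \<le> \<dots>" .
  qed
  then show ?case by (simp add: field_simps)
qed simp

text \<open>The exponential series dominates the Picard series uniformly on compact sets of \<open>(x,
  z)\<close>.\<close>

lemma picard_bound_summable:
  fixes A :: "real \<Rightarrow> complex \<Rightarrow> complex ^ 'n ^ 'n"
  assumes c: "continuous_on UNIV (\<lambda>p. A (fst p) (snd p))"
  obtains M C K where "summable M" "0 < C" "0 \<le> K"
      "\<forall>(a :: complex ^ 'n ^ 'n) (b :: complex ^ 'n ^ 'n). norm (a ** b) \<le> norm a * norm b * K"
      "\<forall>x z. \<bar>x\<bar> \<le> R \<longrightarrow> norm z \<le> R \<longrightarrow> norm (A x z) \<le> C"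
      "\<forall>x z k. \<bar>x\<bar> \<le> R \<longrightarrow> norm z \<le> R \<longrightarrow> norm (picard A k x z) \<le> M k"
proof -
  obtain K where K: "0 \<le> K" "\<And>(a :: complex ^ 'n ^ 'n) (b :: complex ^ 'n ^ 'n). norm (a ** b) \<le> norm a * norm b * K"
    using mmm.nonneg_bounded by blast
  have "compact ((\<lambda>p. A (fst p) (snd p)) ` (cball 0 R \<times> cball 0 R))"
    by (intro compact_continuous_image compact_Times compact_cball continuous_on_subset[OF c]) auto
  from compact_imp_bounded[OF this]
  obtain C where C: "0 < C" "\<forall>p\<in>cball 0 R \<times> cball 0 R. norm (A (fst p) (snd p)) \<le> C"
    unfolding bounded_pos by auto
  have C': "norm (A x z) \<le> C" if "\<bar>x\<bar> \<le> R" "norm z \<le> R" for x z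
    using bspec[OF C(2), of "(x, z)"] that by simp
  define M where "M k = norm (mat 1 :: complex ^ 'n ^ 'n) * ((C * K * \<bar>R\<bar>) ^ k / fact k)" for k
  have "summable M"
    unfolding M_def using summable_exp[of "C * K * \<bar>R\<bar>"]
    by (intro summable_mult) (simp add: field_simps)
  moreover have "norm (picard A k x z) \<le> M k" if "\<bar>x\<bar> \<le> R" "norm z \<le> R" for x z k
  proof -
    have "norm (picard A k x z) \<le> norm (mat 1 :: complex ^ 'n ^ 'n) * (C * K) ^ k / fact k * \<bar>x\<bar> ^ k"
      using that C' C(1) by (intro picard_bound[OF c K(2,1)]) auto
    also have "\<dots> \<le> norm (mat 1 :: complex ^ 'n ^ 'n) * (C * K) ^ k / fact k * \<bar>R\<bar> ^ k"
      using that C(1) K(1) by (intro mult_left_mono power_mono) auto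
    also have "\<dots> = M k" by (simp add: M_def power_mult_distrib)
    finally show ?thesis .
  qed
  ultimately show ?thesis using C(1) K C' by (intro that[of M C K]) auto
qed

lemma fundamental_0 [simp]: "fundamental A 0 z = mat 1"
proof -
  have "picard A k 0 z = (if k = 0 then mat 1 else 0)" for k
    by (cases k) auto
  then have "(\<lambda>k. picard A k 0 z) sums (\<Sum>k\<in>{0}. picard A k 0 z)"
    by (intro sums_finite) auto
  then show ?thesis by (simp add: fundamental_def sums_iff)
qed

text \<open>The formally differentiated series is \<open>A\<close> times the series itself, and it converges
  uniformly on a neighbourhood of \<open>x\<close>, which justifies differentiation term by term.\<close>

lemma fundamental_deriv:
  fixes A :: "real \<Rightarrow> complex \<Rightarrow> complex ^ 'n ^ 'n"
  assumes c: "continuous_on UNIV (\<lambda>p. A (fst p) (snd p))"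
  shows "((\<lambda>x. fundamental A x z) has_vector_derivative A x z ** fundamental A x z) (at x)"
proof -
  define R where "R = \<bar>x\<bar> + norm z + 1"
  obtain M C K where M: "summable M" "0 < C" "0 \<le> K"
      "\<forall>(a :: complex ^ 'n ^ 'n) (b :: complex ^ 'n ^ 'n). norm (a ** b) \<le> norm a * norm b * K"
      "\<forall>x z. \<bar>x\<bar> \<le> R \<longrightarrow> norm z \<le> R \<longrightarrow> norm (A x z) \<le> C"
      "\<forall>x z k. \<bar>x\<bar> \<le> R \<longrightarrow> norm z \<le> R \<longrightarrow> norm (picard A k x z) \<le> M k"
    by (rule picard_bound_summable[OF c, of R]) (rule that)
  define S where "S = {-R<..<R}"
  have xR: "\<bar>x\<bar> < R" by (simp add: R_def add_nonneg_pos)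
  then have Rpos: "0 < R" by linarith
  have zR: "norm z \<le> R" by (simp add: R_def)
  have summ: "summable (\<lambda>k. picard A k y z)" if "\<bar>y\<bar> \<le> R" for y
    using M(6)[rule_format, OF that zR] by (intro summable_comparison_test[OF _ M(1)]) blast
  \<comment> \<open>\<open>d k\<close> is the derivative of the \<open>k\<close>-th Picard term: it vanishes for the constant term.\<close>
  define d where "d k y = (case k of 0 \<Rightarrow> 0 | Suc j \<Rightarrow> A y z ** picard A j y z)" for k y
  define N where "N k = (case k of 0 \<Rightarrow> 0 | Suc j \<Rightarrow> C * M j * K)" for k
  have "summable N"
    by (subst summable_Suc_iff[symmetric]) (auto simp: N_def intro!: summable_mult2 summable_mult M(1))
  moreover have "norm (d k y) \<le> N k" if "y \<in> S" for k y
  proof (cases k)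
    case (Suc j)
    have "norm (A y z ** picard A j y z) \<le> norm (A y z) * norm (picard A j y z) * K" using M(4) by blast
    also have "\<dots> \<le> C * M j * K"
    proof -
      have "norm (A y z) \<le> C" "norm (picard A j y z) \<le> M j"
        using M(5,6) that zR by (auto simp: S_def abs_le_iff)
      then show ?thesis using less_imp_le[OF M(2)] M(3)
        by (intro mult_mono mult_nonneg_nonneg order_trans[OF norm_ge_zero \<open>norm (picard A j y z) \<le> M j\<close>]) auto
    qed
    finally show ?thesis using Suc by (simp add: d_def N_def)
  qed (simp add: d_def N_def)
  ultimately have ul: "uniform_limit S (\<lambda>n y. \<Sum>k<n. d k y) (\<lambda>y. \<Sum>k. d k y) sequentially"
    by (intro Weierstrass_m_test)
  have lim: "(\<Sum>k. d k y) = A y z ** fundamental A y z" if "y \<in> S" for y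
  proof -
    have s: "(\<lambda>j. A y z ** picard A j y z) sums (A y z ** fundamental A y z)"
      unfolding fundamental_def
      by (intro bounded_linear.sums[OF mmm.bounded_linear_right] summable_sums summ) (use that in \<open>auto simp: S_def\<close>)
    then have "(\<lambda>j. d (Suc j) y) sums (A y z ** fundamental A y z)" by (simp add: d_def)
    then have "(\<lambda>j. d j y) sums (A y z ** fundamental A y z + d 0 y)" by (rule sums_Suc)
    then show ?thesis by (simp add: d_def sums_iff)
  qed
  have "\<exists>g. \<forall>y\<in>S. (\<lambda>k. picard A k y z) sums g y \<and>
      (g has_derivative (\<lambda>h. h *\<^sub>R (A y z ** fundamental A y z))) (at y within S)"
  proof (rule has_derivative_series)
    show "convex S" by (simp add: S_def)
    show "0 \<in> S" using Rpos by (simp add: S_def)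
    then show "(\<lambda>k. picard A k 0 z) sums (\<Sum>k. picard A k 0 z)"
      by (intro summable_sums summ) (simp add: R_def)
    show "((\<lambda>y. picard A k y z) has_derivative (\<lambda>h. h *\<^sub>R d k y)) (at y within S)" for k y
    proof (cases k)
      case (Suc j)
      have "continuous_on UNIV (\<lambda>s. A s z ** picard A j s z)"
        by (intro mmm.continuous_on continuous_on_curried[OF c] continuous_on_curried[OF picard_continuous[OF c]]
            continuous_intros)
      from antideriv_deriv[OF this, of y] show ?thesis
        by (simp add: Suc d_def has_vector_derivative_def has_derivative_at_withinI)
    qed (simp add: d_def)
    fix e :: real assume "e > 0"
    with ul have "\<forall>\<^sub>F n in sequentially. \<forall>y\<in>S. dist (\<Sum>k<n. d k y) (\<Sum>k. d k y) < e"
      by (simp add: uniform_limit_iff)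
    then show "\<forall>\<^sub>F n in sequentially. \<forall>y\<in>S. \<forall>h. norm ((\<Sum>k<n. h *\<^sub>R d k y) - h *\<^sub>R (A y z ** fundamental A y z)) \<le> e * norm h"
    proof eventually_elim
      case (elim n)
      show ?case
      proof (intro ballI allI)
        fix y and h :: real assume y: "y \<in> S"
        have "(\<Sum>k<n. h *\<^sub>R d k y) - h *\<^sub>R (A y z ** fundamental A y z) = h *\<^sub>R ((\<Sum>k<n. d k y) - (\<Sum>k. d k y))"
          by (simp add: lim[OF y] scaleR_diff_right scaleR_sum_right)
        then show "norm ((\<Sum>k<n. h *\<^sub>R d k y) - h *\<^sub>R (A y z ** fundamental A y z)) \<le> e * norm h"
          using mult_right_mono[OF less_imp_le[OF bspec[OF elim y]], of "\<bar>h\<bar>"]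
          by (simp add: dist_norm mult.commute)
      qed
    qed
  qed
  then obtain g where g: "\<And>y. y \<in> S \<Longrightarrow> (\<lambda>k. picard A k y z) sums g y"
     "\<And>y. y \<in> S \<Longrightarrow> (g has_derivative (\<lambda>h. h *\<^sub>R (A y z ** fundamental A y z))) (at y within S)"
    by blast
  have xS: "x \<in> S" "open S" using xR by (auto simp: S_def)
  have "(g has_vector_derivative A x z ** fundamental A x z) (at x)"
    using g(2)[OF xS(1)] at_within_open[OF xS] by (simp add: has_vector_derivative_def)
  then show ?thesis
    by (rule has_vector_derivative_transform_within_open[OF _ xS(2,1)])
       (use g(1) in \<open>simp add: fundamental_def sums_iff\<close>)
qed

lemma fundamental_holomorphic:
  fixes A :: "real \<Rightarrow> complex \<Rightarrow> complex ^ 'n ^ 'n"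
  assumes c: "continuous_on UNIV (\<lambda>p. A (fst p) (snd p))"
    and h: "\<And>x. mat_holomorphic_on (A x) UNIV"
  shows "mat_holomorphic_on (fundamental A x) UNIV"
  unfolding mat_holomorphic_on_def
proof (intro allI)
  fix i j
  show "(\<lambda>z. fundamental A x z $ i $ j) holomorphic_on UNIV"
  proof (rule holomorphic_uniform_sequence)
    show "(\<lambda>z. \<Sum>k<n. picard A k x z $ i $ j) holomorphic_on UNIV" for n
      using picard_holomorphic[OF c h] by (auto simp: mat_holomorphic_on_def intro!: holomorphic_intros)
    fix z :: complex
    define R where "R = \<bar>x\<bar> + norm z + 1"
    obtain M C K where M: "summable M" "0 < C" "0 \<le> K"
      "\<forall>(a :: complex ^ 'n ^ 'n) (b :: complex ^ 'n ^ 'n). norm (a ** b) \<le> norm a * norm b * K"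
      "\<forall>x z. \<bar>x\<bar> \<le> R \<longrightarrow> norm z \<le> R \<longrightarrow> norm (A x z) \<le> C"
      "\<forall>x z k. \<bar>x\<bar> \<le> R \<longrightarrow> norm z \<le> R \<longrightarrow> norm (picard A k x z) \<le> M k"
    by (rule picard_bound_summable[OF c, of R]) (rule that)
    have w: "\<bar>x\<bar> \<le> R" "norm w \<le> R" if "w \<in> cball z 1" for w
    proof -
      show "\<bar>x\<bar> \<le> R" by (simp add: R_def)
      have "norm w \<le> norm z + dist z w" by (metis dist_norm norm_minus_commute norm_triangle_sub)
      then show "norm w \<le> R" using that by (simp add: R_def)
    qed
    have "uniform_limit (cball z 1) (\<lambda>n z. \<Sum>k<n. picard A k x z $ i $ j) (\<lambda>z. \<Sum>k. picard A k x z $ i $ j) sequentially"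
    proof (rule Weierstrass_m_test[OF _ M(1)])
      fix k w assume "w \<in> cball z 1"
      then have "norm (picard A k x w) \<le> M k" using M(6) w by blast
      then show "norm (picard A k x w $ i $ j) \<le> M k"
        using Finite_Cartesian_Product.norm_nth_le order_trans by metis
    qed
    moreover have "(\<Sum>k. picard A k x w $ i $ j) = fundamental A x w $ i $ j" if "w \<in> cball z 1" for w
    proof -
      have "summable (\<lambda>k. picard A k x w)"
        using M(6)[rule_format, OF w[OF that]] by (intro summable_comparison_test[OF _ M(1)]) blast
      then have "(\<lambda>k. picard A k x w) sums fundamental A x w" by (simp add: fundamental_def summable_sums)
      from bounded_linear.sums[OF bounded_linear_compose[OF bounded_linear_vec_nth bounded_linear_vec_nth] this]
      show ?thesis by (simp add: sums_iff)
    qed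
    ultimately have "uniform_limit (cball z 1) (\<lambda>n z. \<Sum>k<n. picard A k x z $ i $ j) (\<lambda>z. fundamental A x z $ i $ j) sequentially"
      by (subst uniform_limit_cong'[where i="\<lambda>z. \<Sum>k. picard A k x z $ i $ j"]) auto
    then show "\<exists>d>0. cball z d \<subseteq> UNIV \<and>
        uniform_limit (cball z d) (\<lambda>n z. \<Sum>k<n. picard A k x z $ i $ j) (\<lambda>z. fundamental A x z $ i $ j) sequentially"
      by (intro exI[of _ 1]) auto
  qed simp
qed

text \<open>The inverse of the fundamental matrix, obtained from the adjoint system \<open>\<Psi>' = - \<Psi>
  A\<close>. Defined in this way it is holomorphic in \<open>z\<close> for the same reason as the
  fundamental matrix.\<close>

definition fundamental_inv ::
  "(real \<Rightarrow> complex \<Rightarrow> complex ^ 'n ^ 'n) \<Rightarrow> real \<Rightarrow> complex \<Rightarrow> complex ^ 'n ^ 'n" where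
  "fundamental_inv A x z = transpose (fundamental (\<lambda>x z. - transpose (A x z)) x z)"

lemma bounded_linear_transpose: "bounded_linear (transpose :: complex^'n^'m \<Rightarrow> complex^'m^'n)"
  unfolding linear_conv_bounded_linear[symmetric]
  by (auto simp: linear_iff transpose_def vec_eq_iff)

lemma transpose_uminus: "transpose (- A) = - transpose (A :: complex^'n^'m)"
  by (simp add: transpose_def vec_eq_iff)

lemma fundamental_inv_0 [simp]: "fundamental_inv A 0 z = mat 1"
  by (simp add: fundamental_inv_def transpose_mat)

lemma fundamental_inv_deriv:
  assumes c: "continuous_on UNIV (\<lambda>p. A (fst p) (snd p))"
  shows "((\<lambda>x. fundamental_inv A x z) has_vector_derivative - (fundamental_inv A x z ** A x z)) (at x)"
proof -
  have "continuous_on UNIV (\<lambda>p. - transpose (A (fst p) (snd p)))"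
    by (intro continuous_intros bounded_linear.continuous_on[OF bounded_linear_transpose] c)
  from bounded_linear.has_vector_derivative[OF bounded_linear_transpose fundamental_deriv[OF this, of z x]]
  show ?thesis by (simp add: fundamental_inv_def matrix_transpose_mul transpose_uminus mmm.minus_right)
qed

lemma fundamental_inv_holomorphic:
  assumes c: "continuous_on UNIV (\<lambda>p. A (fst p) (snd p))"
    and h: "\<And>x. mat_holomorphic_on (A x) UNIV"
  shows "mat_holomorphic_on (fundamental_inv A x) UNIV"
proof -
  have "continuous_on UNIV (\<lambda>p. - transpose (A (fst p) (snd p)))"
    by (intro continuous_intros bounded_linear.continuous_on[OF bounded_linear_transpose] c)
  moreover have "mat_holomorphic_on (\<lambda>z. - transpose (A x z)) UNIV" for x
    using h[of x] by (auto simp: mat_holomorphic_on_def transpose_def intro!: holomorphic_intros)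
  ultimately have "mat_holomorphic_on (fundamental (\<lambda>x z. - transpose (A x z)) x) UNIV"
    by (rule fundamental_holomorphic)
  then show ?thesis by (auto simp: mat_holomorphic_on_def fundamental_inv_def transpose_def)
qed

lemma has_vector_derivative_0_imp_const:
  fixes f :: "real \<Rightarrow> 'a::real_normed_vector"
  assumes "convex S" "open S" and "\<And>x. x \<in> S \<Longrightarrow> (f has_vector_derivative 0) (at x)" and "x \<in> S" "y \<in> S"
  shows "f x = f y"
proof -
  have "(f has_derivative (\<lambda>h. 0)) (at t within S)" if "t \<in> S" for t
    using assms(3)[OF that] by (simp add: has_vector_derivative_def has_derivative_at_withinI)
  then obtain c where "\<And>t. t \<in> S \<Longrightarrow> f t = c"
    using has_derivative_zero_constant[OF assms(1)] by blast
  then show ?thesis using assms by simp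
qed

text \<open>The product \<open>\<Psi> \<Phi>\<close> has derivative \<open>- \<Psi> A \<Phi> + \<Psi> A \<Phi>
  = 0\<close>.\<close>

lemma fundamental_inverse:
  assumes c: "continuous_on UNIV (\<lambda>p. A (fst p) (snd p))"
  shows "fundamental_inv A x z ** fundamental A x z = mat 1"
    and "fundamental A x z ** fundamental_inv A x z = mat 1"
proof -
  have "((\<lambda>x. fundamental_inv A x z ** fundamental A x z) has_vector_derivative 0) (at x)" for x
    using mmm.has_vector_derivative[OF fundamental_inv_deriv[OF c, of z x] fundamental_deriv[OF c, of z x]]
    by (simp add: mmm.minus_left matrix_mul_assoc)
  then have "fundamental_inv A x z ** fundamental A x z = fundamental_inv A 0 z ** fundamental A 0 z"
    by (intro has_vector_derivative_0_imp_const[of UNIV]) auto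
  then show 1: "fundamental_inv A x z ** fundamental A x z = mat 1" by simp
  then show "fundamental A x z ** fundamental_inv A x z = mat 1"
    by (simp add: matrix_left_right_inverse)
qed

text \<open>For a solution \<open>K\<close> the product \<open>\<Psi> K\<close> is constant. Working on an
  open interval covers Green's functions, which solve the system on one side of \<open>y\<close>
  only.\<close>

lemma fundamental_solution_unique:
  fixes K :: "real \<Rightarrow> complex ^ 'm ^ 'n"
  assumes c: "continuous_on UNIV (\<lambda>p. A (fst p) (snd p))"
    and S: "convex S" "open S" "x0 \<in> S"
    and K: "\<And>x. x \<in> S \<Longrightarrow> (K has_vector_derivative A x z ** K x) (at x)"
    and x: "x \<in> S"
  shows "K x = fundamental A x z ** (fundamental_inv A x0 z ** K x0)"
proof -
  have "((\<lambda>x. fundamental_inv A x z ** K x) has_vector_derivative 0) (at x)" if "x \<in> S" for x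
    using mmm.has_vector_derivative[OF fundamental_inv_deriv[OF c, of z x] K[OF that]]
    by (simp add: mmm.minus_left matrix_mul_assoc)
  then have "fundamental_inv A x z ** K x = fundamental_inv A x0 z ** K x0"
    using S x by (intro has_vector_derivative_0_imp_const[of S]) auto
  then have "fundamental A x z ** (fundamental_inv A x z ** K x) = fundamental A x z ** (fundamental_inv A x0 z ** K x0)"
    by simp
  then show ?thesis by (simp add: matrix_mul_assoc fundamental_inverse[OF c])
qed

lemma fundamental_vec_deriv:
  assumes c: "continuous_on UNIV (\<lambda>p. A (fst p) (snd p))"
  shows "((\<lambda>x. fundamental A x z *v v) has_vector_derivative A x z *v (fundamental A x z *v v)) (at x)"
  using bounded_linear.has_vector_derivative[OF mvm.bounded_linear_left fundamental_deriv[OF c, of z x]]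
  by (simp add: matrix_vector_mul_assoc)

lemma fundamental_vec_continuous:
  assumes c: "continuous_on UNIV (\<lambda>p. A (fst p) (snd p))"
  shows "continuous_on UNIV (\<lambda>x. fundamental A x z *v v)"
  by (intro continuous_at_imp_continuous_on ballI has_vector_derivative_continuous[OF fundamental_vec_deriv[OF c]])

section \<open>Smooth plateau functions and distributional solutions\<close>

text \<open>For \<open>p = 1\<close> this is the classical smooth function that is flat at \<open>0\<close>.
  The polynomial factors make the family closed under differentiation.\<close>

definition flat :: "real poly \<Rightarrow> real \<Rightarrow> real" where
  "flat p x = (if 0 < x then poly p (1 / x) * exp (- (1 / x)) else 0)"

lemma poly_times_exp_minus_tendsto_0:
  "((\<lambda>t::real. poly p t * exp (- t)) \<longlongrightarrow> 0) at_top"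
proof -
  have "((\<lambda>t::real. \<Sum>i\<le>degree p. coeff p i * (t ^ i / exp t)) \<longlongrightarrow> (\<Sum>i\<le>degree p. coeff p i * 0)) at_top"
    by (intro tendsto_sum tendsto_mult tendsto_const tendsto_power_div_exp_0)
  then show ?thesis
    by (simp add: poly_altdef exp_minus divide_inverse sum_distrib_right mult.assoc)
qed

lemma flat_deriv:
  "(flat p has_field_derivative flat ([:0, 0, 1:] * (p - pderiv p)) x) (at x)"
proof (cases x "0::real" rule: linorder_cases)
  case less
  have "((\<lambda>x. 0) has_field_derivative flat ([:0, 0, 1:] * (p - pderiv p)) x) (at x)"
    using less by (simp add: flat_def)
  then show ?thesis
    by (rule has_field_derivative_transform_within_open[where S="{..<0}"]) (use less in \<open>auto simp: flat_def\<close>)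
next
  case greater
  have "((\<lambda>x. poly p (1 / x) * exp (- (1 / x))) has_field_derivative flat ([:0, 0, 1:] * (p - pderiv p)) x) (at x)"
    using greater unfolding flat_def
    by (auto intro!: derivative_eq_intros DERIV_chain2[OF poly_DERIV] simp: field_simps power2_eq_square)
  then show ?thesis
    by (rule has_field_derivative_transform_within_open[where S="{0<..}"]) (use greater in \<open>auto simp: flat_def\<close>)
next
  case equal
  have 1: "((\<lambda>h. poly ([:0, 1:] * p) (inverse h) * exp (- inverse h)) \<longlongrightarrow> 0) (at_right 0)"
    using filterlim_compose[OF poly_times_exp_minus_tendsto_0 filterlim_inverse_at_top_right] .
  have "((\<lambda>h. flat p h / h) \<longlongrightarrow> 0) (at_right 0)"
    by (rule Lim_transform_eventually[OF 1])
       (auto simp: eventually_at_right_field flat_def field_simps intro!: exI[of _ 1])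
  moreover have "((\<lambda>h. flat p h / h) \<longlongrightarrow> 0) (at_left 0)"
    by (rule tendsto_eventually) (auto simp: eventually_at_left_field flat_def intro!: exI[of _ "-1"])
  ultimately have "((\<lambda>h. flat p h / h) \<longlongrightarrow> 0) (at 0)"
    by (simp add: filterlim_at_split)
  then show ?thesis using equal by (simp add: has_field_derivative_iff flat_def)
qed

text \<open>A set of functions that is closed under differentiation consists of smooth functions. It contains
  all the cut-off functions used below.\<close>

inductive_set smooth_alg :: "(real \<Rightarrow> real) set" where
  flat: "(\<lambda>x. flat p (a * x + b)) \<in> smooth_alg"
| const: "(\<lambda>x. c) \<in> smooth_alg"
| add: "f \<in> smooth_alg \<Longrightarrow> g \<in> smooth_alg \<Longrightarrow> (\<lambda>x. f x + g x) \<in> smooth_alg"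
| mult: "f \<in> smooth_alg \<Longrightarrow> g \<in> smooth_alg \<Longrightarrow> (\<lambda>x. f x * g x) \<in> smooth_alg"
| inverse: "f \<in> smooth_alg \<Longrightarrow> (\<And>x. f x \<noteq> 0) \<Longrightarrow> (\<lambda>x. inverse (f x)) \<in> smooth_alg"

lemma smooth_alg_deriv:
  "f \<in> smooth_alg \<Longrightarrow> \<exists>f'\<in>smooth_alg. \<forall>x. (f has_field_derivative f' x) (at x)"
proof (induction rule: smooth_alg.induct)
  case (flat p a b)
  have "((\<lambda>x. flat p (a * x + b)) has_field_derivative
      flat ([:0, 0, 1:] * (p - pderiv p)) (a * x + b) * a) (at x)" for x
    by (rule DERIV_chain2[OF flat_deriv]) (auto intro!: derivative_eq_intros)
  moreover have "(\<lambda>x. flat ([:0, 0, 1:] * (p - pderiv p)) (a * x + b) * a) \<in> smooth_alg"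
    by (intro smooth_alg.intros)
  ultimately show ?case by (intro bexI[rotated]) auto
next
  case (const c)
  show ?case by (intro bexI[OF _ smooth_alg.const[of 0]]) auto
next
  case (add f g)
  then obtain f' g' where "f' \<in> smooth_alg" "g' \<in> smooth_alg" "\<forall>x. (f has_field_derivative f' x) (at x)"
    "\<forall>x. (g has_field_derivative g' x) (at x)" by blast
  then show ?case by (intro bexI[of _ "\<lambda>x. f' x + g' x"] smooth_alg.intros) (auto intro!: derivative_eq_intros)
next
  case (mult f g)
  then obtain f' g' where "f' \<in> smooth_alg" "g' \<in> smooth_alg" "\<forall>x. (f has_field_derivative f' x) (at x)"
    "\<forall>x. (g has_field_derivative g' x) (at x)" by blast
  then show ?case using mult.hyps
    by (intro bexI[of _ "\<lambda>x. f' x * g x + f x * g' x"] smooth_alg.intros)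
       (auto intro!: derivative_eq_intros simp: mult.commute)
next
  case (inverse f)
  then obtain f' where f': "f' \<in> smooth_alg" "\<forall>x. (f has_field_derivative f' x) (at x)" by blast
  have "(\<lambda>x. (-1) * (inverse (f x) * (f' x * inverse (f x)))) \<in> smooth_alg"
    using inverse f' by (intro smooth_alg.intros) auto
  moreover have "\<forall>x. ((\<lambda>x. inverse (f x)) has_field_derivative (-1) * (inverse (f x) * (f' x * inverse (f x)))) (at x)"
    using f' inverse by (auto intro!: derivative_eq_intros)
  ultimately show ?case by (intro bexI[rotated]) auto
qed

lemma smooth_alg_deriv_in: "f \<in> smooth_alg \<Longrightarrow> deriv f \<in> smooth_alg"
  and smooth_alg_has_deriv: "f \<in> smooth_alg \<Longrightarrow> (f has_field_derivative deriv f x) (at x)"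
proof -
  have "deriv f = f'" if "\<forall>x. (f has_field_derivative f' x) (at x)" for f f' :: "real \<Rightarrow> real"
    using that DERIV_imp_deriv by blast
  then show "f \<in> smooth_alg \<Longrightarrow> deriv f \<in> smooth_alg"
    "f \<in> smooth_alg \<Longrightarrow> (f has_field_derivative deriv f x) (at x)"
    using smooth_alg_deriv by blast+
qed

lemma smooth_alg_test_fun:
  assumes "f \<in> smooth_alg" "bounded {x. f x \<noteq> 0}"
  shows "test_fun f"
proof -
  have "(deriv ^^ k) f \<in> smooth_alg" for k
    by (induction k) (use assms smooth_alg_deriv_in in auto)
  then show ?thesis
    using assms smooth_alg_has_deriv field_differentiable_def unfolding test_fun_def by blast
qed

text \<open>A smooth transition from \<open>0\<close> on the negative axis to \<open>1\<close> on \<open>[1,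
  \<infinity>)\<close>.\<close>

definition smooth_step :: "real \<Rightarrow> real" where
  "smooth_step x = flat 1 x * inverse (flat 1 x + flat 1 (1 - x))"

lemma flat_1: "0 \<le> flat 1 x" "0 < x \<Longrightarrow> 0 < flat 1 x" "x \<le> 0 \<Longrightarrow> flat 1 x = 0"
  by (auto simp: flat_def)

lemma flat_1_sum_pos: "0 < flat 1 x + flat 1 (1 - x)"
  using flat_1[of x] flat_1[of "1 - x"] by (cases "0 < x") (auto intro: add_pos_nonneg add_nonneg_pos)

lemma smooth_step_smooth: "(\<lambda>x. smooth_step (c * x + d)) \<in> smooth_alg"
proof -
  have "(\<lambda>x. flat 1 (c * x + d) * inverse (flat 1 (c * x + d) + flat 1 ((- c) * x + (1 - d)))) \<in> smooth_alg"
  proof (intro smooth_alg.intros)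
    show "flat 1 (c * x + d) + flat 1 (- c * x + (1 - d)) \<noteq> 0" for x
      using flat_1_sum_pos[of "c * x + d"] by (simp add: algebra_simps)
  qed
  then show ?thesis by (simp add: smooth_step_def algebra_simps)
qed

lemma smooth_step_0: "x \<le> 0 \<Longrightarrow> smooth_step x = 0"
  and smooth_step_1: "1 \<le> x \<Longrightarrow> smooth_step x = 1"
  and smooth_step_bounds: "0 \<le> smooth_step x" "smooth_step x \<le> 1"
proof -
  show "x \<le> 0 \<Longrightarrow> smooth_step x = 0" by (simp add: smooth_step_def flat_1)
  show "1 \<le> x \<Longrightarrow> smooth_step x = 1"
    using flat_1(2)[of x] by (simp add: smooth_step_def flat_1(3))
  show "0 \<le> smooth_step x" "smooth_step x \<le> 1"
    using flat_1_sum_pos[of x] flat_1[of x] flat_1[of "1 - x"]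
    by (auto simp: smooth_step_def field_simps)
qed

lemma smooth_step_deriv: "(smooth_step has_field_derivative deriv smooth_step x) (at x)"
  using smooth_alg_has_deriv[OF smooth_step_smooth[of 1 0]] by simp

lemma smooth_step_deriv_cont: "continuous_on UNIV (deriv smooth_step)"
proof -
  have "deriv smooth_step \<in> smooth_alg"
    using smooth_alg_deriv_in[OF smooth_step_smooth[of 1 0]] by simp
  then show ?thesis
    using smooth_alg_has_deriv by (meson DERIV_isCont continuous_at_imp_continuous_on)
qed

lemma smooth_step_deriv_0:
  assumes "x \<notin> {0..1}" shows "deriv smooth_step x = 0"
proof (rule DERIV_imp_deriv)
  consider "x < 0" | "1 < x" using assms by fastforce
  then show "(smooth_step has_field_derivative 0) (at x)"
  proof cases
    case 1
    have "((\<lambda>x. 0) has_field_derivative (0::real)) (at x)" by simp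
    then show ?thesis
      by (rule has_field_derivative_transform_within_open[where S="{..<0}"]) (use 1 in \<open>auto simp: smooth_step_0\<close>)
  next
    case 2
    have "((\<lambda>x. 1) has_field_derivative (0::real)) (at x)" by simp
    then show ?thesis
      by (rule has_field_derivative_transform_within_open[where S="{1<..}"]) (use 2 in \<open>auto simp: smooth_step_1\<close>)
  qed
qed

lemma smooth_step_deriv_integral: "(LINT x|lborel. deriv smooth_step x) = 1"
proof -
  have "(LINT x|lborel. indicator {0..1} x *\<^sub>R deriv smooth_step x) = smooth_step 1 - smooth_step 0"
    by (rule integral_FTC_Icc)
       (use smooth_step_deriv continuous_on_subset[OF smooth_step_deriv_cont] in
         \<open>auto simp: has_real_derivative_iff_has_vector_derivative intro: has_vector_derivative_at_within\<close>)
  moreover have "(\<lambda>x. indicator {0..1} x *\<^sub>R deriv smooth_step x) = deriv smooth_step"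
    using smooth_step_deriv_0 by (auto simp: indicator_def fun_eq_iff)
  ultimately show ?thesis by (simp add: smooth_step_0 smooth_step_1 del: real_scaleR_def)
qed

lemma integrable_scaleR_compact_support:
  fixes K :: "real \<Rightarrow> 'b::euclidean_space"
  assumes K: "set_integrable lborel {c..d} K" and g: "continuous_on UNIV g"
    and z: "\<And>x. x \<notin> {c..d} \<Longrightarrow> g x = 0"
  shows "integrable lborel (\<lambda>x. g x *\<^sub>R K x)"
proof -
  have "bounded (g ` {c..d})"
    by (intro compact_imp_bounded compact_continuous_image continuous_on_subset[OF g]) auto
  then obtain M where M: "\<forall>x\<in>{c..d}. \<bar>g x\<bar> \<le> M" "0 < M"
    unfolding bounded_pos by auto
  have K': "integrable lborel (\<lambda>x. indicator {c..d} x *\<^sub>R K x)"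
    using K by (simp add: set_integrable_def)
  have "integrable lborel (\<lambda>x. g x *\<^sub>R (indicator {c..d} x *\<^sub>R K x))"
  proof (rule Bochner_Integration.integrable_bound)
    show "integrable lborel (\<lambda>x. M *\<^sub>R (indicator {c..d} x *\<^sub>R K x))"
      using K' by (rule integrable_scaleR_right)
    have "g \<in> borel_measurable borel" using g by (rule borel_measurable_continuous_onI)
    then show "(\<lambda>x. g x *\<^sub>R (indicator {c..d} x *\<^sub>R K x)) \<in> borel_measurable lborel"
      using borel_measurable_integrable[OF K'] by measurable
    show "AE x in lborel. norm (g x *\<^sub>R (indicator {c..d} x *\<^sub>R K x)) \<le> norm (M *\<^sub>R (indicator {c..d} x *\<^sub>R K x))"
      using M by (auto simp: indicator_def intro!: mult_right_mono)
  qed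
  moreover have "(\<lambda>x. g x *\<^sub>R (indicator {c..d} x *\<^sub>R K x)) = (\<lambda>x. g x *\<^sub>R K x)"
    using z by (auto simp: indicator_def fun_eq_iff)
  ultimately show ?thesis by (simp only:)
qed

text \<open>The derivatives of steep steps at \<open>a\<close> form an approximate identity: they have
  integral \<open>1\<close> and live on \<open>[a, a + e n]\<close>. After the substitution \<open>x
  = a + e n s\<close> the claim is dominated convergence; the radius \<open>\<delta>\<close> is the
  one on which continuity bounds \<open>K\<close>.\<close>

lemma mollified_value_tendsto:
  fixes K :: "real \<Rightarrow> 'b::euclidean_space"
  assumes K: "K \<in> borel_measurable borel" and c: "isCont K a"
  shows "\<exists>\<delta>>0. \<forall>e. (\<forall>n. 0 < e n \<and> e n < \<delta>) \<and> e \<longlonglongrightarrow> 0 \<longrightarrow>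
    (\<lambda>n. LINT x|lborel. (deriv smooth_step ((x - a) / e n) / e n) *\<^sub>R K x) \<longlonglongrightarrow> K a"
proof -
  have "eventually (\<lambda>x. dist (K x) (K a) < 1) (at a)"
    using c unfolding isCont_def by (rule tendstoD) simp
  then obtain \<delta> where d: "\<delta> > 0" "\<And>x. x \<noteq> a \<Longrightarrow> dist x a < \<delta> \<Longrightarrow> dist (K x) (K a) < 1"
    unfolding eventually_at by blast
  have near: "norm (K x) \<le> norm (K a) + 1" if "dist x a < \<delta>" for x
  proof (cases "x = a")
    case False
    then show ?thesis using d(2)[OF False that] norm_triangle_ineq2[of "K x" "K a"] by (simp add: dist_norm)
  qed simp
  have "bounded (deriv smooth_step ` {0..1})"
    by (intro compact_imp_bounded compact_continuous_image continuous_on_subset[OF smooth_step_deriv_cont]) auto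
  then obtain M where M: "\<forall>x\<in>{0..1}. \<bar>deriv smooth_step x\<bar> \<le> M" "0 < M"
    unfolding bounded_pos by auto
  have meas: "deriv smooth_step \<in> borel_measurable borel"
    using smooth_step_deriv_cont by (rule borel_measurable_continuous_onI)
  have "(\<lambda>n. LINT x|lborel. (deriv smooth_step ((x - a) / e n) / e n) *\<^sub>R K x) \<longlonglongrightarrow> K a"
    if e: "\<And>n. 0 < e n" "\<And>n. e n < \<delta>" "e \<longlonglongrightarrow> 0" for e
  proof -
    have sub: "(LINT x|lborel. (deriv smooth_step ((x - a) / e n) / e n) *\<^sub>R K x)
        = (LINT s|lborel. deriv smooth_step s *\<^sub>R K (a + e n * s))" for n
      using e(1)[of n]
      by (subst lborel_integral_real_affine[where c="e n" and t=a]) (auto simp flip: integral_scaleR_right)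
    have "(\<lambda>n. LINT s|lborel. deriv smooth_step s *\<^sub>R K (a + e n * s)) \<longlonglongrightarrow> (LINT s|lborel. deriv smooth_step s *\<^sub>R K a)"
    proof (rule integral_dominated_convergence)
      show "integrable lborel (\<lambda>s::real. indicator {0..1} s *\<^sub>R (M * (norm (K a) + 1)))"
        by (intro integrable_scaleR_left integrable_real_indicator) (auto simp: emeasure_lborel_Icc_eq)
      show "(\<lambda>s. deriv smooth_step s *\<^sub>R K a) \<in> borel_measurable lborel"
        using meas by simp
      show "(\<lambda>s. deriv smooth_step s *\<^sub>R K (a + e n * s)) \<in> borel_measurable lborel" for n
        using meas K by simp
      show "AE s in lborel. (\<lambda>n. deriv smooth_step s *\<^sub>R K (a + e n * s)) \<longlonglongrightarrow> deriv smooth_step s *\<^sub>R K a"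
      proof (intro AE_I2 tendsto_scaleR tendsto_const)
        fix s
        have "(\<lambda>n. a + e n * s) \<longlonglongrightarrow> a + 0 * s"
          by (intro tendsto_intros e)
        then show "(\<lambda>n. K (a + e n * s)) \<longlonglongrightarrow> K a"
          using isCont_tendsto_compose[OF c] by simp
      qed
      show "AE s in lborel. norm (deriv smooth_step s *\<^sub>R K (a + e n * s)) \<le> indicator {0..1} s *\<^sub>R (M * (norm (K a) + 1))" for n
      proof (rule AE_I2)
        fix s
        show "norm (deriv smooth_step s *\<^sub>R K (a + e n * s)) \<le> indicator {0..1} s *\<^sub>R (M * (norm (K a) + 1))"
        proof (cases "s \<in> {0..1}")
          case True
          then have "e n * \<bar>s\<bar> \<le> e n"
            using mult_left_mono[of "\<bar>s\<bar>" 1 "e n"] e(1)[of n] by simp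
          moreover have "dist (a + e n * s) a = e n * \<bar>s\<bar>"
            using e(1)[of n] by (simp add: dist_norm abs_mult)
          ultimately have "dist (a + e n * s) a < \<delta>"
            using e(2)[of n] by linarith
          then have "norm (K (a + e n * s)) \<le> norm (K a) + 1" by (rule near)
          then show ?thesis using True M by (auto intro!: mult_mono)
        qed (simp add: smooth_step_deriv_0)
      qed
    qed
    moreover have "integrable lborel (deriv smooth_step)"
      using smooth_step_deriv_integral not_integrable_integral_eq by fastforce
    ultimately show ?thesis using smooth_step_deriv_integral sub by simp
  qed
  then show ?thesis using d(1) by blast
qed

text \<open>The difference of a step up at \<open>a\<close> and a step up at \<open>b\<close> approximates the
  indicator function of \<open>[a, b]\<close> as \<open>e\<close> tends to \<open>0\<close>.\<close>

lemma plateau_test_fun: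
  assumes "0 < e" "a < b"
  shows "test_fun (\<lambda>x. smooth_step ((x - a) / e) - smooth_step ((x - b) / e))"
proof (rule smooth_alg_test_fun)
  have "(\<lambda>x. smooth_step ((1 / e) * x + - a / e) + (-1) * smooth_step ((1 / e) * x + - b / e)) \<in> smooth_alg"
    by (intro smooth_alg.intros smooth_step_smooth)
  then show "(\<lambda>x. smooth_step ((x - a) / e) - smooth_step ((x - b) / e)) \<in> smooth_alg"
    by (simp add: diff_divide_distrib algebra_simps)
  have "{x. smooth_step ((x - a) / e) - smooth_step ((x - b) / e) \<noteq> 0} \<subseteq> {a..b + e}"
  proof
    fix x assume x: "x \<in> {x. smooth_step ((x - a) / e) - smooth_step ((x - b) / e) \<noteq> 0}"
    show "x \<in> {a..b + e}"
    proof (rule ccontr)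
      assume "x \<notin> {a..b + e}"
      then consider "x < a" | "b + e < x" by fastforce
      then show False
      proof cases
        case 1
        then have "(x - a) / e \<le> 0" "(x - b) / e \<le> 0" using assms by (auto simp: divide_nonpos_pos)
        then show False using x by (simp add: smooth_step_0)
      next
        case 2
        then have "1 \<le> (x - a) / e" "1 \<le> (x - b) / e" using assms by (auto simp: le_divide_eq)
        then show False using x by (simp add: smooth_step_1)
      qed
    qed
  qed
  then show "bounded {x. smooth_step ((x - a) / e) - smooth_step ((x - b) / e) \<noteq> 0}"
    using bounded_subset bounded_closed_interval by blast
qed

lemma plateau_deriv:
  assumes "0 < e"
  shows "((\<lambda>x. smooth_step ((x - a) / e) - smooth_step ((x - b) / e)) has_field_derivative
     deriv smooth_step ((x - a) / e) / e - deriv smooth_step ((x - b) / e) / e) (at x)"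
proof -
  have "((\<lambda>x. smooth_step ((x - c) / e)) has_field_derivative deriv smooth_step ((x - c) / e) * (1 / e)) (at x)" for c
    by (rule DERIV_chain2[OF smooth_step_deriv]) (use assms in \<open>auto intro!: derivative_eq_intros\<close>)
  from DERIV_diff[OF this[of a] this[of b]] show ?thesis by simp
qed

lemma smooth_step_affine_tendsto:
  assumes "\<And>n. 0 < e n" "e \<longlonglongrightarrow> 0" "x \<noteq> a"
  shows "(\<lambda>n. smooth_step ((x - a) / e n)) \<longlonglongrightarrow> indicator {a<..} x"
proof (cases "a < x")
  case True
  have "eventually (\<lambda>n. e n < x - a) sequentially"
    using assms(2) True by (intro order_tendstoD) auto
  then have "eventually (\<lambda>n. smooth_step ((x - a) / e n) = 1) sequentially"
    by eventually_elim (use assms(1) in \<open>auto simp: le_divide_eq less_imp_le intro!: smooth_step_1\<close>)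
  then show ?thesis using True tendsto_eventually by fastforce
next
  case False
  then have "smooth_step ((x - a) / e n) = 0" for n
    using assms(1)[of n] by (intro smooth_step_0) (simp add: divide_nonpos_pos)
  then show ?thesis using False assms(3) by simp
qed

text \<open>A weak equation \<open>K' = F + J \<delta>\<close> (with \<open>\<delta>\<close> at
  \<open>y\<close>) in integrated form. Test with plateaus that converge to the indicator function
  of \<open>[a, b]\<close>: the derivative of the plateau picks out \<open>K a - K b\<close>, the
  plateau itself the integral of \<open>F\<close> and, if \<open>y\<close> lies in between, the jump
  \<open>J\<close>.\<close>

lemma weak_equation_increment:
  fixes K F :: "real \<Rightarrow> 'b::euclidean_space"
  assumes weak: "\<And>\<phi>. test_fun \<phi> \<Longrightarrow> (LINT x|lborel. - (deriv \<phi> x *\<^sub>R K x) - \<phi> x *\<^sub>R F x) = \<phi> y *\<^sub>R J"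
    and K: "K \<in> borel_measurable borel" "\<And>c d. set_integrable lborel {c..d} K"
    and F: "\<And>c d. set_integrable lborel {c..d} F"
    and c: "isCont K a" "isCont K b" and ab: "a < b" "a \<noteq> y" "b \<noteq> y"
  shows "K b - K a = (LINT x:{a..b}|lborel. F x) + indicator {a..b} y *\<^sub>R J"
proof -
  obtain \<delta>1 where d1: "\<delta>1 > 0" "\<And>e. (\<And>n. 0 < e n \<and> e n < \<delta>1) \<Longrightarrow> e \<longlonglongrightarrow> 0 \<Longrightarrow>
    (\<lambda>n. LINT x|lborel. (deriv smooth_step ((x - a) / e n) / e n) *\<^sub>R K x) \<longlonglongrightarrow> K a"
    using mollified_value_tendsto[OF K(1) c(1)] by blast
  obtain \<delta>2 where d2: "\<delta>2 > 0" "\<And>e. (\<And>n. 0 < e n \<and> e n < \<delta>2) \<Longrightarrow> e \<longlonglongrightarrow> 0 \<Longrightarrow>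
    (\<lambda>n. LINT x|lborel. (deriv smooth_step ((x - b) / e n) / e n) *\<^sub>R K x) \<longlonglongrightarrow> K b"
    using mollified_value_tendsto[OF K(1) c(2)] by blast
  define d where "d = Min {\<delta>1, \<delta>2, 1}"
  have d: "0 < d" "d \<le> \<delta>1" "d \<le> \<delta>2" "d \<le> 1" using d1 d2 by (auto simp: d_def)
  \<comment> \<open>The shift by two keeps \<open>e n\<close> strictly below \<open>d\<close>.\<close>
  define e where "e n = d * inverse (real (Suc (Suc n)))" for n
  have e_pos: "0 < e n" for n using d by (simp add: e_def)
  have e_lt: "e n < d" for n
    using mult_strict_left_mono[of "inverse (real (Suc (Suc n)))" 1 d] d(1) unfolding e_def
    by (simp add: inverse_less_1_iff)
  have "e \<longlonglongrightarrow> d * 0"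
    unfolding e_def by (intro tendsto_mult tendsto_const LIMSEQ_Suc[OF LIMSEQ_inverse_real_of_nat])
  then have e0: "e \<longlonglongrightarrow> 0" by simp
  define \<phi> where "\<phi> n x = smooth_step ((x - a) / e n) - smooth_step ((x - b) / e n)" for n x
  define h where "h c n x = deriv smooth_step ((x - c) / e n) / e n" for c n x
  have h_cont: "continuous_on UNIV (h c n)" for c n
    unfolding h_def using e_pos[of n]
    by (intro continuous_intros continuous_on_compose2[OF smooth_step_deriv_cont]) auto
  have h_int: "integrable lborel (\<lambda>x. h c n x *\<^sub>R K x)" for c n
  proof (rule integrable_scaleR_compact_support[OF K(2) h_cont])
    fix x assume "x \<notin> {c..c + e n}"
    then have "(x - c) / e n \<notin> {0..1}" using e_pos[of n] by (auto simp: field_simps)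
    then show "h c n x = 0" by (simp add: h_def smooth_step_deriv_0)
  qed
  have \<phi>_der: "deriv (\<phi> n) x = h a n x - h b n x" for n x
    unfolding \<phi>_def h_def by (rule DERIV_imp_deriv[OF plateau_deriv[OF e_pos]])
  have \<phi>_test: "test_fun (\<phi> n)" for n
    unfolding \<phi>_def by (rule plateau_test_fun[OF e_pos ab(1)])
  have \<phi>_cont: "continuous_on UNIV (\<phi> n)" for n
    unfolding \<phi>_def by (intro continuous_at_imp_continuous_on ballI DERIV_isCont[OF plateau_deriv[OF e_pos]])
  have \<phi>_0: "\<phi> n x = 0" if "x \<notin> {a..b + 1}" for n x
  proof -
    consider "x < a" | "b + 1 < x" using \<open>x \<notin> {a..b + 1}\<close> by fastforce
    then show ?thesis
    proof cases
      case 1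
      then have "(x - a) / e n \<le> 0" "(x - b) / e n \<le> 0"
        using e_pos[of n] ab by (auto simp: divide_nonpos_pos)
      then show ?thesis by (simp add: \<phi>_def smooth_step_0)
    next
      case 2
      then have "1 \<le> (x - a) / e n" "1 \<le> (x - b) / e n"
        using e_pos[of n] e_lt[of n] d(4) ab by (auto simp: le_divide_eq)
      then show ?thesis by (simp add: \<phi>_def smooth_step_1)
    qed
  qed
  have \<phi>_int: "integrable lborel (\<lambda>x. \<phi> n x *\<^sub>R F x)" for n
    using \<phi>_0 by (intro integrable_scaleR_compact_support[OF F \<phi>_cont])
  have \<phi>_lim: "(\<lambda>n. \<phi> n x) \<longlonglongrightarrow> indicator {a..b} x" if "x \<noteq> a" "x \<noteq> b" for x
  proof -
    have "(\<lambda>n. \<phi> n x) \<longlonglongrightarrow> indicator {a<..} x - indicator {b<..} x"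
      unfolding \<phi>_def by (intro tendsto_diff smooth_step_affine_tendsto e_pos e0 that)
    moreover have "indicator {a<..} x - indicator {b<..} x = (indicator {a..b} x :: real)"
      using that ab by (auto simp: indicator_def)
    ultimately show ?thesis by simp
  qed
  have \<phi>_b: "\<bar>\<phi> n x\<bar> \<le> 1" for n x
    using smooth_step_bounds[of "(x - a) / e n"] smooth_step_bounds[of "(x - b) / e n"]
    by (simp add: \<phi>_def abs_le_iff)
  have F': "integrable lborel (\<lambda>x. indicator {c..d} x *\<^sub>R F x)" for c d
    using F by (simp add: set_integrable_def)
  have Flim: "(\<lambda>n. LINT x|lborel. \<phi> n x *\<^sub>R F x) \<longlonglongrightarrow> (LINT x|lborel. indicator {a..b} x *\<^sub>R F x)"
  proof (rule integral_dominated_convergence)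
    show "integrable lborel (\<lambda>x. norm (indicator {a..b + 1} x *\<^sub>R F x))" using F' by (rule integrable_norm)
    show "(\<lambda>x. indicator {a..b} x *\<^sub>R F x) \<in> borel_measurable lborel"
      using F' by (rule borel_measurable_integrable)
    show "(\<lambda>x. \<phi> n x *\<^sub>R F x) \<in> borel_measurable lborel" for n
      using \<phi>_int by (rule borel_measurable_integrable)
    show "AE x in lborel. (\<lambda>n. \<phi> n x *\<^sub>R F x) \<longlonglongrightarrow> indicator {a..b} x *\<^sub>R F x"
      using AE_lborel_singleton[of a] AE_lborel_singleton[of b]
      by eventually_elim (intro tendsto_scaleR tendsto_const \<phi>_lim)
    show "AE x in lborel. norm (\<phi> n x *\<^sub>R F x) \<le> norm (indicator {a..b + 1} x *\<^sub>R F x)" for n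
    proof (rule AE_I2)
      fix x
      show "norm (\<phi> n x *\<^sub>R F x) \<le> norm (indicator {a..b + 1} x *\<^sub>R F x)"
        using \<phi>_0[of x n] mult_right_mono[OF \<phi>_b[of n x], of "norm (F x)"] by (cases "x \<in> {a..b + 1}") auto
    qed
  qed
  have eq: "\<phi> n y *\<^sub>R J = (LINT x|lborel. h b n x *\<^sub>R K x) - (LINT x|lborel. h a n x *\<^sub>R K x) - (LINT x|lborel. \<phi> n x *\<^sub>R F x)" for n
  proof -
    have "\<phi> n y *\<^sub>R J = (LINT x|lborel. - (deriv (\<phi> n) x *\<^sub>R K x) - \<phi> n x *\<^sub>R F x)"
      using weak[OF \<phi>_test] by simp
    also have "\<dots> = (LINT x|lborel. h b n x *\<^sub>R K x - h a n x *\<^sub>R K x - \<phi> n x *\<^sub>R F x)"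
      by (simp add: \<phi>_der scaleR_diff_left)
    also have "\<dots> = (LINT x|lborel. h b n x *\<^sub>R K x) - (LINT x|lborel. h a n x *\<^sub>R K x) - (LINT x|lborel. \<phi> n x *\<^sub>R F x)"
      using h_int \<phi>_int by simp
    finally show ?thesis .
  qed
  have "(\<lambda>n. \<phi> n y *\<^sub>R J) \<longlonglongrightarrow> indicator {a..b} y *\<^sub>R J"
    using ab by (intro tendsto_scaleR tendsto_const \<phi>_lim) auto
  moreover have "(\<lambda>n. (LINT x|lborel. h b n x *\<^sub>R K x) - (LINT x|lborel. h a n x *\<^sub>R K x) - (LINT x|lborel. \<phi> n x *\<^sub>R F x))
    \<longlonglongrightarrow> K b - K a - (LINT x|lborel. indicator {a..b} x *\<^sub>R F x)"
  proof (intro tendsto_diff Flim)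
    show "(\<lambda>n. LINT x|lborel. h a n x *\<^sub>R K x) \<longlonglongrightarrow> K a"
      unfolding h_def by (rule d1(2)[OF _ e0]) (use e_pos e_lt d in \<open>auto intro: less_le_trans\<close>)
    show "(\<lambda>n. LINT x|lborel. h b n x *\<^sub>R K x) \<longlonglongrightarrow> K b"
      unfolding h_def by (rule d2(2)[OF _ e0]) (use e_pos e_lt d in \<open>auto intro: less_le_trans\<close>)
  qed
  ultimately have "indicator {a..b} y *\<^sub>R J = K b - K a - (LINT x|lborel. indicator {a..b} x *\<^sub>R F x)"
    unfolding eq by (rule LIMSEQ_unique)
  then show ?thesis by (simp add: set_lebesgue_integral_def algebra_simps)
qed

text \<open>\<open>t \<le> 1 + t\<^sup>2\<close>, and constants are integrable on bounded intervals.\<close>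

lemma L2_set_integrable:
  fixes K :: "real \<Rightarrow> 'b::euclidean_space"
  assumes "K \<in> L2"
  shows "set_integrable lborel {c..d} K"
  unfolding set_integrable_def
proof (rule Bochner_Integration.integrable_bound)
  show "integrable lborel (\<lambda>x. indicator {c..d} x + (norm (K x))\<^sup>2)"
    using assms by (intro Bochner_Integration.integrable_add integrable_real_indicator)
      (auto simp: L2_def emeasure_lborel_Icc_eq)
  show "(\<lambda>x. indicator {c..d} x *\<^sub>R K x) \<in> borel_measurable lborel"
    using assms by (intro borel_measurable_scaleR borel_measurable_indicator) (auto simp: L2_def)
  show "AE x in lborel. norm (indicator {c..d} x *\<^sub>R K x) \<le> norm (indicator {c..d} x + (norm (K x))\<^sup>2)"
  proof (rule AE_I2)
    fix x
    have "0 \<le> (norm (K x) - 1)\<^sup>2" by simp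
    then have "norm (K x) \<le> 1 + (norm (K x))\<^sup>2"
      using norm_ge_zero[of "K x"] by (simp add: power2_eq_square algebra_simps del: norm_ge_zero)
    then show "norm (indicator {c..d} x *\<^sub>R K x) \<le> norm (indicator {c..d} x + (norm (K x))\<^sup>2)"
      by (simp add: indicator_def)
  qed
qed

lemma set_integrable_continuous_mult:
  fixes K :: "real \<Rightarrow> complex ^ 'm ^ 'n" and A :: "real \<Rightarrow> complex ^ 'n ^ 'n"
  assumes A: "continuous_on UNIV A" and K: "K \<in> borel_measurable borel" "set_integrable lborel {c..d} K"
  shows "set_integrable lborel {c..d} (\<lambda>x. A x ** K x)"
proof -
  obtain C where C: "0 \<le> C" "\<And>(a :: complex ^ 'n ^ 'n) (b :: complex ^ 'm ^ 'n). norm (a ** b) \<le> norm a * norm b * C"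
    using mmm.nonneg_bounded by blast
  have "bounded (A ` {c..d})"
    by (intro compact_imp_bounded compact_continuous_image continuous_on_subset[OF A]) auto
  then obtain M where M: "\<forall>x\<in>{c..d}. norm (A x) \<le> M" "0 < M"
    unfolding bounded_pos by auto
  show ?thesis
    unfolding set_integrable_def
  proof (rule Bochner_Integration.integrable_bound)
  show "integrable lborel (\<lambda>x. (M * C) *\<^sub>R (indicator {c..d} x *\<^sub>R K x))"
    using K(2) unfolding set_integrable_def by (rule integrable_scaleR_right)
  have "(\<lambda>x. A x ** K x) \<in> borel_measurable borel"
  proof (rule borel_measurable_continuous_Pair[where f=A and g=K and H="(**)"])
    show "A \<in> borel_measurable borel" using A by (rule borel_measurable_continuous_onI)
    show "continuous_on UNIV (\<lambda>x::(complex ^ 'n ^ 'n) \<times> (complex ^ 'm ^ 'n). fst x ** snd x)"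
      by (intro mmm.continuous_on continuous_intros)
  qed (use K in auto)
  then show "(\<lambda>x. indicator {c..d} x *\<^sub>R (A x ** K x)) \<in> borel_measurable lborel"
    by (intro borel_measurable_scaleR borel_measurable_indicator) auto
  show "AE x in lborel. norm (indicator {c..d} x *\<^sub>R (A x ** K x)) \<le> norm ((M * C) *\<^sub>R (indicator {c..d} x *\<^sub>R K x))"
  proof (rule AE_I2)
    fix x
    have "norm (A x ** K x) \<le> M * C * norm (K x)" if "x \<in> {c..d}"
    proof -
      have "norm (A x ** K x) \<le> norm (A x) * norm (K x) * C" by (rule C(2))
      also have "\<dots> \<le> M * norm (K x) * C" using M that C by (intro mult_right_mono) auto
      finally show ?thesis by (simp add: ac_simps)
    qed
    then show "norm (indicator {c..d} x *\<^sub>R (A x ** K x)) \<le> norm ((M * C) *\<^sub>R (indicator {c..d} x *\<^sub>R K x))"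
      using M(2) C(1) by (simp add: indicator_def)
  qed
  qed
qed

lemma ode_of_increments:
  fixes K :: "real \<Rightarrow> 'b::euclidean_space"
  assumes S: "open S" "connected S" and F: "continuous_on S F" "\<And>c d. set_integrable lborel {c..d} F"
    and inc: "\<And>a b. a \<in> S \<Longrightarrow> b \<in> S \<Longrightarrow> a < b \<Longrightarrow> K b - K a = (LINT x:{a..b}|lborel. F x)"
    and x: "x \<in> S"
  shows "(K has_vector_derivative F x) (at x)"
proof -
  obtain e where e: "0 < e" "cball x e \<subseteq> S"
    using S(1) x open_contains_cball by blast
  define a where "a = x - e" define b where "b = x + e"
  have ab: "{a..b} \<subseteq> S" "a < x" "x < b"
    using e by (auto simp: a_def b_def cball_eq_atLeastAtMost)
  have K: "K t = K a + integral {a..t} F" if "t \<in> {a<..<b}" for t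
  proof -
    have "K t - K a = (LINT x:{a..t}|lborel. F x)"
      using ab that by (intro inc) auto
    also have "\<dots> = integral {a..t} F"
      using F(2) by (intro set_borel_integral_eq_integral)
    finally show ?thesis by (simp add: algebra_simps)
  qed
  have "((\<lambda>t. integral {a..t} F) has_vector_derivative F x) (at x within {a..b})"
    by (rule integral_has_vector_derivative) (use ab F continuous_on_subset in auto)
  moreover have "at x within {a..b} = at x"
    by (rule at_within_interior) (use ab in auto)
  ultimately have "((\<lambda>t. K a + integral {a..t} F) has_vector_derivative F x) (at x)"
    by (auto intro!: derivative_eq_intros)
  then show ?thesis
    by (rule has_vector_derivative_transform_within_open[where S="{a<..<b}"]) (use K ab in auto)
qed

text \<open>Away from \<open>y\<close> the increments of \<open>K\<close> are integrals of the continuous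
  function \<open>A K\<close>, so \<open>K\<close> is a classical solution there and has the form
  \<open>\<Phi> C\<close> on either side. Letting the end points of an interval around
  \<open>y\<close> shrink to \<open>y\<close>, the integral disappears and the jump \<open>1\<close>
  of the delta function remains.\<close>

lemma green_structure:
  fixes A :: "real \<Rightarrow> complex \<Rightarrow> complex ^ 'n ^ 'n"
  assumes c: "continuous_on UNIV (\<lambda>p. A (fst p) (snd p))" and G: "is_green A z y K"
  obtains Cp Cm where "\<And>x. y < x \<Longrightarrow> K x = fundamental A x z ** Cp"
    "\<And>x. x < y \<Longrightarrow> K x = fundamental A x z ** Cm"
    "fundamental A y z ** (Cp - Cm) = mat 1"
proof -
  define F where "F x = A x z ** K x" for x
  have K: "K \<in> L2" "continuous_on (- {y}) K"
    "\<And>\<phi>. test_fun \<phi> \<Longrightarrow> (LINT x|lborel. - (deriv \<phi> x *\<^sub>R K x) - \<phi> x *\<^sub>R F x) = \<phi> y *\<^sub>R mat 1"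
    using G by (auto simp: is_green_def F_def)
  have Az: "continuous_on S (\<lambda>x. A x z)" for S
    by (intro continuous_on_curried[OF c] continuous_intros)
  have Km: "K \<in> borel_measurable borel" using K(1) by (simp add: L2_def)
  have KI: "set_integrable lborel {c..d} K" for c d by (rule L2_set_integrable[OF K(1)])
  have FI: "set_integrable lborel {c..d} F" for c d
    unfolding F_def by (rule set_integrable_continuous_mult[OF Az Km KI])
  have cont: "isCont K a" if "a \<noteq> y" for a
    using K(2) that by (simp add: continuous_on_eq_continuous_at open_Compl)
  have inc: "K b - K a = (LINT x:{a..b}|lborel. F x) + indicator {a..b} y *\<^sub>R mat 1"
    if "a < b" "a \<noteq> y" "b \<noteq> y" for a b
    by (rule weak_equation_increment[OF K(3) Km KI FI]) (use that cont in auto)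
  have Fc: "continuous_on S F" if "y \<notin> S" for S
    unfolding F_def using that by (intro mmm.continuous_on Az continuous_on_subset[OF K(2)]) auto
  have der: "(K has_vector_derivative A x z ** K x) (at x)" if "x \<noteq> y" for x
  proof (cases "y < x")
    case True
    then show ?thesis
      unfolding F_def[symmetric] by (intro ode_of_increments[of "{y<..}"] Fc FI) (use inc in auto)
  next
    case False
    then show ?thesis
      unfolding F_def[symmetric] by (intro ode_of_increments[of "{..<y}"] Fc FI) (use inc that in auto)
  qed
  define Cp where "Cp = fundamental_inv A (y + 1) z ** K (y + 1)"
  define Cm where "Cm = fundamental_inv A (y - 1) z ** K (y - 1)"
  have p: "K x = fundamental A x z ** Cp" if "y < x" for x
    unfolding Cp_def by (rule fundamental_solution_unique[OF c, of "{y<..}"]) (use der that in auto)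
  have m: "K x = fundamental A x z ** Cm" if "x < y" for x
    unfolding Cm_def by (rule fundamental_solution_unique[OF c, of "{..<y}"]) (use der that in auto)
  define e where "e n = inverse (real (Suc n))" for n
  have e: "0 < e n" "e n \<le> 1" for n by (auto simp: e_def inverse_le_1_iff)
  have e0: "e \<longlonglongrightarrow> 0" unfolding e_def by (rule LIMSEQ_inverse_real_of_nat)
  have \<Phi>': "isCont (\<lambda>x. fundamental A x z) y"
    by (rule has_vector_derivative_continuous[OF fundamental_deriv[OF c]])
  have l1: "(\<lambda>n. fundamental A (y + e n) z ** Cp - fundamental A (y - e n) z ** Cm) \<longlonglongrightarrow>
     fundamental A y z ** Cp - fundamental A y z ** Cm"
  proof (intro tendsto_diff mmm.tendsto tendsto_const isCont_tendsto_compose[OF \<Phi>'])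
    show "(\<lambda>n. y + e n) \<longlonglongrightarrow> y" using tendsto_add[OF tendsto_const e0] by simp
    show "(\<lambda>n. y - e n) \<longlonglongrightarrow> y" using tendsto_diff[OF tendsto_const e0] by simp
  qed
  have l2: "(\<lambda>n. (LINT x|lborel. indicator {y - e n..y + e n} x *\<^sub>R F x)) \<longlonglongrightarrow> (LINT x::real|lborel. (0 :: complex ^ 'n ^ 'n))"
  proof (rule integral_dominated_convergence[where w="\<lambda>x. norm (indicator {y - 1..y + 1} x *\<^sub>R F x)"])
    have FI': "integrable lborel (\<lambda>x. indicator {c..d} x *\<^sub>R F x)" for c d
      using FI by (simp add: set_integrable_def)
    show "integrable lborel (\<lambda>x. norm (indicator {y - 1..y + 1} x *\<^sub>R F x))" using FI' by (rule integrable_norm)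
    show "(\<lambda>x. indicator {y - e n..y + e n} x *\<^sub>R F x) \<in> borel_measurable lborel" for n
      using FI' by (rule borel_measurable_integrable)
    show "AE x in lborel. (\<lambda>n. indicator {y - e n..y + e n} x *\<^sub>R F x) \<longlonglongrightarrow> 0"
      using AE_lborel_singleton[of y]
    proof eventually_elim
      case (elim x)
      then have "eventually (\<lambda>n. e n < \<bar>x - y\<bar>) sequentially"
        using e0 by (intro order_tendstoD(2)[OF e0]) auto
      then have "eventually (\<lambda>n. indicator {y - e n..y + e n} x *\<^sub>R F x = 0) sequentially"
        by eventually_elim (auto simp: indicator_def abs_if split: if_splits)
      then show ?case by (rule tendsto_eventually)
    qed
    show "AE x in lborel. norm (indicator {y - e n..y + e n} x *\<^sub>R F x) \<le> norm (indicator {y - 1..y + 1} x *\<^sub>R F x)" for n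
    proof (rule AE_I2)
      fix x show "norm (indicator {y - e n..y + e n} x *\<^sub>R F x) \<le> norm (indicator {y - 1..y + 1} x *\<^sub>R F x)"
        using e(2)[of n] by (auto simp: indicator_def)
    qed
  qed simp
  have "fundamental A (y + e n) z ** Cp - fundamental A (y - e n) z ** Cm
      = (LINT x|lborel. indicator {y - e n..y + e n} x *\<^sub>R F x) + mat 1" for n
    using inc[of "y - e n" "y + e n"] e(1)[of n] by (simp add: p m set_lebesgue_integral_def)
  then have "(\<lambda>n. fundamental A (y + e n) z ** Cp - fundamental A (y - e n) z ** Cm) \<longlonglongrightarrow> 0 + mat 1"
    using tendsto_add[OF l2 tendsto_const[of "mat 1"]] by simp
  then have "fundamental A y z ** Cp - fundamental A y z ** Cm = 0 + mat 1"
    by (rule LIMSEQ_unique[OF l1])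
  then have "fundamental A y z ** (Cp - Cm) = mat 1"
    by (simp add: mmm.diff_right)
  with p m show ?thesis by (rule that)
qed

lemma test_fun_deriv:
  assumes "test_fun \<phi>"
  shows "(\<phi> has_field_derivative deriv \<phi> x) (at x)" "continuous_on UNIV (deriv \<phi>)" "bounded {x. \<phi> x \<noteq> 0}"
proof -
  have "(deriv ^^ 0) \<phi> field_differentiable at x" "(deriv ^^ 1) \<phi> field_differentiable at x" for x
    using assms unfolding test_fun_def by blast+
  then show "(\<phi> has_field_derivative deriv \<phi> x) (at x)" "continuous_on UNIV (deriv \<phi>)"
    by (auto simp: DERIV_deriv_iff_field_differentiable field_differentiable_imp_continuous_at
        intro!: continuous_at_imp_continuous_on)
  show "bounded {x. \<phi> x \<noteq> 0}" using assms by (simp add: test_fun_def)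
qed

text \<open>Integration by parts, without boundary terms because test functions have bounded support. It shows
  that square-integrable classical solutions belong to the kernel of \<open>T\<close>.\<close>

lemma weak_deriv_of_C1:
  fixes u :: "real \<Rightarrow> 'b::euclidean_space"
  assumes u: "\<And>x. (u has_vector_derivative v x) (at x)" and v: "continuous_on UNIV v"
  shows "weak_deriv u v"
  unfolding weak_deriv_def
proof (intro allI impI)
  fix \<phi> assume t: "test_fun \<phi>"
  note \<phi> = test_fun_deriv[OF t]
  obtain R where R: "\<And>x. \<phi> x \<noteq> 0 \<Longrightarrow> \<bar>x\<bar> < R" "0 < R"
    using \<phi>(3) bounded_pos_less[of "{x. \<phi> x \<noteq> 0}"] by auto
  have z: "\<phi> x = 0" if "R \<le> \<bar>x\<bar>" for x using R(1)[of x] that by fastforce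
  have dz: "deriv \<phi> x = 0" if "x \<notin> {-R..R}" for x
  proof (rule DERIV_imp_deriv)
    have "((\<lambda>x. 0) has_field_derivative (0::real)) (at x)" by simp
    then show "(\<phi> has_field_derivative 0) (at x)"
      by (rule has_field_derivative_transform_within_open[where S="- {-R..R}"])
         (use that z in \<open>auto simp: open_Compl\<close>)
  qed
  have uc: "continuous_on UNIV u"
    by (meson continuous_at_imp_continuous_on has_vector_derivative_continuous u)
  have \<phi>c: "continuous_on UNIV \<phi>"
    by (meson DERIV_isCont continuous_at_imp_continuous_on \<phi>(1))
  have zz: "\<phi> x = 0" if "x \<notin> {-R..R}" for x using that by (intro z) auto
  have i1: "integrable lborel (\<lambda>x. deriv \<phi> x *\<^sub>R u x)"
    using dz by (intro integrable_scaleR_compact_support[of "-R" R] borel_integrable_atLeastAtMost' \<phi> continuous_on_subset[OF uc]) auto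
  have i2: "integrable lborel (\<lambda>x. \<phi> x *\<^sub>R v x)"
    using zz by (intro integrable_scaleR_compact_support[of "-R" R] borel_integrable_atLeastAtMost' \<phi>c continuous_on_subset[OF v]) auto
  have "(LINT x|lborel. indicator {-R..R} x *\<^sub>R (\<phi> x *\<^sub>R v x + deriv \<phi> x *\<^sub>R u x)) = \<phi> R *\<^sub>R u R - \<phi> (-R) *\<^sub>R u (-R)"
  proof (rule integral_FTC_Icc)
    show "((\<lambda>x. \<phi> x *\<^sub>R u x) has_vector_derivative \<phi> x *\<^sub>R v x + deriv \<phi> x *\<^sub>R u x) (at x within {-R..R})" for x
      by (rule has_vector_derivative_at_within, rule has_vector_derivative_scaleR[OF \<phi>(1) u])
    show "continuous_on {-R..R} (\<lambda>x. \<phi> x *\<^sub>R v x + deriv \<phi> x *\<^sub>R u x)"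
      by (rule continuous_on_subset[of UNIV]) (intro continuous_intros \<phi>c \<phi>(2) v uc subset_UNIV)+
  qed (use R in auto)
  moreover have "indicator {-R..R} x *\<^sub>R (\<phi> x *\<^sub>R v x + deriv \<phi> x *\<^sub>R u x) = \<phi> x *\<^sub>R v x + deriv \<phi> x *\<^sub>R u x" for x
    using dz[of x] zz[of x] by (cases "x \<in> {-R..R}") auto
  ultimately have "(LINT x|lborel. \<phi> x *\<^sub>R v x + deriv \<phi> x *\<^sub>R u x) = 0"
    using z[of R] z[of "-R"] R(2) by simp
  then show "(LINT x|lborel. deriv \<phi> x *\<^sub>R u x) = - (LINT x|lborel. \<phi> x *\<^sub>R v x)"
    using i1 i2 by (simp add: add_eq_0_iff add.commute)
qed

section \<open>Quadratic forms of hyperbolic matrices\<close>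

definition shift_op :: "complex ^ 'n ^ 'n \<Rightarrow> complex \<Rightarrow> complex ^ 'n \<Rightarrow> complex ^ 'n" where
  "shift_op M \<mu> v = M *v v - \<mu> *s v"

lemma gen_eigenspace_shift_op:
  "gen_eigenspace M S = vec.span {v. \<exists>\<mu>\<in>S. \<exists>k::nat. (shift_op M \<mu> ^^ k) v = 0}"
  by (simp add: gen_eigenspace_def shift_op_def[abs_def])

lemma linear_shift_op: "Vector_Spaces.linear (*s) (*s) (shift_op M \<mu>)"
  by unfold_locales (auto simp: shift_op_def algebra_simps vec.scale_right_diff_distrib matrix_vector_right_distrib vec.scale)

lemma linear_funpow:
  fixes f :: "complex ^ 'n \<Rightarrow> complex ^ 'n"
  assumes "Vector_Spaces.linear (*s) (*s) f" shows "Vector_Spaces.linear (*s) (*s) (f ^^ k)"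
proof (induction k)
  case 0
  show ?case using vec.linear_id by (simp add: id_def)
next
  case (Suc k)
  show ?case using Vector_Spaces.linear_compose[OF Suc assms] by (simp add: o_def)
qed

lemmas shift_op_pow_linear = linear_funpow[OF linear_shift_op]

text \<open>\<open>p(M) b\<close>, for a polynomial \<open>p\<close>.\<close>

definition poly_orbit :: "complex ^ 'n ^ 'n \<Rightarrow> complex ^ 'n \<Rightarrow> complex poly \<Rightarrow> complex ^ 'n" where
  "poly_orbit M b p = (\<Sum>i\<le>degree p. coeff p i *s (((*v) M) ^^ i) b)"

lemma poly_orbit_eq:
  assumes "degree p < n"
  shows "poly_orbit M b p = (\<Sum>i<n. coeff p i *s (((*v) M) ^^ i) b)"
  unfolding poly_orbit_def
  by (rule sum.mono_neutral_left) (use assms in \<open>auto simp: coeff_eq_0\<close>)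

lemma poly_orbit_linear_factor:
  "poly_orbit M b ([:-\<mu>, 1:] * q) = shift_op M \<mu> (poly_orbit M b q)"
proof -
  define n where "n = Suc (degree q)"
  have "degree ([:-\<mu>, 1:] * q) \<le> degree [:-\<mu>, 1:] + degree q" by (rule degree_mult_le)
  then have d: "degree ([:-\<mu>, 1:] * q) < Suc n" "degree q < n" "degree q < Suc n" by (auto simp: n_def)
  have "coeff q n = 0" by (simp add: n_def coeff_eq_0)
  have "poly_orbit M b ([:-\<mu>, 1:] * q)
     = (\<Sum>i<Suc n. (- \<mu> * coeff q i + coeff (pCons 0 q) i) *s (((*v) M) ^^ i) b)"
    by (subst poly_orbit_eq[OF d(1)]) simp
  also have "\<dots> = - \<mu> *s (\<Sum>i<Suc n. coeff q i *s (((*v) M) ^^ i) b) + (\<Sum>i<Suc n. coeff (pCons 0 q) i *s (((*v) M) ^^ i) b)"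
    by (simp only: vec.scale_left_distrib sum.distrib vec.scale_sum_right vec.scale_scale)
  also have "(\<Sum>i<Suc n. coeff (pCons 0 q) i *s (((*v) M) ^^ i) b) = (\<Sum>i<n. coeff q i *s (((*v) M) ^^ Suc i) b)"
    by (subst sum.lessThan_Suc_shift) simp
  also have "\<dots> = M *v (\<Sum>i<n. coeff q i *s (((*v) M) ^^ i) b)"
    by (simp add: vec.sum vec.scale)
  finally show ?thesis using \<open>coeff q n = 0\<close>
    by (simp add: poly_orbit_eq[OF d(2), symmetric] poly_orbit_eq[OF d(3), symmetric] shift_op_def)
qed

text \<open>The vectors \<open>M\<^sup>i b\<close> for \<open>i \<le> N\<close> are too many to be distinct
  and independent; a coincidence or a linear relation among them is a polynomial that annihilates
  \<open>b\<close>.\<close>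

lemma poly_orbit_annihilator:
  fixes M :: "complex ^ 'n ^ 'n"
  shows "\<exists>p. p \<noteq> 0 \<and> poly_orbit M b p = 0"
proof (cases "inj_on (\<lambda>i. (((*v) M) ^^ i) b) {..CARD('n)}")
  case True
  define S where "S = (\<lambda>i. (((*v) M) ^^ i) b) ` {..CARD('n)}"
  have "card S = Suc (CARD('n))" unfolding S_def by (simp add: card_image[OF True])
  then have "vec.dependent S"
    using vec.independent_bound_general[of S] dim_subset_UNIV_cart_gen[of S] by fastforce
  moreover have "finite S" by (simp add: S_def)
  ultimately obtain u v where u: "v \<in> S" "u v \<noteq> 0" "(\<Sum>v\<in>S. u v *s v) = 0"
    using vec.dependent_finite by blast
  obtain j where j: "j \<le> CARD('n)" "v = (((*v) M) ^^ j) b" using u(1) by (auto simp: S_def)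
  define p where "p = (\<Sum>i\<le>CARD('n). monom (u ((((*v) M) ^^ i) b)) i)"
  have cp: "coeff p i = (if i \<le> CARD('n) then u ((((*v) M) ^^ i) b) else 0)" for i
    by (simp add: p_def coeff_sum if_distrib[of "\<lambda>x. x = _"] sum.delta)
  have "p \<noteq> 0" using cp[of j] j u(2) by auto
  have "degree p < Suc (CARD('n))" using degree_le[of "CARD('n)" p] by (simp add: cp less_Suc_eq_le)
  from poly_orbit_eq[OF this, of M b]
  have "poly_orbit M b p = (\<Sum>i\<le>CARD('n). u ((((*v) M) ^^ i) b) *s (((*v) M) ^^ i) b)"
    by (simp add: cp lessThan_Suc_atMost)
  also have "\<dots> = (\<Sum>v\<in>S. u v *s v)"
    unfolding S_def by (simp add: sum.reindex[OF True])
  finally show ?thesis using \<open>p \<noteq> 0\<close> u(3) by auto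
next
  case False
  then obtain i j where ij: "i \<noteq> j" "(((*v) M) ^^ i) b = (((*v) M) ^^ j) b"
    unfolding inj_on_def by blast
  define p where "p = monom 1 i - monom (1::complex) j"
  have "coeff p i = 1" using ij(1) by (simp add: p_def)
  then have "p \<noteq> 0" by auto
  define n where "n = Suc (degree p + i + j)"
  have *: "(\<Sum>l<n. coeff (monom 1 m) l *s (((*v) M) ^^ l) b) = (((*v) M) ^^ m) b" if "m < n" for m
  proof -
    have "(\<Sum>l<n. coeff (monom 1 m) l *s (((*v) M) ^^ l) b) = (\<Sum>l<n. if l = m then (((*v) M) ^^ m) b else 0)"
      by (rule sum.cong) auto
    also have "\<dots> = (((*v) M) ^^ m) b"
      using that by (subst sum.delta) auto
    finally show ?thesis .
  qed
  have "poly_orbit M b p = (\<Sum>l<n. coeff p l *s (((*v) M) ^^ l) b)"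
    by (rule poly_orbit_eq) (simp add: n_def)
  also have "\<dots> = (\<Sum>l<n. coeff (monom 1 i) l *s (((*v) M) ^^ l) b) - (\<Sum>l<n. coeff (monom 1 j) l *s (((*v) M) ^^ l) b)"
    by (simp only: p_def coeff_diff vec.scale_left_diff_distrib sum_subtractf)
  also have "\<dots> = 0"
    using ij by (subst (1 2) *) (auto simp: n_def)
  finally show ?thesis using \<open>p \<noteq> 0\<close> by auto
qed

text \<open>An eigenvector of the map induced by \<open>M\<close> on the quotient by \<open>T\<close>.
  Splitting linear factors off a polynomial that annihilates \<open>b\<close>, one reaches a step at
  which the vector enters \<open>T\<close>. The number \<open>\<mu>\<close> is an eigenvalue of
  \<open>M\<close> itself: otherwise \<open>M - \<mu>\<close> would be injective, hence map
  \<open>T\<close> onto \<open>T\<close>, and could not send a vector outside \<open>T\<close> into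
  \<open>T\<close>. Both the decomposition into generalized eigenspaces and the construction of the
  form below climb up one dimension at a time with this lemma.\<close>

lemma exists_eigenvector_mod_invariant:
  fixes M :: "complex ^ 'n ^ 'n"
  assumes T: "vec.subspace T" "\<And>v. v \<in> T \<Longrightarrow> M *v v \<in> T" and b: "b \<notin> T"
  shows "\<exists>b' \<mu>. b' \<notin> T \<and> shift_op M \<mu> b' \<in> T \<and> is_eigenvalue M \<mu>"
proof -
  have ex: "\<exists>b' \<mu>. b' \<notin> T \<and> shift_op M \<mu> b' \<in> T" if "p \<noteq> 0" "poly_orbit M b p \<in> T" for p
    using that
  proof (induction "degree p" arbitrary: p)
    case 0
    then obtain a where a: "p = [:a:]" "a \<noteq> 0" by (metis degree_eq_zeroE pCons_0_0)
    then have "a *s b \<in> T" using 0 by (simp add: poly_orbit_def)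
    then have "inverse a *s (a *s b) \<in> T" using T(1) by (rule vec.subspace_scale[rotated])
    then show ?case using a b by simp
  next
    case (Suc n)
    have "degree p > 0" using Suc.hyps(2) by simp
    then obtain \<mu> where "poly p \<mu> = 0" using alg_closed_imp_poly_has_root by blast
    then obtain q where q: "p = [:-\<mu>, 1:] * q" by (metis poly_eq_0_iff_dvd dvd_def)
    have "q \<noteq> 0" using q Suc.prems by auto
    then have "degree p = Suc (degree q)" unfolding q by (subst degree_mult_eq) auto
    then have "n = degree q" using Suc.hyps(2) by simp
    show ?case
    proof (cases "poly_orbit M b q \<in> T")
      case True
      then show ?thesis using Suc.hyps(1)[OF \<open>n = degree q\<close> \<open>q \<noteq> 0\<close>] by blast
    next
      case False
      then show ?thesis using Suc.prems(2) unfolding q poly_orbit_linear_factor by blast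
    qed
  qed
  obtain p where "p \<noteq> 0" "poly_orbit M b p = 0" using poly_orbit_annihilator by blast
  then obtain b' \<mu> where b': "b' \<notin> T" "shift_op M \<mu> b' \<in> T"
    using ex[of p] vec.subspace_0[OF T(1)] by auto
  have "is_eigenvalue M \<mu>"
  proof (rule ccontr)
    interpret L: Vector_Spaces.linear "(*s)" "(*s)" "shift_op M \<mu>" by (rule linear_shift_op)
    assume no: "\<not> is_eigenvalue M \<mu>"
    have inj: "inj (shift_op M \<mu>)"
      using no by (subst L.inj_iff_eq_0) (auto simp: is_eigenvalue_def shift_op_def)
    have sub: "shift_op M \<mu> ` T \<subseteq> T"
      using T by (auto simp: shift_op_def intro!: vec.subspace_diff vec.subspace_scale)
    have "vec.dim (shift_op M \<mu> ` T) = vec.dim T"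
      by (rule vec.dim_image_eq[OF linear_shift_op]) (use inj inj_on_subset in blast)
    then have "shift_op M \<mu> ` T = T"
      using vec.subspace_dim_equal[OF L.subspace_image[OF T(1)] T(1) sub] by simp
    then obtain t where "t \<in> T" "shift_op M \<mu> t = shift_op M \<mu> b'" using b'(2) by (metis imageE)
    then show False using inj b'(1) by (metis injD)
  qed
  then show ?thesis using b' by blast
qed

lemma gen_eigenspace_subspace: "vec.subspace (gen_eigenspace M S)"
  by (simp add: gen_eigenspace_def)

lemma gen_eigenspace_invariant:
  assumes "v \<in> gen_eigenspace M S" shows "M *v v \<in> gen_eigenspace M S"
proof -
  let ?G = "{v. \<exists>\<mu>\<in>S. \<exists>k::nat. (shift_op M \<mu> ^^ k) v = 0}"
  have "M *v v \<in> vec.span ?G" if v: "v \<in> ?G" for v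
  proof -
    obtain \<mu> k where k: "\<mu> \<in> S" "(shift_op M \<mu> ^^ k) v = 0" using v by blast
    interpret L: Vector_Spaces.linear "(*s)" "(*s)" "shift_op M \<mu>" by (rule linear_shift_op)
    have "(shift_op M \<mu> ^^ k) (shift_op M \<mu> v) = 0"
      using k(2) L.zero by (simp add: funpow_swap1[symmetric])
    then have "shift_op M \<mu> v \<in> ?G" using k(1) by blast
    then have "shift_op M \<mu> v + \<mu> *s v \<in> vec.span ?G"
      using v by (intro vec.span_add vec.span_scale vec.span_base)
    then show ?thesis by (simp add: shift_op_def)
  qed
  then have "(*v) M ` vec.span ?G \<subseteq> vec.span ?G"
    unfolding vec.span_image[symmetric] by (intro vec.span_minimal) auto
  then show ?thesis using assms unfolding gen_eigenspace_shift_op by blast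
qed

text \<open>On a generalized eigenspace for \<open>\<nu>\<close> the operator \<open>M - \<mu>\<close> is
  invertible if \<open>\<mu> \<noteq> \<nu>\<close>, being a nonzero multiple of the identity plus a
  nilpotent operator.\<close>

lemma shift_op_solve_generalized:
  assumes "\<nu> \<noteq> \<mu>" "(shift_op M \<nu> ^^ k) w = 0"
  shows "\<exists>w'. (shift_op M \<nu> ^^ k) w' = 0 \<and> shift_op M \<mu> w' = w"
  using assms(2)
proof (induction k arbitrary: w)
  case 0
  interpret L: Vector_Spaces.linear "(*s)" "(*s)" "shift_op M \<mu>" by (rule linear_shift_op)
  show ?case using 0 L.zero by (intro exI[of _ 0]) simp
next
  case (Suc k)
  let ?n = "shift_op M \<nu>" and ?d = "inverse (\<mu> - \<nu>)"
  interpret L: Vector_Spaces.linear "(*s)" "(*s)" "shift_op M \<mu>" by (rule linear_shift_op)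
  interpret P: Vector_Spaces.linear "(*s)" "(*s)" "?n ^^ Suc k" by (rule shift_op_pow_linear)
  interpret N: Vector_Spaces.linear "(*s)" "(*s)" "?n" by (rule linear_shift_op)
  have "(?n ^^ k) (?n w) = 0" using Suc.prems by (simp add: funpow_swap1)
  from Suc.IH[OF this] obtain w'' where w'': "(?n ^^ k) w'' = 0" "shift_op M \<mu> w'' = ?n w" by blast
  have "(?n ^^ Suc k) (?d *s (w'' - w)) = 0"
  proof -
    have "(?n ^^ Suc k) w'' = 0" using w''(1) N.zero by simp
    then show ?thesis using Suc.prems by (simp only: P.scale P.diff) simp
  qed
  moreover have "shift_op M \<mu> (?d *s (w'' - w)) = w"
  proof -
    have "shift_op M \<mu> (?d *s (w'' - w)) = ?d *s (?n w - shift_op M \<mu> w)"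
      by (simp add: L.scale L.diff w''(2))
    also have "?n w - shift_op M \<mu> w = (\<mu> - \<nu>) *s w"
      by (simp add: shift_op_def vec.scale_left_diff_distrib)
    also have "?d *s ((\<mu> - \<nu>) *s w) = w"
      using assms(1) by (simp only: vec.scale_scale) simp
    finally show ?thesis .
  qed
  ultimately show ?case by blast
qed

text \<open>Modulo the range of \<open>M - \<mu>\<close> only the component with generalized eigenvalue
  \<open>\<mu>\<close> survives, all others being in the range by the preceding lemma.\<close>

lemma gen_eigenspace_reduce:
  assumes "w \<in> gen_eigenspace M S"
  shows "\<exists>w'\<in>gen_eigenspace M S. \<exists>k. (shift_op M \<mu> ^^ k) (w - shift_op M \<mu> w') = 0"
proof -
  let ?G = "{v. \<exists>\<mu>\<in>S. \<exists>k::nat. (shift_op M \<mu> ^^ k) v = 0}"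
  define U where "U = {w. \<exists>w'\<in>vec.span ?G. \<exists>k. (shift_op M \<mu> ^^ k) (w - shift_op M \<mu> w') = 0}"
  interpret L: Vector_Spaces.linear "(*s)" "(*s)" "shift_op M \<mu>" by (rule linear_shift_op)
  have up: "(shift_op M \<mu> ^^ (k + l)) v = 0" if "(shift_op M \<mu> ^^ k) v = 0" for k l v
  proof -
    interpret P: Vector_Spaces.linear "(*s)" "(*s)" "shift_op M \<mu> ^^ l" by (rule shift_op_pow_linear)
    show ?thesis using that P.zero by (subst add.commute) (simp add: funpow_add)
  qed
  have "vec.subspace U"
    unfolding vec.subspace_def
  proof (intro conjI ballI allI)
    show "0 \<in> U" unfolding U_def using L.zero vec.span_zero by (auto intro!: bexI[of _ 0] exI[of _ 0])
    fix x assume x: "x \<in> U"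
    then obtain x' k where x': "x' \<in> vec.span ?G" "(shift_op M \<mu> ^^ k) (x - shift_op M \<mu> x') = 0"
      unfolding U_def by blast
    show "c *s x \<in> U" for c
    proof -
      interpret P: Vector_Spaces.linear "(*s)" "(*s)" "shift_op M \<mu> ^^ k" by (rule shift_op_pow_linear)
      have "c *s x - shift_op M \<mu> (c *s x') = c *s (x - shift_op M \<mu> x')"
        by (simp add: L.scale vec.scale_right_diff_distrib)
      then have "(shift_op M \<mu> ^^ k) (c *s x - shift_op M \<mu> (c *s x')) = 0"
        using x'(2) by (simp only: P.scale) simp
      then show ?thesis using x'(1) vec.span_scale unfolding U_def by blast
    qed
    fix y assume "y \<in> U"
    then obtain y' l where y': "y' \<in> vec.span ?G" "(shift_op M \<mu> ^^ l) (y - shift_op M \<mu> y') = 0"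
      unfolding U_def by blast
    interpret P: Vector_Spaces.linear "(*s)" "(*s)" "shift_op M \<mu> ^^ (k + l)" by (rule shift_op_pow_linear)
    have "x + y - shift_op M \<mu> (x' + y') = (x - shift_op M \<mu> x') + (y - shift_op M \<mu> y')"
      by (simp add: L.add)
    then have "(shift_op M \<mu> ^^ (k + l)) (x + y - shift_op M \<mu> (x' + y')) = 0"
      using up[OF x'(2), of l] up[OF y'(2), of k] by (simp only: P.add) (simp add: add.commute)
    then show "x + y \<in> U" using x'(1) y'(1) vec.span_add unfolding U_def by blast
  qed
  moreover have "?G \<subseteq> U"
  proof
    fix v assume v: "v \<in> ?G"
    then obtain \<nu> k where k: "\<nu> \<in> S" "(shift_op M \<nu> ^^ k) v = 0" by blast
    show "v \<in> U"
    proof (cases "\<nu> = \<mu>")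
      case True
      then show ?thesis using k L.zero vec.span_zero unfolding U_def by (auto intro!: bexI[of _ 0] exI[of _ k])
    next
      case False
      then obtain w' where "(shift_op M \<nu> ^^ k) w' = 0" "shift_op M \<mu> w' = v"
        using shift_op_solve_generalized[OF False k(2)] by blast
      moreover from this have "w' \<in> vec.span ?G" using k(1) by (intro vec.span_base) blast
      ultimately show ?thesis unfolding U_def by (auto intro!: bexI[of _ w'] exI[of _ 0])
    qed
  qed
  ultimately have "vec.span ?G \<subseteq> U" by (intro vec.span_minimal)
  then show ?thesis using assms unfolding gen_eigenspace_shift_op U_def by blast
qed

text \<open>If the span \<open>W\<close> of the generalized eigenvectors were proper, there would be
  \<open>b\<close> outside \<open>W\<close> with \<open>(M - \<mu>) b\<close> in \<open>W\<close>.
  Subtracting a vector of \<open>W\<close> from \<open>b\<close> makes \<open>(M - \<mu>) b\<close>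
  a generalized eigenvector for \<open>\<mu>\<close>, and then the difference is one as well.\<close>

lemma hyperbolic_gen_eigenspace_UNIV:
  assumes "hyperbolic M"
  shows "gen_eigenspace M {\<mu>. Re \<mu> \<noteq> 0} = UNIV"
proof (rule ccontr)
  let ?W = "gen_eigenspace M {\<mu>. Re \<mu> \<noteq> 0}"
  assume "?W \<noteq> UNIV"
  then obtain b0 where "b0 \<notin> ?W" by blast
  from exists_eigenvector_mod_invariant[OF gen_eigenspace_subspace gen_eigenspace_invariant this]
  obtain b \<mu> where b: "b \<notin> ?W" "shift_op M \<mu> b \<in> ?W" "is_eigenvalue M \<mu>" by blast
  have \<mu>: "Re \<mu> \<noteq> 0" using assms b(3) by (auto simp: hyperbolic_def)
  interpret L: Vector_Spaces.linear "(*s)" "(*s)" "shift_op M \<mu>" by (rule linear_shift_op)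
  obtain w' k where w': "w' \<in> ?W" "(shift_op M \<mu> ^^ k) (shift_op M \<mu> b - shift_op M \<mu> w') = 0"
    using gen_eigenspace_reduce[OF b(2)] by blast
  then have "(shift_op M \<mu> ^^ Suc k) (b - w') = 0"
    by (simp add: funpow_swap1 L.diff)
  then have "b - w' \<in> ?W"
    using \<mu> unfolding gen_eigenspace_shift_op by (intro vec.span_base) blast
  then have "(b - w') + w' \<in> ?W"
    using w'(1) gen_eigenspace_subspace by (rule_tac vec.subspace_add) auto
  then show False using b(1) by simp
qed

lemma hyperbolic_splitting:
  assumes "hyperbolic M"
  shows "\<exists>x\<in>stable_space M. \<exists>y\<in>unstable_space M. v = x + y"
proof -
  let ?G = "\<lambda>S. {v. \<exists>\<mu>\<in>S. \<exists>k::nat. (shift_op M \<mu> ^^ k) v = 0}"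
  have "?G {\<mu>. Re \<mu> \<noteq> 0} = ?G {\<mu>. Re \<mu> < 0} \<union> ?G {\<mu>. Re \<mu> > 0}"
    by (auto simp: neq_iff)
  then have "gen_eigenspace M {\<mu>. Re \<mu> \<noteq> 0} = {x + y | x y. x \<in> stable_space M \<and> y \<in> unstable_space M}"
    unfolding stable_space_def unstable_space_def gen_eigenspace_shift_op
    by (simp only: vec.span_Un)
  then show ?thesis using hyperbolic_gen_eigenspace_UNIV[OF assms] by blast
qed

lemma gen_eigenspace_uminus: "gen_eigenspace (- M) S = gen_eigenspace M (uminus ` S)"
proof -
  have eq: "(shift_op (- M) \<mu> ^^ k) v = (-1) ^ k *s (shift_op M (- \<mu>) ^^ k) v" for \<mu> k v
  proof (induction k)
    case (Suc k)
    interpret L: Vector_Spaces.linear "(*s)" "(*s)" "shift_op (- M) \<mu>" by (rule linear_shift_op)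
    have neg: "shift_op (- M) \<mu> u = - shift_op M (- \<mu>) u" for u
      by (simp add: shift_op_def mvm.minus_left)
    have "(shift_op (- M) \<mu> ^^ Suc k) v = shift_op (- M) \<mu> ((-1) ^ k *s (shift_op M (- \<mu>) ^^ k) v)"
      by (simp only: funpow.simps o_apply Suc)
    also have "\<dots> = (-1) ^ k *s (- shift_op M (- \<mu>) ((shift_op M (- \<mu>) ^^ k) v))"
      by (simp only: L.scale) (simp only: neg)
    also have "\<dots> = (-1) ^ Suc k *s (shift_op M (- \<mu>) ^^ Suc k) v" by simp
    finally show ?case .
  qed simp
  have "(shift_op (- M) \<mu> ^^ k) v = 0 \<longleftrightarrow> (shift_op M (- \<mu>) ^^ k) v = 0" for \<mu> k v
    unfolding eq by simp
  then show ?thesis unfolding gen_eigenspace_shift_op by simp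
qed

text \<open>Reversal of \<open>x\<close> replaces \<open>M\<close> by \<open>- M\<close>; by this lemma
  statements at \<open>- \<infinity>\<close> follow from those at \<open>+ \<infinity>\<close>.\<close>

lemma stable_space_uminus: "stable_space (- M) = unstable_space M"
proof -
  have "uminus ` {\<mu>. Re \<mu> < 0} = {\<mu>. Re \<mu> > 0}"
    by (auto simp: image_iff intro!: exI[of _ "- _"])
  then show ?thesis by (simp add: stable_space_def unstable_space_def gen_eigenspace_uminus)
qed

lemma hyperbolic_uminus:
  assumes "hyperbolic M" shows "hyperbolic (- M)"
  unfolding hyperbolic_def
proof (intro allI impI)
  fix \<mu> assume "is_eigenvalue (- M) \<mu>"
  then obtain v where "v \<noteq> 0" "- (M *v v) = \<mu> *s v" by (auto simp: is_eigenvalue_def mvm.minus_left)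
  then have "M *v v = (- \<mu>) *s v" by (metis minus_minus vec.scale_minus_left)
  then have "is_eigenvalue M (- \<mu>)" using \<open>v \<noteq> 0\<close> by (auto simp: is_eigenvalue_def)
  then have "Re (- \<mu>) \<noteq> 0" using assms unfolding hyperbolic_def by blast
  then show "Re \<mu> \<noteq> 0" by simp
qed

lemma inner_scale_self: "inner v (\<mu> *s v) = Re \<mu> * (norm v)\<^sup>2" for v :: "complex ^ 'n"
proof -
  have "inner (v $ i) (\<mu> * v $ i) = Re \<mu> * (norm (v $ i))\<^sup>2" for i
    by (simp add: inner_complex_def cmod_power2) (simp add: algebra_simps power2_eq_square)
  then show ?thesis
    by (simp add: inner_vec_def power2_norm_eq_inner sum_distrib_left)
qed

lemma norm_scale_vec: "norm (k *s v) = norm k * norm (v :: complex ^ 'n)"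
proof -
  have "(norm (k *s v))\<^sup>2 = (norm k * norm v)\<^sup>2"
    by (simp add: power2_norm_eq_inner inner_vec_def power_mult_distrib sum_distrib_left)
       (simp add: norm_mult power2_norm_eq_inner[symmetric] power_mult_distrib)
  then show ?thesis by (simp add: power2_eq_iff_nonneg)
qed

definition sym_form :: "(complex ^ 'n \<Rightarrow> complex ^ 'n \<Rightarrow> real) \<Rightarrow> bool" where
  "sym_form h \<longleftrightarrow> bounded_bilinear h \<and> (\<forall>u v. h u v = h v u)"

lemma bounded_linear_vec_linear:
  assumes "Vector_Spaces.linear (*s) (*s) (f :: complex ^ 'n \<Rightarrow> complex ^ 'm)"
  shows "bounded_linear f"
proof -
  have "(*v) (matrix f) = f" using matrix_works[OF assms] by auto
  then show ?thesis using matrix_vector_mul_bounded_linear[of "matrix f"] by simp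
qed

lemma sym_form_extend:
  assumes h: "sym_form h" and f: "bounded_linear p" "bounded_linear (f :: complex ^ 'n \<Rightarrow> complex ^ 'n)"
  shows "sym_form (\<lambda>u v. h (p u) (p v) + (k::real) * inner (f u) (f v))"
proof -
  interpret h: bounded_bilinear h using h by (simp add: sym_form_def)
  have "bounded_bilinear (\<lambda>u v. h (p u) (p v))" by (rule h.comp[OF f(1) f(1)])
  then interpret h1: bounded_bilinear "\<lambda>u v. h (p u) (p v)" .
  have "bounded_bilinear (\<lambda>u v. inner (f u) (f v))"
    by (rule bounded_bilinear.comp[OF bounded_bilinear_inner f(2) f(2)])
  then interpret h2: bounded_bilinear "\<lambda>u v. inner (f u) (f v)" .
  have "bilinear (\<lambda>u v. h (p u) (p v) + k * inner (f u) (f v))"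
    unfolding bilinear_def linear_iff
    by (simp add: h1.add_left h1.add_right h2.add_left h2.add_right h1.scaleR_left h1.scaleR_right
        h2.scaleR_left h2.scaleR_right algebra_simps)
  then show ?thesis
    using h by (simp add: sym_form_def bilinear_conv_bounded_bilinear inner_commute)
qed

text \<open>On the space spanned by \<open>T\<close> and \<open>b\<close> let \<open>f\<close> be the
  projection onto the line of \<open>b\<close> along \<open>T\<close>. Take the given form on the
  component in \<open>T\<close> plus \<open>k\<close> times the inner product of the components
  along \<open>b\<close>, where \<open>k\<close> has the sign of \<open>Re \<mu>\<close>. For
  \<open>|k|\<close> large the new diagonal term absorbs the coupling \<open>h(s, a t0)\<close>,
  which arises because \<open>M b\<close> has the component \<open>t0\<close> in \<open>T\<close>.\<close>

lemma hyperbolic_form_step: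
  fixes M :: "complex ^ 'n ^ 'n"
  assumes T: "vec.subspace T" and h: "sym_form h" "0 < c" "\<And>v. v \<in> T \<Longrightarrow> c * (norm v)\<^sup>2 \<le> h v (M *v v)"
    and TM: "\<And>v. v \<in> T \<Longrightarrow> M *v v \<in> T"
    and b: "b \<notin> T" "shift_op M \<mu> b \<in> T" "Re \<mu> \<noteq> 0"
  shows "\<exists>h' c'. sym_form h' \<and> 0 < c' \<and> (\<forall>v\<in>vec.span (insert b T). c' * (norm v)\<^sup>2 \<le> h' v (M *v v))"
proof -
  interpret h: bounded_bilinear h using h by (simp add: sym_form_def)
  obtain B where B: "B \<subseteq> T" "vec.independent B" "T \<subseteq> vec.span B"
    using vec.basis_exists by metis
  have "vec.span B = T" using B T by (metis vec.span_minimal subset_antisym)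
  then have "vec.independent (insert b B)"
    using B(2) b(1) by (intro vec.independent_insertI) auto
  then obtain f where f: "Vector_Spaces.linear (*s) (*s) f" "\<forall>x\<in>insert b B. f x = (if x = b then b else 0)"
    using vec.linear_independent_extend[of "insert b B" "\<lambda>x. if x = b then b else 0"] by blast
  interpret f: Vector_Spaces.linear "(*s)" "(*s)" f by (rule f(1))
  have fb: "f b = b" using f(2) by simp
  have fT: "f t = 0" if "t \<in> T" for t
  proof -
    have "\<forall>x\<in>B. f x = 0" using f(2) B(1) b(1) by auto
    then show ?thesis using f.eq_0_on_span[of B t] that \<open>vec.span B = T\<close> by blast
  qed
  have fl: "bounded_linear f" using f(1) by (rule bounded_linear_vec_linear)
  then have pl: "bounded_linear (\<lambda>v. v - f v)" by (intro bounded_linear_sub bounded_linear_ident)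
  define t0 where "t0 = shift_op M \<mu> b"
  obtain C where C: "0 < C" "\<And>u v. norm (h u v) \<le> norm u * norm v * C"
    using h.pos_bounded by blast
  have bn: "0 < norm b" using b(1) T vec.subspace_0 by fastforce
  \<comment> \<open>The value for which \<open>k Re \<mu> |b|\<^sup>2\<close> equals the coefficient needed in Young's inequality for the coupling, plus \<open>c\<close>.\<close>
  define k where "k = sgn (Re \<mu>) * ((C * norm t0)\<^sup>2 / (2 * c) + c) / (\<bar>Re \<mu>\<bar> * (norm b)\<^sup>2)"
  define h' where "h' u v = h (u - f u) (v - f v) + k * inner (f u) (f v)" for u v
  define c' where "c' = min (c / 4) (c / (2 * (norm b)\<^sup>2))"
  have c': "0 < c'" "4 * c' \<le> c" "2 * (norm b)\<^sup>2 * c' \<le> c"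
    using h(2) bn by (auto simp: c'_def min_def field_simps)
  have "c' * (norm v)\<^sup>2 \<le> h' v (M *v v)" if v: "v \<in> vec.span (insert b T)" for v
  proof -
    obtain a where "v - a *s b \<in> vec.span T"
      using v vec.span_breakdown_eq by blast
    moreover have "vec.span T = T" using T by (simp add: vec.span_eq_iff)
    ultimately obtain s where s: "s \<in> T" "v = s + a *s b" by force
    have fv: "f v = a *s b" using s fT fb by (simp add: f.add f.scale)
    have Mb: "M *v b = \<mu> *s b + t0" by (simp add: t0_def shift_op_def)
    have Mv: "M *v v = (M *v s + a *s t0) + (\<mu> * a) *s b"
      by (simp add: s(2) Mb matrix_vector_right_distrib vec.scale vec.scale_right_distrib mult.commute)
    have in_T: "M *v s + a *s t0 \<in> T"
      using T TM s(1) b(2) by (auto simp: t0_def intro!: vec.subspace_add vec.subspace_scale)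
    have fMv: "f (M *v v) = \<mu> *s (a *s b)"
      unfolding Mv using fT[OF in_T] fb by (simp add: f.add f.scale)
    have "h' v (M *v v) = h s (M *v s + a *s t0) + k * inner (a *s b) (\<mu> *s (a *s b))"
    proof -
      have "M *v v - \<mu> *s (a *s b) = M *v s + a *s t0" by (simp add: Mv)
      moreover have "v - a *s b = s" by (simp add: s(2))
      ultimately show ?thesis by (simp only: h'_def fv fMv)
    qed
    also have "\<dots> = h s (M *v s) + h s (a *s t0) + k * Re \<mu> * (norm a * norm b)\<^sup>2"
      by (simp only: h.add_right inner_scale_self norm_scale_vec mult.assoc)
    also have "k * Re \<mu> * (norm a * norm b)\<^sup>2 = ((C * norm t0)\<^sup>2 / (2 * c) + c) * (norm a)\<^sup>2"
    proof -
      have "k * Re \<mu> * (norm b)\<^sup>2 = (C * norm t0)\<^sup>2 / (2 * c) + c"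
        using bn b(3) by (simp add: k_def sgn_if)
      then show ?thesis by (metis (no_types, lifting) mult.assoc mult.commute power_mult_distrib)
    qed
    finally have eq: "h' v (M *v v) = h s (M *v s) + h s (a *s t0) + ((C * norm t0)\<^sup>2 / (2 * c) + c) * (norm a)\<^sup>2" .
    have "\<bar>h s (a *s t0)\<bar> \<le> norm s * norm (a *s t0) * C" using C(2)[of s "a *s t0"] by simp
    then have 1: "- (norm s * (norm a * (C * norm t0))) \<le> h s (a *s t0)"
      by (simp add: norm_scale_vec abs_le_iff algebra_simps)
    have 2: "norm s * (norm a * (C * norm t0)) \<le> c / 2 * (norm s)\<^sup>2 + (C * norm t0)\<^sup>2 / (2 * c) * (norm a)\<^sup>2"
    proof -
      have "0 \<le> (c * norm s - norm a * (C * norm t0))\<^sup>2" by simp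
      then have "2 * c * (norm s * (norm a * (C * norm t0))) \<le> (c * norm s)\<^sup>2 + (norm a * (C * norm t0))\<^sup>2"
        by (simp add: power2_diff algebra_simps)
      also have "\<dots> = 2 * c * (c / 2 * (norm s)\<^sup>2 + (C * norm t0)\<^sup>2 / (2 * c) * (norm a)\<^sup>2)"
        using h(2) by (simp add: power_mult_distrib field_simps power2_eq_square)
      finally show ?thesis using h(2) by simp
    qed
    have 3: "c / 2 * (norm s)\<^sup>2 + c * (norm a)\<^sup>2 \<le> h' v (M *v v)"
    proof -
      have "c / 2 * (norm s)\<^sup>2 = (c * (norm s)\<^sup>2) / 2" by simp
      then show ?thesis using eq 1 2 h(3)[OF s(1)] unfolding distrib_right by linarith
    qed
    have "(norm v)\<^sup>2 \<le> (norm s + norm a * norm b)\<^sup>2"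
      using norm_triangle_ineq[of s "a *s b"] by (intro power_mono) (auto simp: s(2) norm_scale_vec)
    also have "\<dots> \<le> 2 * (norm s)\<^sup>2 + 2 * (norm a)\<^sup>2 * (norm b)\<^sup>2"
    proof -
      have "0 \<le> (norm s - norm a * norm b)\<^sup>2" by simp
      then show ?thesis by (simp add: power2_diff power2_sum power_mult_distrib)
    qed
    finally have "c' * (norm v)\<^sup>2 \<le> c' * (2 * (norm s)\<^sup>2 + 2 * (norm a)\<^sup>2 * (norm b)\<^sup>2)"
      using c'(1) by simp
    also have "\<dots> = (4 * c') * (norm s)\<^sup>2 / 2 + (2 * (norm b)\<^sup>2 * c') * (norm a)\<^sup>2"
      by (simp add: algebra_simps)
    also have "\<dots> \<le> c * (norm s)\<^sup>2 / 2 + c * (norm a)\<^sup>2"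
      using c' by (intro add_mono divide_right_mono mult_right_mono) auto
    finally show ?thesis using 3 by simp
  qed
  moreover have "sym_form h'"
    using sym_form_extend[OF h(1) pl fl, of k] by (simp add: h'_def[abs_def])
  ultimately show ?thesis using c'(1) by blast
qed

text \<open>A flag of invariant subspaces is built from \<open>{0}\<close> upwards, extending the form at each
  step. Only eigenvalues of \<open>M\<close> occur, so hyperbolicity guarantees \<open>Re \<mu>
  \<noteq> 0\<close>. On \<open>{0}\<close> any symmetric form serves.\<close>

lemma hyperbolic_form_exists:
  fixes M :: "complex ^ 'n ^ 'n"
  assumes "hyperbolic M"
  shows "\<exists>h c. sym_form h \<and> 0 < c \<and> (\<forall>v. c * (norm v)\<^sup>2 \<le> h v (M *v v))"
proof -
  have "\<exists>T h c. vec.subspace T \<and> vec.dim T = n \<and> (\<forall>v\<in>T. M *v v \<in> T) \<and> sym_form h \<and> 0 < c \<and>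
      (\<forall>v\<in>T. c * (norm v)\<^sup>2 \<le> h v (M *v v))" if "n \<le> CARD('n)" for n
    using that
  proof (induction n)
    case 0
    have "sym_form (\<lambda>u v. inner u v)" by (simp add: sym_form_def bounded_bilinear_inner inner_commute)
    then show ?case
      by (intro exI[of _ "{0}"] exI[of _ "\<lambda>u v. inner u v"] exI[of _ 1]) (auto simp: vec.subspace_def)
  next
    case (Suc n)
    then obtain T h c where T: "vec.subspace T" "vec.dim T = n" "\<forall>v\<in>T. M *v v \<in> T" "sym_form h" "0 < c"
      "\<forall>v\<in>T. c * (norm v)\<^sup>2 \<le> h v (M *v v)" by auto
    have "T \<noteq> UNIV" using T(2) Suc.prems vec_dim_card[where ?'n='n and ?'a=complex] by auto
    then obtain b0 where "b0 \<notin> T" by blast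
    from exists_eigenvector_mod_invariant[OF T(1) _ this]
    obtain b \<mu> where b: "b \<notin> T" "shift_op M \<mu> b \<in> T" "is_eigenvalue M \<mu>" using T(3) by blast
    have \<mu>: "Re \<mu> \<noteq> 0" using assms b(3) by (auto simp: hyperbolic_def)
    have spT: "vec.span T = T" using T(1) by (simp add: vec.span_eq_iff)
    obtain h' c' where h': "sym_form h'" "0 < c'" "\<forall>v\<in>vec.span (insert b T). c' * (norm v)\<^sup>2 \<le> h' v (M *v v)"
      using hyperbolic_form_step[OF T(1,4,5) _ _ b(1,2) \<mu>] T(3,6) by blast
    have "vec.dim (vec.span (insert b T)) = Suc n"
    proof -
      have "b \<notin> vec.span T" using b(1) unfolding spT .
      then show ?thesis using T(2) by (simp add: vec.dim_insert)
    qed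
    moreover have "(*v) M ` vec.span (insert b T) \<subseteq> vec.span (insert b T)"
      unfolding vec.span_image[symmetric]
    proof (intro vec.span_minimal)
      have "M *v b = shift_op M \<mu> b + \<mu> *s b" by (simp add: shift_op_def)
      then have "M *v b \<in> vec.span (insert b T)"
        using b(2) by (auto intro!: vec.span_add vec.span_scale intro: vec.span_base)
      then show "(*v) M ` insert b T \<subseteq> vec.span (insert b T)"
        using T(3) by (auto intro: vec.span_base)
    qed simp
    ultimately show ?case using h' by (intro exI[of _ "vec.span (insert b T)"] exI[of _ h'] exI[of _ c']) auto
  qed
  from this[OF order_refl] obtain T h c where T: "vec.subspace T" "vec.dim T = CARD('n)" "sym_form h" "0 < c"
      "\<forall>v\<in>T. c * (norm v)\<^sup>2 \<le> h v (M *v v)" by blast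
  have "T = UNIV"
    using vec.subspace_dim_equal[OF T(1) vec.subspace_UNIV] T(2) vec_dim_card[where ?'n='n and ?'a=complex] by simp
  then show ?thesis using T by blast
qed

definition decaying :: "complex ^ 'n ^ 'n \<Rightarrow> complex ^ 'n \<Rightarrow> bool" where
  "decaying M v \<longleftrightarrow> (\<exists>u. u 0 = v \<and> (\<forall>x. (u has_vector_derivative M *v u x) (at x)) \<and> (u \<longlongrightarrow> 0) at_top)"

lemma power_exp_tendsto_0:
  assumes "a < 0" shows "((\<lambda>x::real. x ^ i * exp (a * x)) \<longlongrightarrow> 0) at_top"
proof -
  have "filterlim (\<lambda>x. - a * x) at_top at_top"
    using assms by (intro filterlim_tendsto_pos_mult_at_top[OF tendsto_const _ filterlim_ident]) auto
  from filterlim_compose[OF tendsto_power_div_exp_0 this]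
  have "((\<lambda>x. (- a * x) ^ i / exp (- a * x)) \<longlongrightarrow> 0) at_top" .
  then have "((\<lambda>x. inverse ((- a) ^ i) * ((- a * x) ^ i / exp (- a * x))) \<longlongrightarrow> inverse ((- a) ^ i) * 0) at_top"
    by (intro tendsto_mult tendsto_const)
  moreover have "inverse ((- a) ^ i) * ((- a * x) ^ i / exp (- a * x)) = x ^ i * exp (a * x)" for x
  proof -
    have "(- a * x) ^ i = (- a) ^ i * x ^ i" by (rule power_mult_distrib)
    moreover have "(- a) ^ i \<noteq> 0" using assms by simp
    ultimately show ?thesis by (simp add: exp_minus field_simps)
  qed
  ultimately show ?thesis by simp
qed

text \<open>The solution is \<open>e\<^sup>\<mu>\<^sup>x\<close> times a polynomial in \<open>x\<close>, the
  exponential series of the nilpotent part.\<close>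

lemma decaying_generalized_eigenvector:
  fixes M :: "complex ^ 'n ^ 'n"
  assumes "Re \<mu> < 0" "(shift_op M \<mu> ^^ k) v = 0"
  shows "decaying M v"
proof -
  let ?n = "shift_op M \<mu>"
  interpret N: Vector_Spaces.linear "(*s)" "(*s)" ?n by (rule linear_shift_op)
  have N0: "?n 0 = 0" by (rule N.zero)
  have vk: "(?n ^^ Suc k) v = 0" using assms(2) N0 by simp
  define c where "c i x = exp (\<mu> * of_real x) * ((of_real x) ^ i / fact i)" for i x
  define d where "d i x = \<mu> * c i x + (case i of 0 \<Rightarrow> 0 | Suc j \<Rightarrow> c j x)" for i x
  have cd: "(c i has_vector_derivative d i x) (at x)" for i x
  proof -
    have 1: "((\<lambda>w. w ^ i / fact i) has_field_derivative (case i of 0 \<Rightarrow> 0 | Suc j \<Rightarrow> w ^ j / fact j)) (at w)"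
      for w :: complex
    proof (cases i)
      case (Suc j)
      have "((\<lambda>w. w ^ Suc j / fact (Suc j)) has_field_derivative of_nat (Suc j) * w ^ j / fact (Suc j)) (at w)"
      proof (rule DERIV_cdivide)
        show "((\<lambda>w. w ^ Suc j) has_field_derivative of_nat (Suc j) * w ^ j) (at w)"
          by (rule derivative_eq_intros refl)+ (simp del: of_nat_Suc)
      qed
      moreover have "of_nat (Suc j) * w ^ j / fact (Suc j) = w ^ j / fact j"
        by (simp only: fact_Suc of_nat_mult) (simp del: of_nat_Suc)
      ultimately show ?thesis by (simp only: Suc nat.case)
    qed simp
    have 2: "((\<lambda>w. exp (\<mu> * w)) has_field_derivative exp (\<mu> * w) * \<mu>) (at w)" for w
      by (auto intro!: derivative_eq_intros)
    have "d i x = exp (\<mu> * of_real x) * \<mu> * (of_real x ^ i / fact i)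
        + (case i of 0 \<Rightarrow> 0 | Suc j \<Rightarrow> of_real x ^ j / fact j) * exp (\<mu> * of_real x)"
      by (cases i) (simp_all add: c_def d_def mult_ac)
    then have "((\<lambda>w. exp (\<mu> * w) * (w ^ i / fact i)) has_field_derivative d i x) (at (of_real x))"
      using DERIV_mult[OF 2 1, of "of_real x"] by simp
    from has_vector_derivative_real_field[OF this] show ?thesis by (simp add: c_def[abs_def])
  qed
  define u where "u x = (\<Sum>i\<le>k. c i x *s (?n ^^ i) v)" for x
  have bl: "bounded_linear (\<lambda>a::complex. a *s w)" for w :: "complex ^ 'n"
    unfolding linear_conv_bounded_linear[symmetric]
    by (auto simp: linear_iff vec_eq_iff algebra_simps)
  have "u 0 = v"
  proof -
    have "c i 0 = (if i = 0 then 1 else 0)" for i by (cases i) (auto simp: c_def)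
    then have "u 0 = (\<Sum>i\<le>k. if i = 0 then v else 0)"
      unfolding u_def by (intro sum.cong) auto
    then show ?thesis by simp
  qed
  moreover have "(u has_vector_derivative M *v u x) (at x)" for x
  proof -
    have "(u has_vector_derivative (\<Sum>i\<le>k. d i x *s (?n ^^ i) v)) (at x)"
      unfolding u_def
      by (intro has_vector_derivative_sum bounded_linear.has_vector_derivative[OF bl cd])
    moreover have "(\<Sum>i\<le>k. d i x *s (?n ^^ i) v) = M *v u x"
    proof -
      have "(\<Sum>i\<le>k. d i x *s (?n ^^ i) v) = \<mu> *s u x + (\<Sum>i\<le>k. (case i of 0 \<Rightarrow> 0 | Suc j \<Rightarrow> c j x) *s (?n ^^ i) v)"
        by (simp only: d_def u_def vec.scale_left_distrib sum.distrib vec.scale_sum_right vec.scale_scale)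
      also have "(\<Sum>i\<le>k. (case i of 0 \<Rightarrow> 0 | Suc j \<Rightarrow> c j x) *s (?n ^^ i) v)
          = (\<Sum>i\<le>Suc k. (case i of 0 \<Rightarrow> 0 | Suc j \<Rightarrow> c j x) *s (?n ^^ i) v)"
        by (simp only: sum.atMost_Suc vk) simp
      also have "\<dots> = (\<Sum>i\<le>k. c i x *s ?n ((?n ^^ i) v))"
        by (subst sum.atMost_Suc_shift) simp
      also have "\<dots> = ?n (u x)"
        by (simp add: u_def N.sum N.scale)
      also have "\<mu> *s u x + ?n (u x) = M *v u x" by (simp add: shift_op_def)
      finally show ?thesis .
    qed
    ultimately show ?thesis by simp
  qed
  moreover have "(u \<longlongrightarrow> 0) at_top"
  proof -
    have "(c i \<longlongrightarrow> 0) at_top" for i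
    proof (rule Lim_null_comparison)
      have "((\<lambda>x. x ^ i * exp (Re \<mu> * x) * inverse (fact i)) \<longlongrightarrow> 0 * inverse (fact i)) at_top"
        by (intro tendsto_mult tendsto_const power_exp_tendsto_0 assms)
      then show "((\<lambda>x. x ^ i * exp (Re \<mu> * x) * inverse (fact i)) \<longlongrightarrow> 0) at_top" by simp
      show "eventually (\<lambda>x. norm (c i x) \<le> x ^ i * exp (Re \<mu> * x) * inverse (fact i)) at_top"
        using eventually_ge_at_top[of 0]
        by eventually_elim (simp add: c_def norm_mult norm_divide norm_power field_simps)
    qed
    then have "(u \<longlongrightarrow> (\<Sum>i\<le>k. 0 *s (?n ^^ i) v)) at_top"
      unfolding u_def by (intro tendsto_sum bounded_linear.tendsto[OF bl])
    then show ?thesis by simp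
  qed
  ultimately show ?thesis unfolding decaying_def by blast
qed

lemma decaying_stable_space:
  fixes M :: "complex ^ 'n ^ 'n"
  assumes "v \<in> stable_space M" shows "decaying M v"
proof -
  let ?G = "{v. \<exists>\<mu>\<in>{\<mu>. Re \<mu> < 0}. \<exists>k::nat. (shift_op M \<mu> ^^ k) v = 0}"
  have "vec.subspace {v. decaying M v}"
    unfolding vec.subspace_def
  proof (intro conjI ballI allI)
    show "0 \<in> {v. decaying M v}"
      by (auto simp: decaying_def intro!: exI[of _ "\<lambda>x. 0"])
    fix x assume "x \<in> {v. decaying M v}"
    then obtain u where u: "u 0 = x" "\<And>t. (u has_vector_derivative M *v u t) (at t)" "(u \<longlongrightarrow> 0) at_top"
      by (auto simp: decaying_def)
    fix c :: complex
    have bl: "bounded_linear (\<lambda>v::complex ^ 'n. c *s v)"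
      unfolding linear_conv_bounded_linear[symmetric] by (auto simp: linear_iff vec_eq_iff algebra_simps)
    show "c *s x \<in> {v. decaying M v}"
      using bounded_linear.has_vector_derivative[OF bl u(2)] bounded_linear.tendsto[OF bl u(3)] u(1)
      by (auto simp: decaying_def vec.scale intro!: exI[of _ "\<lambda>t. c *s u t"])
  next
    fix x y assume "x \<in> {v. decaying M v}" "y \<in> {v. decaying M v}"
    then obtain u w where u: "u 0 = x" "\<And>t. (u has_vector_derivative M *v u t) (at t)" "(u \<longlongrightarrow> 0) at_top"
      and w: "w 0 = y" "\<And>t. (w has_vector_derivative M *v w t) (at t)" "(w \<longlongrightarrow> 0) at_top"
      by (auto simp: decaying_def)
    show "x + y \<in> {v. decaying M v}"
      using has_vector_derivative_add[OF u(2) w(2)] tendsto_add[OF u(3) w(3)] u(1) w(1)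
      by (auto simp: decaying_def matrix_vector_right_distrib intro!: exI[of _ "\<lambda>t. u t + w t"])
  qed
  then have "vec.span ?G \<subseteq> {v. decaying M v}"
    using decaying_generalized_eigenvector by (intro vec.span_minimal) auto
  then show ?thesis using assms unfolding stable_space_def gen_eigenspace_shift_op by blast
qed

lemma sym_form_has_derivative:
  assumes "sym_form h" "(u has_vector_derivative w) (at x)"
  shows "((\<lambda>x. h (u x) (u x)) has_field_derivative 2 * h (u x) w) (at x)"
proof -
  interpret h: bounded_bilinear h using assms by (simp add: sym_form_def)
  have "((\<lambda>x. h (u x) (u x)) has_vector_derivative h (u x) w + h w (u x)) (at x)"
    by (rule h.has_vector_derivative[OF assms(2) assms(2)])
  moreover have "h w (u x) = h (u x) w" using assms(1) by (simp add: sym_form_def)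
  ultimately show ?thesis by (simp add: has_real_derivative_iff_has_vector_derivative)
qed

text \<open>Along the decaying solution that starts at \<open>v\<close> the function \<open>h(u, u)\<close>
  increases, strictly at the start, and it tends to \<open>0\<close>; hence it is negative at the
  start.\<close>

lemma form_neg_on_stable_space:
  assumes h: "sym_form h" "0 < c" "\<And>v. c * (norm v)\<^sup>2 \<le> h v (M *v v)"
    and v: "v \<in> stable_space M" "v \<noteq> 0"
  shows "h v v < 0"
proof -
  interpret h: bounded_bilinear h using h by (simp add: sym_form_def)
  obtain u where u: "u 0 = v" "\<And>t. (u has_vector_derivative M *v u t) (at t)" "(u \<longlongrightarrow> 0) at_top"
    using decaying_stable_space[OF v(1)] by (auto simp: decaying_def)
  define V where "V t = h (u t) (u t)" for t
  have V': "(V has_field_derivative 2 * h (u t) (M *v u t)) (at t)" for t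
    unfolding V_def[abs_def] by (rule sym_form_has_derivative[OF h(1) u(2)])
  have pos: "0 \<le> 2 * h (u t) (M *v u t)" for t
  proof -
    have "0 \<le> c * (norm (u t))\<^sup>2" using h(2) by simp
    then show ?thesis using h(3)[of "u t"] by linarith
  qed
  have mono: "V s \<le> V t" if "s \<le> t" for s t
    by (rule DERIV_nonneg_imp_nondecreasing[OF that]) (use V' pos in blast)
  have "0 < c * (norm (u 0))\<^sup>2" using h(2) v(2) u(1) by simp
  then have "0 < 2 * h (u 0) (M *v u 0)" using h(3)[of "u 0"] by linarith
  then obtain e where e: "0 < e" "\<And>t. 0 < t \<Longrightarrow> t < e \<Longrightarrow> V 0 < V t"
    using DERIV_pos_inc_right[OF V'] by fastforce
  have "V 0 < V (e / 2)" using e by simp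
  moreover have "V (e / 2) \<le> 0"
  proof (rule tendsto_lowerbound)
    have "(V \<longlongrightarrow> h 0 0) at_top" unfolding V_def[abs_def] by (intro h.tendsto u(3))
    then show "(V \<longlongrightarrow> 0) at_top" by (simp add: h.zero_left)
    show "eventually (\<lambda>t. V (e / 2) \<le> V t) at_top"
      using eventually_ge_at_top[of "e / 2"] by eventually_elim (rule mono)
  qed simp
  ultimately show ?thesis by (simp add: V_def u(1))
qed

lemma form_pos_on_unstable_space:
  assumes h: "sym_form h" "0 < c" "\<And>v. c * (norm v)\<^sup>2 \<le> h v (M *v v)"
    and v: "v \<in> unstable_space M" "v \<noteq> 0"
  shows "0 < h v v"
proof -
  interpret h: bounded_bilinear h using h by (simp add: sym_form_def)
  have "bilinear (\<lambda>u v. - h u v)"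
    unfolding bilinear_def linear_iff
    by (simp add: h.add_left h.add_right h.scaleR_left h.scaleR_right)
  then have "sym_form (\<lambda>u v. - h u v)"
    using h(1) by (simp add: sym_form_def bilinear_conv_bounded_bilinear)
  then have "- h v v < 0"
    by (rule form_neg_on_stable_space[where M="- M" and c=c])
       (use h v in \<open>auto simp: stable_space_uminus mvm.minus_left h.minus_right\<close>)
  then show ?thesis by simp
qed

section \<open>Solutions of finite energy on a half line\<close>

lemma basis_of_coords:
  assumes "basis_of I b V" "v \<in> V"
  obtains k :: "complex ^ 'n" where "\<And>j. j \<notin> I \<Longrightarrow> k $ j = 0" "v = (\<Sum>j\<in>I. k $ j *s b j)"
proof -
  have b: "inj_on b I" "vec.span (b ` I) = V" using assms by (auto simp: basis_of_def)
  have "finite (b ` I)" by simp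
  then obtain u where "v = (\<Sum>w\<in>b ` I. u w *s w)"
    using assms(2) b(2) vec.span_finite[of "b ` I"] by auto
  then have "v = (\<Sum>j\<in>I. u (b j) *s b j)" by (simp add: sum.reindex[OF b(1)])
  then have "v = (\<Sum>j\<in>I. (\<chi> j. if j \<in> I then u (b j) else 0) $ j *s b j)" by simp
  then show ?thesis by (intro that[of "\<chi> j. if j \<in> I then u (b j) else 0"]) auto
qed

lemma basis_of_combination_in:
  assumes "basis_of I b V" shows "(\<Sum>j\<in>I. k j *s b j) \<in> V"
proof -
  have "vec.span (b ` I) = V" using assms by (simp add: basis_of_def)
  then show ?thesis by (metis (no_types, lifting) image_eqI vec.span_base vec.span_scale vec.span_sum)
qed

lemma basis_of_combination_0:
  fixes b :: "'n \<Rightarrow> complex ^ 'n"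
  assumes "basis_of I b V" "(\<Sum>j\<in>I. k j *s b j) = 0" "j \<in> I"
  shows "k j = 0"
proof (rule ccontr)
  assume "k j \<noteq> 0"
  have b: "inj_on b I" "\<not> vec.dependent (b ` I)" using assms by (auto simp: basis_of_def)
  define u where "u = k \<circ> the_inv_into I b"
  have u: "u (b i) = k i" if "i \<in> I" for i
    using that by (simp add: u_def the_inv_into_f_f[OF b(1)])
  have "(\<Sum>v\<in>b ` I. u v *s v) = 0"
    using assms(2) u by (simp add: sum.reindex[OF b(1)])
  moreover have "u (b j) \<noteq> 0" using u assms(3) \<open>k j \<noteq> 0\<close> by simp
  ultimately have "vec.dependent (b ` I)"
    using assms(3) by (subst vec.dependent_finite) auto
  then show False using b(2) by simp
qed

lemma basis_of_dim:
  fixes b :: "'n \<Rightarrow> complex ^ 'n"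
  assumes "basis_of I b V" shows "vec.dim V = card I"
proof -
  have "vec.dim V = card (b ` I)"
    using assms vec.dim_span_eq_card_independent[of "b ` I"] unfolding basis_of_def by metis
  then show ?thesis using assms by (simp add: basis_of_def card_image)
qed

lemma basis_of_subspace: "basis_of I b V \<Longrightarrow> vec.subspace V"
  by (auto simp: basis_of_def)

lemma vec_scaleR_conv: "r *\<^sub>R v = complex_of_real r *s v" for v :: "complex ^ 'n"
  by (simp add: vec_eq_iff scaleR_conv_of_real[where 'a=complex])

lemma bounded_bilinear_scale_vec: "bounded_bilinear (\<lambda>(a::complex) (v::complex ^ 'n). a *s v)"
proof -
  have "bilinear (\<lambda>(a::complex) (v::complex ^ 'n). a *s v)"
    unfolding bilinear_def linear_iff by (auto simp: vec_eq_iff algebra_simps)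
  then show ?thesis by (simp add: bilinear_conv_bounded_bilinear)
qed

interpretation scale_vec: bounded_bilinear "\<lambda>(a::complex) (v::complex ^ 'n). a *s v"
  by (rule bounded_bilinear_scale_vec)

text \<open>On the unit sphere of coefficient vectors the form is at most \<open>- m\<close> along the limit
  frame, by compactness. The form changes little when the frame does, so it remains negative for
  frames near the limit.\<close>

lemma form_negative_near_subspace:
  fixes V :: "(complex ^ 'n) set" and E :: "'a \<Rightarrow> (complex ^ 'n) set"
  assumes h: "sym_form h" and neg: "\<And>v. v \<in> V \<Longrightarrow> v \<noteq> 0 \<Longrightarrow> h v v < 0" and E: "grass_tendsto E V F"
  shows "eventually (\<lambda>x. vec.dim (E x) = vec.dim V \<and> (\<forall>v\<in>E x. h v v \<le> 0)) F"
proof -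
  interpret h: bounded_bilinear h using h by (simp add: sym_form_def)
  obtain I b b0 where b: "basis_of I b0 V" "\<forall>j\<in>I. ((\<lambda>x. b x j) \<longlongrightarrow> b0 j) F"
    "eventually (\<lambda>x. basis_of I (b x) (E x)) F"
    using E unfolding grass_tendsto_def by blast
  obtain C where C: "0 < C" "\<And>u v. norm (h u v) \<le> norm u * norm v * C"
    using h.pos_bounded by blast
  \<comment> \<open>Coefficient vectors are supported in the index set of the frame.\<close>
  define S where "S = {k::complex ^ 'n. norm k = 1} \<inter> {k. \<forall>j. j \<notin> I \<longrightarrow> k $ j = 0}"
  define s where "s c k = (\<Sum>j\<in>I. k $ j *s c j)" for c :: "'n \<Rightarrow> complex ^ 'n" and k :: "complex ^ 'n"
  have "compact S"
  proof -
    have "closed {k::complex ^ 'n. \<forall>j. j \<notin> I \<longrightarrow> k $ j = 0}"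
      by (intro closed_Collect_all closed_Collect_imp closed_Collect_eq continuous_intros) auto
    moreover have "compact {k::complex ^ 'n. norm k = 1}"
      using compact_sphere[of "0::complex ^ 'n" 1] by (simp add: sphere_def)
    ultimately show ?thesis unfolding S_def by (rule compact_Int_closed[rotated])
  qed
  have cont: "continuous_on S (\<lambda>k. h (s b0 k) (s b0 k))"
    unfolding s_def by (intro h.continuous_on continuous_on_sum scale_vec.continuous_on continuous_intros)
  have neg0: "h (s b0 k) (s b0 k) < 0" if k: "k \<in> S" for k
  proof (rule neg)
    show "s b0 k \<in> V" unfolding s_def by (rule basis_of_combination_in[OF b(1)])
    show "s b0 k \<noteq> 0"
    proof
      assume "s b0 k = 0"
      then have "k $ j = 0" for j
        using basis_of_combination_0[OF b(1), of "\<lambda>j. k $ j" j] k by (cases "j \<in> I") (auto simp: s_def S_def)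
      then have "k = 0" by (simp add: vec_eq_iff)
      then show False using k by (simp add: S_def)
    qed
  qed
  obtain m where m: "0 < m" "\<And>k. k \<in> S \<Longrightarrow> h (s b0 k) (s b0 k) \<le> - m"
  proof (cases "S = {}")
    case True
    then show ?thesis using that[of 1] by auto
  next
    case False
    obtain k0 where k0: "k0 \<in> S" "\<And>k. k \<in> S \<Longrightarrow> h (s b0 k) (s b0 k) \<le> h (s b0 k0) (s b0 k0)"
      using continuous_attains_sup[OF \<open>compact S\<close> False cont] by blast
    show ?thesis
      by (rule that[of "- h (s b0 k0) (s b0 k0)"]) (use neg0[OF k0(1)] k0(2) in auto)
  qed
  define \<delta> where "\<delta> x = (\<Sum>j\<in>I. norm (b x j - b0 j))" for x
  define B where "B = (\<Sum>j\<in>I. norm (b0 j))"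
  have "(\<delta> \<longlongrightarrow> (\<Sum>j\<in>I. norm (b0 j - b0 j))) F"
    unfolding \<delta>_def using b(2) by (intro tendsto_sum tendsto_norm tendsto_diff tendsto_const) auto
  then have d0: "(\<delta> \<longlongrightarrow> 0) F" by simp
  have "((\<lambda>x. C * \<delta> x * (2 * B + \<delta> x)) \<longlongrightarrow> C * 0 * (2 * B + 0)) F"
    by (intro tendsto_intros d0)
  then have "((\<lambda>x. C * \<delta> x * (2 * B + \<delta> x)) \<longlongrightarrow> 0) F" by simp
  then have "eventually (\<lambda>x. C * \<delta> x * (2 * B + \<delta> x) < m) F"
    by (rule order_tendstoD(2)) (rule m(1))
  then show ?thesis
    using b(3)
  proof eventually_elim
    case (elim x)
    have d: "0 \<le> \<delta> x" by (simp add: \<delta>_def sum_nonneg)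
    have unit: "h (s (b x) k) (s (b x) k) \<le> 0" if k: "k \<in> S" for k
    proof -
      let ?v = "s (b x) k" and ?w = "s b0 k"
      have kj: "norm (k $ j) \<le> 1" for j
        using k Finite_Cartesian_Product.norm_nth_le[of k j] by (simp add: S_def)
      have kn: "norm (k $ j *s y) \<le> norm y" for j and y :: "complex ^ 'n"
        using kj[of j] by (simp add: norm_scale_vec mult_left_le_one_le)
      have "?v - ?w = (\<Sum>j\<in>I. k $ j *s (b x j - b0 j))"
        by (simp add: s_def sum_subtractf vec.scale_right_diff_distrib)
      then have "norm (?v - ?w) \<le> (\<Sum>j\<in>I. norm (k $ j *s (b x j - b0 j)))"
        using norm_sum by metis
      also have "\<dots> \<le> \<delta> x"
        unfolding \<delta>_def by (intro sum_mono kn)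
      finally have vw: "norm (?v - ?w) \<le> \<delta> x" .
      have "norm ?w \<le> (\<Sum>j\<in>I. norm (k $ j *s b0 j))" unfolding s_def by (rule norm_sum)
      also have "\<dots> \<le> B"
        unfolding B_def by (intro sum_mono kn)
      finally have w: "norm ?w \<le> B" .
      have v: "norm ?v \<le> B + \<delta> x"
        using norm_triangle_ineq[of ?w "?v - ?w"] vw w by simp
      have "h ?v ?v - h ?w ?w = h (?v - ?w) ?v + h ?w (?v - ?w)"
        by (simp add: h.diff_left h.diff_right)
      also have "\<dots> \<le> norm (?v - ?w) * norm ?v * C + norm ?w * norm (?v - ?w) * C"
        using C(2)[of "?v - ?w" ?v] C(2)[of ?w "?v - ?w"] by simp
      also have "\<dots> \<le> \<delta> x * (B + \<delta> x) * C + B * \<delta> x * C"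
        using vw v w C(1) d order_trans[OF norm_ge_zero w] by (intro add_mono mult_right_mono mult_mono) auto
      also have "\<dots> = C * \<delta> x * (2 * B + \<delta> x)" by (simp add: algebra_simps)
      finally show ?thesis using elim(1) m(2)[OF k] by simp
    qed
    have "h v v \<le> 0" if vE: "v \<in> E x" for v
    proof -
      obtain k where k: "\<And>j. j \<notin> I \<Longrightarrow> k $ j = 0" "v = (\<Sum>j\<in>I. k $ j *s b x j)"
        using basis_of_coords[OF elim(2) vE] by metis
      show ?thesis
      proof (cases "k = 0")
        case True
        then show ?thesis using k(2) by (simp add: h.zero_left)
      next
        case False
        define r where "r = norm k"
        have r: "0 < r" using False by (simp add: r_def)
        have kS: "inverse r *\<^sub>R k \<in> S" using r k(1) by (simp add: S_def r_def)
        have "v = r *\<^sub>R s (b x) (inverse r *\<^sub>R k)"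
          using r by (simp add: k(2) s_def vec_scaleR_conv vec.scale_sum_right mult.assoc[symmetric])
        then have "h v v = r * (r * h (s (b x) (inverse r *\<^sub>R k)) (s (b x) (inverse r *\<^sub>R k)))"
          by (metis h.scaleR_left h.scaleR_right real_scaleR_def)
        then show ?thesis using unit[OF kS] r by (simp add: mult_nonneg_nonpos)
      qed
    qed
    moreover have "vec.dim (E x) = vec.dim V"
      using basis_of_dim[OF elim(2)] basis_of_dim[OF b(1)] by simp
    ultimately show ?case by blast
  qed
qed

text \<open>Square integrability on \<open>[0, \<infinity>)\<close>, in terms of proper integrals. This fits
  the growth estimate for the Lyapunov function, which is obtained on bounded intervals.\<close>

definition finite_energy :: "(real \<Rightarrow> complex ^ 'n) \<Rightarrow> bool" where
  "finite_energy u \<longleftrightarrow> (\<exists>C. \<forall>T\<ge>0. integral {0..T} (\<lambda>x. (norm (u x))\<^sup>2) \<le> C)"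

lemma norm_sq_integrable_on:
  fixes u :: "real \<Rightarrow> complex ^ 'n"
  assumes "continuous_on UNIV u" shows "(\<lambda>x. (norm (u x))\<^sup>2) integrable_on {a..b}"
proof -
  have "continuous_on {a..b} (\<lambda>x. (norm (u x))\<^sup>2)"
    by (intro continuous_intros continuous_on_subset[OF assms]) auto
  then show ?thesis by (rule integrable_continuous_interval)
qed

lemma finite_energyI_tail:
  assumes u: "continuous_on UNIV u" and X: "0 \<le> X"
    and tail: "\<And>T. X \<le> T \<Longrightarrow> integral {X..T} (\<lambda>x. (norm (u x))\<^sup>2) \<le> C"
  shows "finite_energy u"
proof -
  let ?f = "\<lambda>x. (norm (u x))\<^sup>2"
  note i = norm_sq_integrable_on[OF u]
  have "0 \<le> C" using tail[of X] by simp
  have "integral {0..T} ?f \<le> integral {0..X} ?f + C" if "0 \<le> T" for T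
  proof (cases "X \<le> T")
    case True
    then show ?thesis
      using Henstock_Kurzweil_Integration.integral_combine[OF X True i] tail[OF True] by simp
  next
    case False
    then have "integral {0..T} ?f \<le> integral {0..X} ?f"
      by (intro integral_subset_le i) auto
    then show ?thesis using \<open>0 \<le> C\<close> by simp
  qed
  then show ?thesis unfolding finite_energy_def by blast
qed

lemma finite_energy_of_integrable_bound:
  fixes f :: "real \<Rightarrow> real"
  assumes u: "continuous_on UNIV u" and f: "integrable lborel f" "\<And>x. 0 \<le> f x"
    and le: "\<And>x. a < x \<Longrightarrow> (norm (u x))\<^sup>2 \<le> f x"
  shows "finite_energy u"
proof (rule finite_energyI_tail[OF u])
  define X where "X = max 0 (a + 1)"
  show "0 \<le> X" by (simp add: X_def)
  have hi: "(f has_integral (LINT x|lborel. f x)) UNIV"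
    using f(1) by (rule has_integral_integral_lborel)
  fix T assume "X \<le> T"
  have fi: "f integrable_on {X..T}"
    using hi by (meson has_integral_integrable integrable_on_subinterval subset_UNIV)
  have "integral {X..T} (\<lambda>x. (norm (u x))\<^sup>2) \<le> integral {X..T} f"
    by (rule integral_le[OF norm_sq_integrable_on[OF u] fi]) (rule le, auto simp: X_def)
  also have "\<dots> \<le> integral UNIV f"
    by (rule integral_subset_le[OF _ fi]) (use hi f(2) in auto)
  also have "\<dots> = (LINT x|lborel. f x)" using hi by blast
  finally show "integral {X..T} (\<lambda>x. (norm (u x))\<^sup>2) \<le> (LINT x|lborel. f x)" .
qed

text \<open>Monotone convergence along the intervals \<open>[-n, n]\<close>.\<close>

lemma L2_of_finite_energy:
  fixes u :: "real \<Rightarrow> complex ^ 'n"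
  assumes u: "continuous_on UNIV u" and fe: "finite_energy u" "finite_energy (\<lambda>x. u (- x))"
  shows "u \<in> L2"
proof -
  let ?f = "\<lambda>x. (norm (u x))\<^sup>2"
  note i = norm_sq_integrable_on[OF u]
  obtain C1 where C1: "\<And>T. 0 \<le> T \<Longrightarrow> integral {0..T} ?f \<le> C1" using fe(1) unfolding finite_energy_def by blast
  obtain C2 where C2: "\<And>T. 0 \<le> T \<Longrightarrow> integral {0..T} (\<lambda>x. ?f (- x)) \<le> C2" using fe(2) unfolding finite_energy_def by blast
  have um: "u \<in> borel_measurable borel" using u by (rule borel_measurable_continuous_onI)
  have fc: "continuous_on S ?f" for S by (intro continuous_intros continuous_on_subset[OF u]) auto
  define g where "g n x = indicator {- real n..real n} x * ?f x" for n x
  have gi: "integrable lborel (g n)" for n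
    using borel_integrable_atLeastAtMost'[OF fc, of "- real n" "real n"]
    by (simp add: set_integrable_def g_def[abs_def])
  have g_int: "(LINT x|lborel. g n x) = integral {- real n..real n} ?f" for n
    using set_borel_integral_eq_integral(2)[OF borel_integrable_atLeastAtMost'[OF fc, of "- real n" "real n"]]
    by (simp add: set_lebesgue_integral_def g_def)
  have bound: "(LINT x|lborel. g n x) \<le> C1 + C2" for n
  proof -
    have "integral {- real n..real n} ?f = integral {- real n..0} ?f + integral {0..real n} ?f"
      using Henstock_Kurzweil_Integration.integral_combine[of "- real n" 0 "real n" ?f] i by simp
    moreover have "integral {- real n..0} ?f = integral {0..real n} (\<lambda>x. ?f (- x))"
      using Henstock_Kurzweil_Integration.integral_reflect_real[of "real n" 0 "\<lambda>x. ?f (- x)"] by simp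
    ultimately show ?thesis using C1[of "real n"] C2[of "real n"] g_int[of n] by simp
  qed
  have mono: "incseq (\<lambda>n. LINT x|lborel. g n x)"
  proof (rule incseq_SucI)
    show "(LINT x|lborel. g n x) \<le> (LINT x|lborel. g (Suc n) x)" for n
      by (rule integral_mono[OF gi gi]) (auto simp: g_def indicator_def)
  qed
  then obtain L where L: "(\<lambda>n. LINT x|lborel. g n x) \<longlonglongrightarrow> L"
    using incseq_convergent[OF mono] bound by metis
  have "integrable lborel ?f"
  proof (rule integrable_monotone_convergence[OF gi _ _ L])
    show "AE x in lborel. mono (\<lambda>n. g n x)"
      by (intro AE_I2 monoI) (auto simp: g_def indicator_def)
    show "AE x in lborel. (\<lambda>n. g n x) \<longlonglongrightarrow> ?f x"
    proof (intro AE_I2 tendsto_eventually)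
      fix x :: real
      obtain N :: nat where "\<bar>x\<bar> \<le> real N" using real_arch_simple by blast
      then show "eventually (\<lambda>n. g n x = ?f x) sequentially"
        by (intro eventually_sequentiallyI[of N]) (auto simp: g_def indicator_def abs_le_iff)
    qed
    show "?f \<in> borel_measurable lborel" using um by measurable
  qed
  then show ?thesis using um by (simp add: L2_def)
qed

lemma finite_energy_subspace:
  fixes A :: "real \<Rightarrow> complex \<Rightarrow> complex ^ 'n ^ 'n"
  assumes c: "continuous_on UNIV (\<lambda>p. A (fst p) (snd p))"
  shows "vec.subspace {v. finite_energy (\<lambda>x. fundamental A x z *v v)}"
  unfolding vec.subspace_def
proof (intro conjI ballI allI)
  have uc: "continuous_on UNIV (\<lambda>x. fundamental A x z *v v)" for v
    by (rule fundamental_vec_continuous[OF c])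
  note i = norm_sq_integrable_on[OF uc]
  show "0 \<in> {v. finite_energy (\<lambda>x. fundamental A x z *v v)}"
    by (auto simp: finite_energy_def)
  fix v assume "v \<in> {v. finite_energy (\<lambda>x. fundamental A x z *v v)}"
  then obtain C where C: "\<And>T. 0 \<le> T \<Longrightarrow> integral {0..T} (\<lambda>x. (norm (fundamental A x z *v v))\<^sup>2) \<le> C"
    by (auto simp: finite_energy_def)
  show "k *s v \<in> {v. finite_energy (\<lambda>x. fundamental A x z *v v)}" for k
  proof -
    have "integral {0..T} (\<lambda>x. (norm (fundamental A x z *v (k *s v)))\<^sup>2) \<le> (norm k)\<^sup>2 * C" if "0 \<le> T" for T
      using C[OF that] by (simp add: vec.scale norm_scale_vec power_mult_distrib mult_left_mono)
    then show ?thesis by (auto simp: finite_energy_def)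
  qed
  fix w assume "w \<in> {v. finite_energy (\<lambda>x. fundamental A x z *v v)}"
  then obtain D where D: "\<And>T. 0 \<le> T \<Longrightarrow> integral {0..T} (\<lambda>x. (norm (fundamental A x z *v w))\<^sup>2) \<le> D"
    by (auto simp: finite_energy_def)
  have "integral {0..T} (\<lambda>x. (norm (fundamental A x z *v (v + w)))\<^sup>2) \<le> 2 * C + 2 * D" if T: "0 \<le> T" for T
  proof -
    have "integral {0..T} (\<lambda>x. (norm (fundamental A x z *v (v + w)))\<^sup>2)
      \<le> integral {0..T} (\<lambda>x. 2 * (norm (fundamental A x z *v v))\<^sup>2 + 2 * (norm (fundamental A x z *v w))\<^sup>2)"
    proof (rule integral_le)
      show "(\<lambda>x. 2 * (norm (fundamental A x z *v v))\<^sup>2 + 2 * (norm (fundamental A x z *v w))\<^sup>2) integrable_on {0..T}"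
        by (intro integrable_add integrable_on_mult_right i)
      fix x
      let ?a = "fundamental A x z *v v" and ?b = "fundamental A x z *v w"
      have "(norm (?a + ?b))\<^sup>2 \<le> (norm ?a + norm ?b)\<^sup>2"
        by (intro power_mono norm_triangle_ineq) auto
      also have "\<dots> \<le> 2 * (norm ?a)\<^sup>2 + 2 * (norm ?b)\<^sup>2"
      proof -
        have "0 \<le> (norm ?a - norm ?b)\<^sup>2" by simp
        then show ?thesis by (simp add: power2_diff power2_sum)
      qed
      finally show "(norm (fundamental A x z *v (v + w)))\<^sup>2 \<le> 2 * (norm ?a)\<^sup>2 + 2 * (norm ?b)\<^sup>2"
        by (simp add: matrix_vector_right_distrib)
    qed (rule i)
    also have "\<dots> = 2 * integral {0..T} (\<lambda>x. (norm (fundamental A x z *v v))\<^sup>2)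
        + 2 * integral {0..T} (\<lambda>x. (norm (fundamental A x z *v w))\<^sup>2)"
    proof -
      have "(\<lambda>x. 2 * (norm (fundamental A x z *v v'))\<^sup>2) integrable_on {0..T}" for v'
        by (rule integrable_on_mult_right[OF i])
      from Henstock_Kurzweil_Integration.integral_add[OF this[of v] this[of w]]
      show ?thesis by simp
    qed
    finally show ?thesis using C[OF T] D[OF T] by simp
  qed
  then show "v + w \<in> {v. finite_energy (\<lambda>x. fundamental A x z *v v)}"
    by (auto simp: finite_energy_def)
qed

lemma hyperbolic_dim:
  fixes M :: "complex ^ 'n ^ 'n"
  assumes "hyperbolic M" shows "CARD('n) \<le> vec.dim (stable_space M) + vec.dim (unstable_space M)"
proof -
  have sub: "vec.subspace (stable_space M)" "vec.subspace (unstable_space M)"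
    by (simp_all add: stable_space_def unstable_space_def gen_eigenspace_subspace)
  have "{x + y | x y. x \<in> stable_space M \<and> y \<in> unstable_space M} = UNIV"
    using hyperbolic_splitting[OF assms] by blast
  then show ?thesis using vec.dim_sums_Int[OF sub] vec_dim_card[where ?'n='n and ?'a=complex] by simp
qed

text \<open>The perturbation \<open>A(x) - M\<close> tends to \<open>0\<close> and costs at most half of the
  constant \<open>c\<close>.\<close>

lemma asymptotic_form:
  fixes A :: "real \<Rightarrow> complex ^ 'n ^ 'n"
  assumes h: "sym_form h" "0 < c" "\<And>v. c * (norm v)\<^sup>2 \<le> h v (M *v v)"
    and lim: "(A \<longlongrightarrow> M) F"
  shows "eventually (\<lambda>x. \<forall>v. c / 2 * (norm v)\<^sup>2 \<le> h v (A x *v v)) F"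
proof -
  interpret h: bounded_bilinear h using h by (simp add: sym_form_def)
  obtain C where C: "0 < C" "\<And>u v. norm (h u v) \<le> norm u * norm v * C"
    using h.pos_bounded by blast
  obtain D where D: "0 < D" "\<And>(B :: complex ^ 'n ^ 'n) v. norm (B *v v) \<le> norm B * norm v * D"
    using mvm.pos_bounded by blast
  have "((\<lambda>x. norm (A x - M) * D * C) \<longlongrightarrow> norm (M - M) * D * C) F"
    by (intro tendsto_intros lim)
  then have "((\<lambda>x. norm (A x - M) * D * C) \<longlongrightarrow> 0) F" by simp
  then have "eventually (\<lambda>x. norm (A x - M) * D * C < c / 2) F"
    by (rule order_tendstoD(2)) (use h(2) in simp)
  then show ?thesis
  proof eventually_elim
    case (elim x)
    show ?case
    proof
      fix v
      have "\<bar>h v ((A x - M) *v v)\<bar> \<le> norm v * norm ((A x - M) *v v) * C" using C(2) by simp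
      also have "\<dots> \<le> norm v * (norm (A x - M) * norm v * D) * C"
        using C(1) by (intro mult_right_mono mult_left_mono D(2)) auto
      also have "\<dots> = (norm (A x - M) * D * C) * (norm v)\<^sup>2" by (simp add: power2_eq_square)
      also have "\<dots> \<le> c / 2 * (norm v)\<^sup>2" using elim by (intro mult_right_mono) auto
      finally have "- (c / 2 * (norm v)\<^sup>2) \<le> h v ((A x - M) *v v)" by (simp only: abs_le_iff) linarith
      moreover have "h v (A x *v v) = h v (M *v v) + h v ((A x - M) *v v)"
        by (simp add: h.add_right[symmetric] mvm.diff_left)
      ultimately show "c / 2 * (norm v)\<^sup>2 \<le> h v (A x *v v)"
        using h(3)[of v] by simp
    qed
  qed
qed

text \<open>Beyond some \<open>X\<close> the function \<open>V = h(u, u)\<close> grows along every solution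
  \<open>u\<close> at least at the rate \<open>c |u|\<^sup>2\<close>, and \<open>V \<le> 0\<close>
  on \<open>E(x)\<close>. For solutions with values in \<open>E\<close> this bounds the energy by
  \<open>- V(X) / c\<close>. For a solution of finite energy \<open>V(X) \<le> 0\<close>, since a
  positive value of \<open>V\<close> would persist and keep \<open>|u|\<^sup>2\<close> away from
  \<open>0\<close>. Hence the space \<open>LX\<close> of values at \<open>X\<close> of finite-energy
  solutions contains \<open>E(X)\<close> and meets the unstable space of \<open>M\<close> in
  \<open>0\<close> only; by dimensions \<open>LX = E(X)\<close>.\<close>

lemma half_line_characterization:
  fixes A :: "real \<Rightarrow> complex \<Rightarrow> complex ^ 'n ^ 'n" and E :: "real \<Rightarrow> (complex ^ 'n) set"
  assumes cont: "continuous_on UNIV (\<lambda>p. A (fst p) (snd p))"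
    and lim: "((\<lambda>x. A x z) \<longlongrightarrow> M) at_top" and hyp: "hyperbolic M"
    and sub: "\<And>x. vec.subspace (E x)"
    and tr: "\<And>u x y. (\<And>x. (u has_vector_derivative (A x z *v u x)) (at x)) \<Longrightarrow> u x \<in> E x \<Longrightarrow> u y \<in> E y"
    and E: "grass_tendsto E (stable_space M) at_top"
  shows "v \<in> E 0 \<longleftrightarrow> finite_energy (\<lambda>x. fundamental A x z *v v)"
proof -
  obtain h c where h: "sym_form h" "0 < c" "\<And>v. c * (norm v)\<^sup>2 \<le> h v (M *v v)"
    using hyperbolic_form_exists[OF hyp] by blast
  interpret h: bounded_bilinear h using h by (simp add: sym_form_def)
  obtain C where C: "0 < C" "\<And>u v. norm (h u v) \<le> norm u * norm v * C"
    using h.pos_bounded by blast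
  have neg: "h v v < 0" if "v \<in> stable_space M" "v \<noteq> 0" for v
    using form_neg_on_stable_space[OF h that] .
  have "eventually (\<lambda>x. vec.dim (E x) = vec.dim (stable_space M) \<and> (\<forall>v\<in>E x. h v v \<le> 0)) at_top"
    by (rule form_negative_near_subspace[OF h(1) _ E]) (rule neg)
  then have "eventually (\<lambda>x. 0 \<le> x \<and> (\<forall>v. c / 2 * (norm v)\<^sup>2 \<le> h v (A x z *v v)) \<and>
      (vec.dim (E x) = vec.dim (stable_space M) \<and> (\<forall>v\<in>E x. h v v \<le> 0))) at_top"
    using eventually_ge_at_top[of 0] asymptotic_form[OF h lim]
    by eventually_elim blast
  then obtain X where X: "\<And>x. X \<le> x \<Longrightarrow> 0 \<le> x \<and> (\<forall>v. c / 2 * (norm v)\<^sup>2 \<le> h v (A x z *v v)) \<and>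
      (vec.dim (E x) = vec.dim (stable_space M) \<and> (\<forall>v\<in>E x. h v v \<le> 0))"
    unfolding eventually_at_top_linorder by blast
  have X0: "0 \<le> X" using X by blast
  define u where "u v x = fundamental A x z *v v" for v x
  have u0: "u v 0 = v" for v by (simp add: u_def)
  have ud: "(u v has_vector_derivative A x z *v u v x) (at x)" for v x
    unfolding u_def[abs_def] by (rule fundamental_vec_deriv[OF cont])
  have uc: "continuous_on UNIV (u v)" for v
    unfolding u_def[abs_def] by (rule fundamental_vec_continuous[OF cont])
  note i = norm_sq_integrable_on[OF uc]
  have uE: "u v x \<in> E x \<longleftrightarrow> v \<in> E 0" for v x
    using tr[OF ud, of v x 0] tr[OF ud, of v 0 x] u0 by auto
  define V where "V v x = h (u v x) (u v x)" for v x
  have V': "(V v has_field_derivative 2 * h (u v x) (A x z *v u v x)) (at x)" for v x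
    unfolding V_def[abs_def] by (rule sym_form_has_derivative[OF h(1) ud])
  \<comment> \<open>The energy inequality, from which both directions follow.\<close>
  have growth: "c * integral {X..T} (\<lambda>x. (norm (u v x))\<^sup>2) \<le> V v T - V v X" if T: "X \<le> T" for v T
  proof -
    have 1: "((\<lambda>x. 2 * h (u v x) (A x z *v u v x)) has_integral V v T - V v X) {X..T}"
      by (rule fundamental_theorem_of_calculus[OF T])
         (use V' in \<open>auto simp: has_real_derivative_iff_has_vector_derivative intro: has_vector_derivative_at_within\<close>)
    have "integral {X..T} (\<lambda>x. c * (norm (u v x))\<^sup>2) \<le> integral {X..T} (\<lambda>x. 2 * h (u v x) (A x z *v u v x))"
    proof (rule integral_le)
      show "(\<lambda>x. c * (norm (u v x))\<^sup>2) integrable_on {X..T}" by (intro integrable_on_mult_right i)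
      show "(\<lambda>x. 2 * h (u v x) (A x z *v u v x)) integrable_on {X..T}" using 1 by blast
      fix x assume "x \<in> {X..T}"
      then have "c / 2 * (norm (u v x))\<^sup>2 \<le> h (u v x) (A x z *v u v x)" using X by auto
      then show "c * (norm (u v x))\<^sup>2 \<le> 2 * h (u v x) (A x z *v u v x)" by simp
    qed
    then show ?thesis unfolding integral_unique[OF 1] by simp
  qed
  have into: "finite_energy (u v)" if v: "v \<in> E 0" for v
  proof (rule finite_energyI_tail[OF uc X0])
    fix T assume T: "X \<le> T"
    have "V v T \<le> 0" using X[OF T] uE[of v T] v by (simp add: V_def)
    then have "c * integral {X..T} (\<lambda>x. (norm (u v x))\<^sup>2) \<le> - V v X" using growth[OF T, of v] by simp
    then show "integral {X..T} (\<lambda>x. (norm (u v x))\<^sup>2) \<le> - V v X / c"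
      using h(2) by (simp add: field_simps)
  qed
  have nonpos: "h (u v X) (u v X) \<le> 0" if fe: "finite_energy (u v)" for v
  proof (rule ccontr)
    assume "\<not> h (u v X) (u v X) \<le> 0"
    then have \<delta>: "0 < V v X" by (simp add: V_def)
    obtain D where D: "\<And>T. 0 \<le> T \<Longrightarrow> integral {0..T} (\<lambda>x. (norm (u v x))\<^sup>2) \<le> D"
      using fe unfolding finite_energy_def by blast
    have lower: "V v X / C \<le> (norm (u v x))\<^sup>2" if x: "X \<le> x" for x
    proof -
      have "0 \<le> integral {X..x} (\<lambda>x. (norm (u v x))\<^sup>2)" by (rule integral_nonneg[OF i]) simp
      then have "0 \<le> c * integral {X..x} (\<lambda>x. (norm (u v x))\<^sup>2)" using h(2) by simp
      then have "V v X \<le> V v x" using growth[OF x, of v] by simp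
      also have "\<dots> \<le> (norm (u v x))\<^sup>2 * C"
        using C(2)[of "u v x" "u v x"] by (simp add: V_def power2_eq_square)
      finally show ?thesis using C(1) by (simp add: field_simps)
    qed
    have DL: "(T - X) * (V v X / C) \<le> D" if T: "X \<le> T" for T
    proof -
      have "integral {X..T} (\<lambda>x. V v X / C) \<le> integral {X..T} (\<lambda>x. (norm (u v x))\<^sup>2)"
        by (rule integral_le[OF _ i]) (use lower in auto)
      also have "\<dots> \<le> integral {0..T} (\<lambda>x. (norm (u v x))\<^sup>2)"
        by (rule integral_subset_le[OF _ i i]) (use X0 in auto)
      also have "\<dots> \<le> D" using D T X0 by simp
      finally show ?thesis using T by simp
    qed
    have q: "0 < V v X / C" using \<delta> C(1) by simp
    define k where "k = (\<bar>D\<bar> + 1) / (V v X / C)"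
    have "0 \<le> k" using q unfolding k_def by (intro divide_nonneg_pos) auto
    then have "k * (V v X / C) \<le> D" using DL[of "X + k"] by simp
    moreover have "k * (V v X / C) = \<bar>D\<bar> + 1"
      using less_imp_neq[OF q] unfolding k_def by (intro nonzero_eq_divide_eq[THEN iffD1]) auto
    ultimately have "\<bar>D\<bar> + 1 \<le> D" by simp
    then show False by simp
  qed
  define L where "L = {v. finite_energy (u v)}"
  have Lsub: "vec.subspace L" unfolding L_def u_def[abs_def] by (rule finite_energy_subspace[OF cont])
  define LX where "LX = (\<lambda>v. u v X) ` L"
  have "LX = (*v) (fundamental A X z) ` L" by (auto simp: LX_def u_def)
  then have LXsub: "vec.subspace LX" using vec.subspace_image[OF Lsub] by metis
  \<comment> \<open>Dimension count: \<open>LX\<close> is transversal to the unstable space.\<close>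
  have disj: "LX \<inter> unstable_space M \<subseteq> {0}"
  proof
    fix w assume w: "w \<in> LX \<inter> unstable_space M"
    then obtain v where "w = u v X" "finite_energy (u v)" by (auto simp: LX_def L_def)
    then have "h w w \<le> 0" using nonpos by blast
    moreover have "0 < h w w" if "w \<noteq> 0"
      using form_pos_on_unstable_space[OF h _ that] w by blast
    ultimately show "w \<in> {0}" by fastforce
  qed
  have EL: "E X \<subseteq> LX"
  proof
    fix e assume e: "e \<in> E X"
    define v where "v = fundamental_inv A X z *v e"
    have "u v X = e" by (simp add: u_def v_def matrix_vector_mul_assoc fundamental_inverse[OF cont])
    then have "finite_energy (u v)" using into uE[of v X] e by simp
    then have "v \<in> L" by (simp add: L_def)
    then show "e \<in> LX" unfolding LX_def using \<open>u v X = e\<close> by (metis imageI)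
  qed
  have usub: "vec.subspace (unstable_space M)"
    by (simp add: unstable_space_def gen_eigenspace_subspace)
  have "vec.dim (LX \<inter> unstable_space M) = 0" using disj by simp
  then have "vec.dim LX + vec.dim (unstable_space M) \<le> CARD('n)"
    using vec.dim_sums_Int[OF LXsub usub]
      dim_subset_UNIV_cart_gen[of "{x + y | x y. x \<in> LX \<and> y \<in> unstable_space M}"] by linarith
  then have "vec.dim LX \<le> vec.dim (E X)"
    using hyperbolic_dim[OF hyp] X[OF order_refl] by linarith
  then have "E X = LX" using vec.subspace_dim_equal[OF sub LXsub EL] by simp
  have out: "v \<in> E 0" if "finite_energy (u v)" for v
  proof -
    have "u v X \<in> LX" using that by (auto simp: LX_def L_def)
    then show ?thesis using \<open>E X = LX\<close> uE[of v X] by simp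
  qed
  have "v \<in> E 0 \<longleftrightarrow> finite_energy (u v)" using into out by blast
  then show ?thesis by (simp only: u_def[abs_def])
qed

lemma grass_tendsto_compose:
  assumes "grass_tendsto E V F" "filterlim g F G"
  shows "grass_tendsto (\<lambda>x. E (g x)) V G"
proof -
  obtain I b b0 where b: "basis_of I b0 V" "\<forall>j\<in>I. ((\<lambda>x. b x j) \<longlongrightarrow> b0 j) F"
    "eventually (\<lambda>x. basis_of I (b x) (E x)) F"
    using assms(1) unfolding grass_tendsto_def by blast
  show ?thesis
    unfolding grass_tendsto_def
    by (rule exI[of _ I], rule exI[of _ "\<lambda>x. b (g x)"], rule exI[of _ b0])
       (use b filterlim_compose[OF _ assms(2)] eventually_compose_filterlim[OF _ assms(2)] in auto)
qed

lemma decay_at_top: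
  fixes A :: "real \<Rightarrow> complex \<Rightarrow> complex ^ 'n ^ 'n"
  assumes cont: "continuous_on UNIV (\<lambda>p. A (fst p) (snd p))"
    and lim: "((\<lambda>x. A x z) \<longlongrightarrow> M) at_top" and hyp: "hyperbolic M"
    and E: "transported_family A z E (stable_space M) at_top"
  shows "v \<in> E 0 \<longleftrightarrow> finite_energy (\<lambda>x. fundamental A x z *v v)"
  by (rule half_line_characterization[OF cont lim hyp]) (use E in \<open>auto simp: transported_family_def\<close>)

text \<open>The case of \<open>- \<infinity>\<close> by the reflection of \<open>x\<close>, which turns the
  unstable space of \<open>M\<close> into the stable space of \<open>- M\<close>.\<close>

lemma decay_at_bot:
  fixes A :: "real \<Rightarrow> complex \<Rightarrow> complex ^ 'n ^ 'n"
  assumes cont: "continuous_on UNIV (\<lambda>p. A (fst p) (snd p))"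
    and lim: "((\<lambda>x. A x z) \<longlongrightarrow> M) at_bot" and hyp: "hyperbolic M"
    and E: "transported_family A z E (unstable_space M) at_bot"
  shows "v \<in> E 0 \<longleftrightarrow> finite_energy (\<lambda>x. fundamental A (- x) z *v v)"
proof -
  define A' where "A' x z = - A (- x) z" for x z
  have cont': "continuous_on UNIV (\<lambda>p. A' (fst p) (snd p))"
    unfolding A'_def by (intro continuous_intros continuous_on_curried[OF cont])
  have refl: "((\<lambda>x. u (- x)) has_vector_derivative - d) (at x)"
    if "(u has_vector_derivative d) (at (- x))" for u :: "real \<Rightarrow> 'b::real_normed_vector" and d x
  proof -
    have "(uminus has_vector_derivative (-1)) (at x)" by (auto intro!: derivative_eq_intros)
    from vector_diff_chain_at[OF this that] show ?thesis by (simp add: o_def)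
  qed
  have "fundamental A (- x) z = fundamental A' x z" for x
  proof -
    have "((\<lambda>x. fundamental A (- x) z) has_vector_derivative A' x z ** fundamental A (- x) z) (at x)" for x
      using refl[OF fundamental_deriv[OF cont, of z "- x"]] by (simp add: A'_def mmm.minus_left)
    from fundamental_solution_unique[OF cont' convex_UNIV open_UNIV UNIV_I[of 0] this UNIV_I[of x]]
    show ?thesis by (simp add: fundamental_inverse[OF cont'])
  qed
  moreover have "v \<in> E (- 0) \<longleftrightarrow> finite_energy (\<lambda>x. fundamental A' x z *v v)"
  proof (rule half_line_characterization[OF cont', where M="- M" and E="\<lambda>x. E (- x)"])
    show "((\<lambda>x. A' x z) \<longlongrightarrow> - M) at_top"
      unfolding A'_def by (intro tendsto_minus filterlim_compose[OF lim] filterlim_uminus_at_bot_at_top)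
    show "hyperbolic (- M)" using hyp by (rule hyperbolic_uminus)
    show "vec.subspace (E (- x))" for x using E by (simp add: transported_family_def)
    show "grass_tendsto (\<lambda>x. E (- x)) (stable_space (- M)) at_top"
      unfolding stable_space_uminus
      by (rule grass_tendsto_compose[OF _ filterlim_uminus_at_bot_at_top])
         (use E in \<open>simp add: transported_family_def\<close>)
    fix u x y assume u: "\<And>x. (u has_vector_derivative (A' x z *v u x)) (at x)" "u x \<in> E (- x)"
    have "((\<lambda>x. u (- x)) has_vector_derivative A x z *v u (- x)) (at x)" for x
      using refl[OF u(1)[of "- x"]] by (simp add: A'_def mvm.minus_left)
    moreover have "(\<lambda>x. u (- x)) (- x) \<in> E (- x)" using u(2) by simp
    ultimately have "(\<lambda>x. u (- x)) (- y) \<in> E (- y)"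
      using E unfolding transported_family_def by blast
    then show "u y \<in> E (- y)" by simp
  qed
  ultimately show ?thesis by simp
qed

section \<open>The Green's function as a spectral projection\<close>

lemma continuous_AE_0_imp_0:
  fixes u :: "real \<Rightarrow> 'b::real_normed_vector"
  assumes u: "continuous_on UNIV u" and ae: "AE x in lborel. u x = 0"
  shows "u x = 0"
proof (rule ccontr)
  assume ne: "u x \<noteq> 0"
  have "open {x. u x \<noteq> 0}"
    using open_Collect_neq[OF u continuous_on_const[of UNIV 0]] by simp
  moreover have "emeasure lborel {x. u x \<noteq> 0} = 0"
    using ae by (subst (asm) AE_iff_measurable[where N="{x. u x \<noteq> 0}"])
      (use \<open>open {x. u x \<noteq> 0}\<close> in auto)
  then have "{x. u x \<noteq> 0} \<in> null_sets lborel"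
    using \<open>open {x. u x \<noteq> 0}\<close> by (intro null_setsI) auto
  then have "negligible {x. u x \<noteq> 0}"
    using negligible_iff_null_sets null_sets_completionI by blast
  ultimately show False using open_not_negligible[of "{x. u x \<noteq> 0}"] ne by auto
qed

text \<open>Each column of Green's function is square integrable and coincides with a solution on either side
  of \<open>y\<close>; finite energy is a matter of the behaviour near infinity.\<close>

lemma green_side_finite_energy:
  fixes A :: "real \<Rightarrow> complex \<Rightarrow> complex ^ 'n ^ 'n" and v :: "complex ^ 'n"
  assumes c: "continuous_on UNIV (\<lambda>p. A (fst p) (snd p))" and K: "K \<in> L2"
  shows "(\<And>x. y < x \<Longrightarrow> K x = fundamental A x z ** C) \<Longrightarrow> finite_energy (\<lambda>x. fundamental A x z *v (C *v v))"
    and "(\<And>x. x < y \<Longrightarrow> K x = fundamental A x z ** C) \<Longrightarrow> finite_energy (\<lambda>x. fundamental A (- x) z *v (C *v v))"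
proof -
  obtain D where D: "0 < D" "\<And>(B :: complex ^ 'n ^ 'n) v. norm (B *v v) \<le> norm B * norm v * D"
    using mvm.pos_bounded by blast
  have KI: "integrable lborel (\<lambda>x. (norm (K x))\<^sup>2)" using K by (simp add: L2_def)
  have le: "(norm (B *v v))\<^sup>2 \<le> (norm B)\<^sup>2 * (norm v * D)\<^sup>2" for B :: "complex ^ 'n ^ 'n"
    using power_mono[OF D(2)[of B v], of 2] by (simp add: power_mult_distrib mult.assoc)
  show "finite_energy (\<lambda>x. fundamental A x z *v (C *v v))" if C: "\<And>x. y < x \<Longrightarrow> K x = fundamental A x z ** C"
  proof (rule finite_energy_of_integrable_bound[where a=y])
    show "continuous_on UNIV (\<lambda>x. fundamental A x z *v (C *v v))" by (rule fundamental_vec_continuous[OF c])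
    show "integrable lborel (\<lambda>x. (norm (K x))\<^sup>2 * (norm v * D)\<^sup>2)" using KI by simp
    show "(norm (fundamental A x z *v (C *v v)))\<^sup>2 \<le> (norm (K x))\<^sup>2 * (norm v * D)\<^sup>2" if "y < x" for x
      using le[of "K x"] C[OF that] by (simp add: matrix_vector_mul_assoc)
  qed simp
  show "finite_energy (\<lambda>x. fundamental A (- x) z *v (C *v v))" if C: "\<And>x. x < y \<Longrightarrow> K x = fundamental A x z ** C"
  proof (rule finite_energy_of_integrable_bound[where a="- y"])
    show "continuous_on UNIV (\<lambda>x. fundamental A (- x) z *v (C *v v))"
      by (rule continuous_on_compose2[OF fundamental_vec_continuous[OF c]]) (auto intro!: continuous_intros)
    show "integrable lborel (\<lambda>x. (norm (K (- x)))\<^sup>2 * (norm v * D)\<^sup>2)"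
      using lborel_integrable_real_affine[OF KI, of "-1" 0] by simp
    show "(norm (fundamental A (- x) z *v (C *v v)))\<^sup>2 \<le> (norm (K (- x)))\<^sup>2 * (norm v * D)\<^sup>2" if "- y < x" for x
      using le[of "K (- x)"] C[of "- x"] that by (simp add: matrix_vector_mul_assoc)
  qed simp
qed

lemma bounded_of_limits:
  fixes A :: "real \<Rightarrow> 'b::real_normed_vector"
  assumes "continuous_on UNIV A" "(A \<longlongrightarrow> l) at_top" "(A \<longlongrightarrow> m) at_bot"
  obtains B where "0 < B" "\<And>x. norm (A x) \<le> B"
proof -
  have "eventually (\<lambda>x. dist (A x) l < 1) at_top" using assms(2) by (rule tendstoD) simp
  then obtain X where X: "\<And>x. X \<le> x \<Longrightarrow> dist (A x) l < 1" unfolding eventually_at_top_linorder by blast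
  have "eventually (\<lambda>x. dist (A x) m < 1) at_bot" using assms(3) by (rule tendstoD) simp
  then obtain Y where Y: "\<And>x. x \<le> Y \<Longrightarrow> dist (A x) m < 1" unfolding eventually_at_bot_linorder by blast
  have "bounded (A ` {Y..X} \<union> ball l 1 \<union> ball m 1)"
    by (intro bounded_Un[THEN iffD2] conjI compact_imp_bounded compact_continuous_image
        continuous_on_subset[OF assms(1)] bounded_ball) auto
  moreover have "range A \<subseteq> A ` {Y..X} \<union> ball l 1 \<union> ball m 1"
  proof
    fix a assume "a \<in> range A"
    then obtain x where "a = A x" by blast
    then show "a \<in> A ` {Y..X} \<union> ball l 1 \<union> ball m 1"
      using X[of x] Y[of x] by (cases "X \<le> x"; cases "x \<le> Y") (auto simp: dist_commute)
  qed
  ultimately have "bounded (range A)" by (rule bounded_subset)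
  then show ?thesis using that unfolding bounded_pos by auto
qed

lemma zero_in_L2: "(\<lambda>x. 0) \<in> L2"
  by (simp add: L2_def)

text \<open>A solution of finite energy on both half lines is in \<open>H\<^sup>1\<close>, since
  \<open>A\<close> is bounded in \<open>x\<close>; so it belongs to the kernel of
  \<open>T(z)\<close>.\<close>

lemma kernel_of_finite_energy:
  fixes A :: "real \<Rightarrow> complex \<Rightarrow> complex ^ 'n ^ 'n"
  assumes c: "continuous_on UNIV (\<lambda>p. A (fst p) (snd p))"
    and lim: "((\<lambda>x. A x z) \<longlongrightarrow> l) at_top" "((\<lambda>x. A x z) \<longlongrightarrow> m) at_bot"
    and inv: "T_invertible A z"
    and fe: "finite_energy (\<lambda>x. fundamental A x z *v v)" "finite_energy (\<lambda>x. fundamental A (- x) z *v v)"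
  shows "v = 0"
proof -
  define u where "u x = fundamental A x z *v v" for x
  define w where "w x = A x z *v u x" for x
  have uc: "continuous_on UNIV u" unfolding u_def by (rule fundamental_vec_continuous[OF c])
  have Ac: "continuous_on UNIV (\<lambda>x. A x z)" by (intro continuous_on_curried[OF c] continuous_intros)
  have wc: "continuous_on UNIV w" unfolding w_def by (intro mvm.continuous_on Ac uc)
  have uL: "u \<in> L2" by (rule L2_of_finite_energy[OF uc]) (use fe in \<open>simp_all add: u_def[abs_def]\<close>)
  obtain B where B: "0 < B" "\<And>x. norm (A x z) \<le> B" using bounded_of_limits[OF Ac lim] by blast
  obtain D where D: "0 < D" "\<And>(B :: complex ^ 'n ^ 'n) v. norm (B *v v) \<le> norm B * norm v * D"
    using mvm.pos_bounded by blast
  have wL: "w \<in> L2"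
  proof -
    have wm: "w \<in> borel_measurable borel" using wc by (rule borel_measurable_continuous_onI)
    have "integrable lborel (\<lambda>x. (norm (w x))\<^sup>2)"
    proof (rule Bochner_Integration.integrable_bound)
      show "integrable lborel (\<lambda>x. (B * D)\<^sup>2 * (norm (u x))\<^sup>2)" using uL by (simp add: L2_def)
      show "(\<lambda>x. (norm (w x))\<^sup>2) \<in> borel_measurable lborel" using wm by measurable
      show "AE x in lborel. norm ((norm (w x))\<^sup>2) \<le> norm ((B * D)\<^sup>2 * (norm (u x))\<^sup>2)"
      proof (rule AE_I2)
        fix x
        have "norm (w x) \<le> norm (A x z) * norm (u x) * D" unfolding w_def by (rule D(2))
        also have "\<dots> \<le> B * norm (u x) * D" using B D(1) by (intro mult_right_mono) auto
        finally have "(norm (w x))\<^sup>2 \<le> (B * norm (u x) * D)\<^sup>2" by (intro power_mono) auto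
        then show "norm ((norm (w x))\<^sup>2) \<le> norm ((B * D)\<^sup>2 * (norm (u x))\<^sup>2)"
          by (simp add: power_mult_distrib mult_ac)
      qed
    qed
    then show ?thesis using wm by (simp add: L2_def)
  qed
  have "weak_deriv u w"
  proof (rule weak_deriv_of_C1[OF _ wc])
    show "(u has_vector_derivative w x) (at x)" for x
      unfolding u_def[abs_def] w_def by (rule fundamental_vec_deriv[OF c])
  qed
  then have g1: "T_graph A z u (\<lambda>x. 0)"
    using uL wL zero_in_L2 unfolding T_graph_def by (auto simp: w_def intro!: bexI[of _ w])
  have g2: "T_graph A z (\<lambda>x. 0) (\<lambda>x. 0)"
    using zero_in_L2 unfolding T_graph_def weak_deriv_def by (auto intro!: bexI[of _ "\<lambda>x. 0"])
  have "AE x in lborel. u x = 0"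
  proof -
    have "\<forall>u1 u2. T_graph A z u1 (\<lambda>x. 0) \<and> T_graph A z u2 (\<lambda>x. 0) \<longrightarrow> (AE x in lborel. u1 x = u2 x)"
      using inv zero_in_L2 unfolding T_invertible_def by blast
    from this[rule_format, OF conjI[OF g1 g2]] show ?thesis .
  qed
  then have "u 0 = 0" using continuous_AE_0_imp_0[OF uc] by blast
  then show ?thesis by (simp add: u_def)
qed

text \<open>\<open>P\<close> is the projection onto \<open>S\<close> along \<open>U\<close>. The definition
  entails that the two spaces span everything and meet only in \<open>0\<close>.\<close>

definition projects :: "complex ^ 'n ^ 'n \<Rightarrow> (complex ^ 'n) set \<Rightarrow> (complex ^ 'n) set \<Rightarrow> bool" where
  "projects P S U \<longleftrightarrow> (\<forall>v. P *v v \<in> S \<and> v - P *v v \<in> U) \<and> (\<forall>v\<in>S. P *v v = v) \<and> (\<forall>v\<in>U. P *v v = 0)"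

lemma projects_unique:
  assumes "projects P S U" "projects P' S U" shows "P = P'"
proof -
  have "P *v v = P' *v v" for v
  proof -
    have "P' *v v = P' *v (P *v v) + P' *v (v - P *v v)"
      by (simp add: matrix_vector_right_distrib[symmetric])
    also have "\<dots> = P *v v" using assms unfolding projects_def by simp
    finally show ?thesis by simp
  qed
  then show ?thesis by (simp add: matrix_eq)
qed

lemma projects_idem: "projects P S U \<Longrightarrow> P ** P = P"
  unfolding projects_def by (simp add: matrix_eq matrix_vector_mul_assoc[symmetric])

lemma projects_range: "projects P S U \<Longrightarrow> {v. P *v v = v} = S"
  unfolding projects_def by (metis (mono_tags, lifting) Collect_cong Collect_mem_eq)

lemma projects_kernel: "projects P S U \<Longrightarrow> {v. P *v v = 0} = U"
proof -
  assume p: "projects P S U"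
  have "v \<in> U" if "P *v v = 0" for v
  proof -
    have "v - P *v v \<in> U" using p unfolding projects_def by blast
    then show ?thesis using that by simp
  qed
  then show ?thesis using p unfolding projects_def by blast
qed

lemma projectsI:
  assumes S: "vec.subspace S" "vec.subspace U" "S \<inter> U \<subseteq> {0}"
    and P: "\<And>v. P *v v \<in> S" "\<And>v. v - P *v v \<in> U"
  shows "projects P S U"
  unfolding projects_def
proof (intro conjI allI ballI P)
  fix v assume "v \<in> S"
  then have "v - P *v v \<in> S \<inter> U" using P S(1) by (auto intro: vec.subspace_diff)
  then show "P *v v = v" using S(3) by auto
next
  fix v assume v: "v \<in> U"
  have "v - (v - P *v v) \<in> U" by (rule vec.subspace_diff[OF S(2) v P(2)])
  then have "P *v v \<in> S \<inter> U" using P by simp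
  then show "P *v v = 0" using S(3) by auto
qed

text \<open>The formula for Green's function in terms of a projection. On the diagonal \<open>G\<close> is
  understood through its one-sided limits.\<close>

definition green_given_by ::
  "(real \<Rightarrow> complex \<Rightarrow> complex ^ 'n ^ 'n) \<Rightarrow> complex \<Rightarrow> (real \<Rightarrow> real \<Rightarrow> complex ^ 'n ^ 'n) \<Rightarrow> complex ^ 'n ^ 'n \<Rightarrow> bool" where
  "green_given_by A z G P \<longleftrightarrow> (\<forall>x y.
     (y < x \<longrightarrow> G x y = fundamental A x z ** P ** fundamental_inv A y z) \<and>
     (x < y \<longrightarrow> G x y = fundamental A x z ** (P - mat 1) ** fundamental_inv A y z))"

text \<open>Write \<open>G(\<cdot>, y) = \<Phi> Cp\<close> on the right and \<open>\<Phi> Cm\<close> on the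
  left of \<open>y\<close>. Square integrability puts the range of \<open>Cp\<close> into \<open>Es
  0\<close> and that of \<open>Cm\<close> into \<open>Eu 0\<close>, and the jump condition reads
  \<open>Cp \<Phi>(y) - Cm \<Phi>(y) = 1\<close>. So \<open>P = Cp \<Phi>(y)\<close> is the
  projection onto \<open>Es 0\<close> along \<open>Eu 0\<close>; being determined by these spaces,
  it is the same for all \<open>y\<close>.\<close>

lemma green_formula:
  fixes A :: "real \<Rightarrow> complex \<Rightarrow> complex ^ 'n ^ 'n"
  assumes c: "continuous_on UNIV (\<lambda>p. A (fst p) (snd p))"
    and lim: "((\<lambda>x. A x z) \<longlongrightarrow> Mp) at_top" "((\<lambda>x. A x z) \<longlongrightarrow> Mm) at_bot"
    and hyp: "hyperbolic Mp" "hyperbolic Mm"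
    and Es: "transported_family A z Es (stable_space Mp) at_top"
    and Eu: "transported_family A z Eu (unstable_space Mm) at_bot"
    and inv: "T_invertible A z"
    and G: "\<And>y. is_green A z y (\<lambda>x. G x y)"
  shows "\<exists>P. projects P (Es 0) (Eu 0) \<and> green_given_by A z G P"
proof -
  note top = decay_at_top[OF c lim(1) hyp(1) Es] and bot = decay_at_bot[OF c lim(2) hyp(2) Eu]
  have sub: "vec.subspace (Es 0)" "vec.subspace (Eu 0)"
    using Es Eu by (auto simp: transported_family_def)
  have disj: "Es 0 \<inter> Eu 0 \<subseteq> {0}"
    using kernel_of_finite_energy[OF c lim inv] top bot by blast
  have ex: "\<exists>P. projects P (Es 0) (Eu 0) \<and>
     (\<forall>x. y < x \<longrightarrow> G x y = fundamental A x z ** P ** fundamental_inv A y z) \<and>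
     (\<forall>x. x < y \<longrightarrow> G x y = fundamental A x z ** (P - mat 1) ** fundamental_inv A y z)" for y
  proof -
    obtain Cp Cm where C: "\<And>x. y < x \<Longrightarrow> G x y = fundamental A x z ** Cp"
      "\<And>x. x < y \<Longrightarrow> G x y = fundamental A x z ** Cm"
      "fundamental A y z ** (Cp - Cm) = mat 1"
      using green_structure[OF c G[of y]] by blast
    have GL: "(\<lambda>x. G x y) \<in> L2" using G[of y] by (simp add: is_green_def)
    define P where "P = Cp ** fundamental A y z"
    have "(Cp - Cm) ** fundamental A y z = mat 1" using C(3) by (simp add: matrix_left_right_inverse)
    then have Q: "P - mat 1 = Cm ** fundamental A y z" by (simp add: P_def mmm.diff_left algebra_simps)
    have Pv: "P *v v \<in> Es 0" for v
      using green_side_finite_energy(1)[OF c GL C(1), where v="fundamental A y z *v v"]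
      by (simp add: top P_def matrix_vector_mul_assoc[symmetric])
    have Qv: "v - P *v v \<in> Eu 0" for v
    proof -
      have "(P - mat 1) *v v \<in> Eu 0"
        using green_side_finite_energy(2)[OF c GL C(2), where v="fundamental A y z *v v"]
        by (simp add: bot Q matrix_vector_mul_assoc[symmetric])
      then have "- ((P - mat 1) *v v) \<in> Eu 0" using sub(2) vec.subspace_neg by blast
      then show ?thesis by (simp add: mvm.diff_left)
    qed
    have 1: "Cp = P ** fundamental_inv A y z"
      by (simp add: P_def matrix_mul_assoc[symmetric] fundamental_inverse[OF c])
    have 2: "Cm = (P - mat 1) ** fundamental_inv A y z"
      by (simp add: Q matrix_mul_assoc[symmetric] fundamental_inverse[OF c])
    have "projects P (Es 0) (Eu 0)" by (rule projectsI[OF sub disj Pv Qv])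
    then show ?thesis using C(1,2) 1 2 by (intro exI[of _ P]) (auto simp: matrix_mul_assoc)
  qed
  then obtain P where P: "projects P (Es 0) (Eu 0)" by blast
  have "(y < x \<longrightarrow> G x y = fundamental A x z ** P ** fundamental_inv A y z) \<and>
     (x < y \<longrightarrow> G x y = fundamental A x z ** (P - mat 1) ** fundamental_inv A y z)" for x y
    using ex[of y] projects_unique[OF P] by blast
  with P show ?thesis unfolding green_given_by_def by blast
qed

text \<open>On the diagonal the limit from the right continues the formula for \<open>y < x\<close> (\<open>s
  = 0\<close>), the limit from the left that for \<open>x < y\<close> (\<open>s = 1\<close>). What
  matters is that \<open>s\<close> does not depend on \<open>z\<close>.\<close>

lemma green_value_formula:
  fixes A :: "real \<Rightarrow> complex \<Rightarrow> complex ^ 'n ^ 'n"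
  assumes c: "continuous_on UNIV (\<lambda>p. A (fst p) (snd p))" and g: "g \<in> green_values G x y"
  obtains s :: real where "\<And>z P. green_given_by A z (\<lambda>x y. G x y z) P \<Longrightarrow>
    g z = fundamental A x z ** (P - s *\<^sub>R mat 1) ** fundamental_inv A y z"
proof (cases "x = y")
  case False
  then have gG: "g = G x y" using g by (simp add: green_values_def)
  show ?thesis
  proof (cases "y < x")
    case True
    then show ?thesis using gG by (intro that[of 0]) (simp add: green_given_by_def)
  next
    case F: False
    then show ?thesis using gG False by (intro that[of 1]) (simp add: green_given_by_def)
  qed
next
  case True
  have \<Phi>: "isCont (\<lambda>\<xi>. fundamental A \<xi> z) y" for z
    by (rule has_vector_derivative_continuous[OF fundamental_deriv[OF c]])
  have lim: "((\<lambda>\<xi>. fundamental A \<xi> z ** R ** S) \<longlongrightarrow> fundamental A y z ** R ** S) (at y within X)" for z R S X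
    by (intro mmm.tendsto tendsto_const tendsto_within_subset[OF isContD[OF \<Phi>]]) auto
  consider "g = (\<lambda>z. Lim (at_right y) (\<lambda>\<xi>. G \<xi> y z))" | "g = (\<lambda>z. Lim (at_left y) (\<lambda>\<xi>. G \<xi> y z))"
    using g True by (auto simp: green_values_def)
  then show ?thesis
  proof cases
    case 1
    show ?thesis
    proof (rule that[of 0])
      fix z P assume "green_given_by A z (\<lambda>x y. G x y z) P"
      then have a: "\<And>x y. y < x \<Longrightarrow> G x y z = fundamental A x z ** P ** fundamental_inv A y z"
        by (simp add: green_given_by_def)
      have "((\<lambda>\<xi>. G \<xi> y z) \<longlongrightarrow> fundamental A y z ** P ** fundamental_inv A y z) (at_right y)"
        by (rule Lim_transform_eventually[OF lim])
           (use eventually_at_right_less[of y] in \<open>eventually_elim, simp add: a\<close>)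
      then have "Lim (at_right y) (\<lambda>\<xi>. G \<xi> y z) = fundamental A y z ** P ** fundamental_inv A y z"
        by (intro tendsto_Lim) auto
      then show "g z = fundamental A x z ** (P - 0 *\<^sub>R mat 1) ** fundamental_inv A y z"
        using 1 True by simp
    qed
  next
    case 2
    show ?thesis
    proof (rule that[of 1])
      fix z P assume "green_given_by A z (\<lambda>x y. G x y z) P"
      then have a: "\<And>x y. x < y \<Longrightarrow> G x y z = fundamental A x z ** (P - mat 1) ** fundamental_inv A y z"
        by (simp add: green_given_by_def)
      have "eventually (\<lambda>\<xi>. \<xi> < y) (at_left y)" by (simp add: eventually_at_filter)
      then have "eventually (\<lambda>\<xi>. fundamental A \<xi> z ** (P - mat 1) ** fundamental_inv A y z = G \<xi> y z) (at_left y)"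
        by eventually_elim (simp add: a)
      then have "((\<lambda>\<xi>. G \<xi> y z) \<longlongrightarrow> fundamental A y z ** (P - mat 1) ** fundamental_inv A y z) (at_left y)"
        by (rule Lim_transform_eventually[OF lim])
      then have "Lim (at_left y) (\<lambda>\<xi>. G \<xi> y z) = fundamental A y z ** (P - mat 1) ** fundamental_inv A y z"
        by (intro tendsto_Lim) auto
      then show "g z = fundamental A x z ** (P - 1 *\<^sub>R mat 1) ** fundamental_inv A y z"
        using 2 True by simp
    qed
  qed
qed

section \<open>Holomorphic families of idempotents\<close>

lemma holomorphic_eq_on_connected:
  assumes "f holomorphic_on D" "g holomorphic_on D" "open D" "connected D"
    and "open U" "U \<subseteq> D" "U \<noteq> {}" "\<And>z. z \<in> U \<Longrightarrow> f z = g z" and z: "z \<in> D"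
  shows "f z = (g z :: complex)"
proof -
  obtain a where a: "a \<in> U" using assms by blast
  have "a islimpt U" using a assms(5) by (simp add: interior_limit_point interior_open)
  moreover have "(\<lambda>z. f z - g z) holomorphic_on D" using assms by (intro holomorphic_intros)
  ultimately have "f z - g z = 0"
    using analytic_continuation[of "\<lambda>z. f z - g z" D U a z] assms a by auto
  then show ?thesis by simp
qed

lemma mat_eq_on_connected:
  fixes f g :: "complex \<Rightarrow> complex ^ 'n ^ 'm"
  assumes "mat_holomorphic_on f D" "mat_holomorphic_on g D" "open D" "connected D"
    and "open U" "U \<subseteq> D" "U \<noteq> {}" "\<And>z. z \<in> U \<Longrightarrow> f z = g z" and z: "z \<in> D"
  shows "f z = g z"
proof -
  have "f z $ i $ j = g z $ i $ j" for i j
    using assms by (intro holomorphic_eq_on_connected[of "\<lambda>z. f z $ i $ j" D "\<lambda>z. g z $ i $ j" U z])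
      (auto simp: mat_holomorphic_on_def)
  then show ?thesis by (simp add: vec_eq_iff)
qed

lemma vec_eq_on_connected:
  fixes f g :: "complex \<Rightarrow> complex ^ 'n"
  assumes "vec_holomorphic_on f D" "vec_holomorphic_on g D" "open D" "connected D"
    and "open U" "U \<subseteq> D" "U \<noteq> {}" "\<And>z. z \<in> U \<Longrightarrow> f z = g z" and z: "z \<in> D"
  shows "f z = g z"
proof -
  have "f z $ i = g z $ i" for i
    using assms by (intro holomorphic_eq_on_connected[of "\<lambda>z. f z $ i" D "\<lambda>z. g z $ i" U z])
      (auto simp: vec_holomorphic_on_def)
  then show ?thesis by (simp add: vec_eq_iff)
qed

lemma mat_holomorphic_on_subset: "mat_holomorphic_on f D \<Longrightarrow> D' \<subseteq> D \<Longrightarrow> mat_holomorphic_on f D'"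
  unfolding mat_holomorphic_on_def using holomorphic_on_subset by blast

lemma vec_holomorphic_on_subset: "vec_holomorphic_on f D \<Longrightarrow> D' \<subseteq> D \<Longrightarrow> vec_holomorphic_on f D'"
  unfolding vec_holomorphic_on_def using holomorphic_on_subset by blast

lemma mat_holomorphic_on_diff:
  "mat_holomorphic_on f D \<Longrightarrow> mat_holomorphic_on g D \<Longrightarrow> mat_holomorphic_on (\<lambda>z. f z - g z) D"
  by (auto simp: mat_holomorphic_on_def intro!: holomorphic_intros)

lemma mat_holomorphic_on_add:
  "mat_holomorphic_on f D \<Longrightarrow> mat_holomorphic_on g D \<Longrightarrow> mat_holomorphic_on (\<lambda>z. f z + g z) D"
  by (auto simp: mat_holomorphic_on_def intro!: holomorphic_intros)

lemma mat_holomorphic_on_const: "mat_holomorphic_on (\<lambda>z. M) D"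
  by (auto simp: mat_holomorphic_on_def)

lemma vec_holomorphic_on_mult:
  "mat_holomorphic_on f D \<Longrightarrow> vec_holomorphic_on v D \<Longrightarrow> vec_holomorphic_on (\<lambda>z. f z *v v z) D"
  by (auto simp: mat_holomorphic_on_def vec_holomorphic_on_def matrix_vector_mult_def intro!: holomorphic_intros)

lemma vec_holomorphic_on_diff:
  "vec_holomorphic_on f D \<Longrightarrow> vec_holomorphic_on g D \<Longrightarrow> vec_holomorphic_on (\<lambda>z. f z - g z) D"
  by (auto simp: vec_holomorphic_on_def intro!: holomorphic_intros)

lemma vec_holomorphic_on_const: "vec_holomorphic_on (\<lambda>z. v) D"
  by (auto simp: vec_holomorphic_on_def)

definition columns_matrix :: "('n \<Rightarrow> complex ^ 'n) \<Rightarrow> complex ^ 'n ^ 'n" where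
  "columns_matrix b = (\<chi> i j. b j $ i)"

lemma columns_matrix_mult: "columns_matrix b *v k = (\<Sum>j\<in>UNIV. k $ j *s b j)"
  by (simp add: vec_eq_iff columns_matrix_def matrix_vector_mult_def mult.commute)

lemma columns_matrix_det_iff: "det (columns_matrix b) \<noteq> 0 \<longleftrightarrow> (\<forall>k::complex ^ 'n. (\<Sum>j\<in>UNIV. k $ j *s b j) = 0 \<longrightarrow> k = 0)"
  by (simp add: invertible_det_nz[symmetric] invertible_left_inverse matrix_left_invertible_ker columns_matrix_mult)

text \<open>Independence of an indexed family, in terms of coefficients, gives independence of the set of its
  members and of the members belonging to a part of the index set.\<close>

lemma independent_family:
  fixes b :: "'n \<Rightarrow> complex ^ 'n"
  assumes b: "\<And>k::complex ^ 'n. (\<Sum>j\<in>UNIV. k $ j *s b j) = 0 \<Longrightarrow> k = 0"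
  shows "inj_on b I \<and> \<not> vec.dependent (b ` I)"
proof
  show inj: "inj_on b I"
  proof (rule inj_onI, rule ccontr)
    fix i j assume ij: "b i = b j" "i \<noteq> j"
    define k :: "complex ^ 'n" where "k = (\<chi> l. if l = i then 1 else if l = j then -1 else 0)"
    have "(\<Sum>l\<in>UNIV. k $ l *s b l) = (\<Sum>l\<in>{i, j}. k $ l *s b l)"
      by (rule sum.mono_neutral_right) (auto simp: k_def)
    also have "\<dots> = 0" using ij by (simp add: k_def)
    finally have "k = 0" by (rule b)
    then have "k $ i = 0" by simp
    then show False by (simp add: k_def)
  qed
  show "\<not> vec.dependent (b ` I)"
  proof
    assume "vec.dependent (b ` I)"
    then obtain u v where u: "v \<in> b ` I" "u v \<noteq> 0" "(\<Sum>v\<in>b ` I. u v *s v) = 0"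
      using vec.dependent_finite[of "b ` I"] by auto
    define k :: "complex ^ 'n" where "k = (\<chi> l. if l \<in> I then u (b l) else 0)"
    have "(\<Sum>l\<in>UNIV. k $ l *s b l) = (\<Sum>l\<in>I. k $ l *s b l)"
      by (rule sum.mono_neutral_right) (auto simp: k_def)
    also have "\<dots> = 0" using u(3) by (simp add: sum.reindex[OF inj] k_def)
    finally have "k = 0" by (rule b)
    moreover obtain i where "i \<in> I" "v = b i" using u(1) by blast
    moreover have "k $ i = 0" using \<open>k = 0\<close> by simp
    moreover have "k $ i = u (b i)" using \<open>i \<in> I\<close> by (simp add: k_def)
    ultimately show False using u(2) by simp
  qed
qed

lemma sum_split:
  fixes f :: "'b::finite \<Rightarrow> 'a::comm_monoid_add"
  shows "(\<Sum>j\<in>UNIV. f j) = (\<Sum>j\<in>I. f j) + (\<Sum>j\<in>- I. f j)"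
  using sum.union_disjoint[of I "- I" f] by (simp add: Compl_partition)

text \<open>Applying \<open>P\<close> to the expansion of a fixed vector of \<open>P\<close> kills the part
  outside \<open>I\<close>.\<close>

lemma fixed_space_basis:
  fixes P :: "complex ^ 'n ^ 'n"
  assumes b: "\<And>k::complex ^ 'n. (\<Sum>j\<in>UNIV. k $ j *s b j) = 0 \<Longrightarrow> k = 0"
    and I: "\<And>j. j \<in> I \<Longrightarrow> P *v b j = b j" and J: "\<And>j. j \<notin> I \<Longrightarrow> P *v b j = 0"
  shows "basis_of I b {v. P *v v = v}"
proof -
  have "vec.span (b ` I) = {v. P *v v = v}"
  proof (rule subset_antisym)
    show "vec.span (b ` I) \<subseteq> {v. P *v v = v}"
    proof (rule vec.span_minimal)
      show "vec.subspace {v. P *v v = v}"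
        by (auto simp: vec.subspace_def matrix_vector_right_distrib vec.scale)
    qed (use I in auto)
    show "{v. P *v v = v} \<subseteq> vec.span (b ` I)"
    proof
      fix v assume v: "v \<in> {v. P *v v = v}"
      have "det (columns_matrix b) \<noteq> 0" using b by (simp add: columns_matrix_det_iff)
      then have "surj ((*v) (columns_matrix b))"
        by (simp add: invertible_det_nz[symmetric] invertible_right_inverse matrix_right_invertible_surjective)
      then obtain k where "v = columns_matrix b *v k" by (metis surjD)
      then have k: "v = (\<Sum>j\<in>I. k $ j *s b j) + (\<Sum>j\<in>- I. k $ j *s b j)"
        by (simp add: columns_matrix_mult sum_split[of _ I])
      have "v = P *v v" using v by simp
      also have "\<dots> = (\<Sum>j\<in>I. k $ j *s (P *v b j)) + (\<Sum>j\<in>- I. k $ j *s (P *v b j))"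
        by (subst k) (simp add: matrix_vector_right_distrib vec.sum vec.scale)
      also have "\<dots> = (\<Sum>j\<in>I. k $ j *s b j)" using I J by simp
      finally show "v \<in> vec.span (b ` I)"
        by (simp add: vec.span_sum vec.span_scale vec.span_base)
    qed
  qed
  then show ?thesis using independent_family[OF b] by (simp add: basis_of_def)
qed

text \<open>A basis of the range together with a basis of the kernel, indexed by all of \<open>'n\<close>; the
  dimensions add up to \<open>N\<close>.\<close>

lemma idempotent_adapted_basis:
  fixes P :: "complex ^ 'n ^ 'n"
  assumes P: "P ** P = P"
  obtains I and b :: "'n \<Rightarrow> complex ^ 'n" where
    "\<And>k::complex ^ 'n. (\<Sum>j\<in>UNIV. k $ j *s b j) = 0 \<Longrightarrow> k = 0"
    "\<And>j. j \<in> I \<Longrightarrow> P *v b j = b j" "\<And>j. j \<notin> I \<Longrightarrow> P *v b j = 0"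
proof -
  define R where "R = {v. P *v v = v}" define N where "N = {v. P *v v = 0}"
  have sub: "vec.subspace R" "vec.subspace N"
    by (auto simp: R_def N_def vec.subspace_def matrix_vector_right_distrib vec.scale)
  have PP: "P *v (P *v v) = P *v v" for v using P by (simp add: matrix_vector_mul_assoc)
  have "v \<in> {x + y | x y. x \<in> R \<and> y \<in> N}" for v
    by (intro CollectI exI[of _ "P *v v"] exI[of _ "v - P *v v"])
       (auto simp: R_def N_def PP mvm.diff_right)
  then have "{x + y | x y. x \<in> R \<and> y \<in> N} = UNIV" by blast
  moreover have "R \<inter> N = {0}" by (auto simp: R_def N_def)
  ultimately have dims: "vec.dim R + vec.dim N = CARD('n)"
    using vec.dim_sums_Int[OF sub] vec_dim_card[where ?'n='n and ?'a=complex] by simp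
  obtain BR where BR: "BR \<subseteq> R" "vec.independent BR" "R \<subseteq> vec.span BR" "card BR = vec.dim R"
    using vec.basis_exists by metis
  obtain BN where BN: "BN \<subseteq> N" "vec.independent BN" "N \<subseteq> vec.span BN" "card BN = vec.dim N"
    using vec.basis_exists by metis
  have spans: "vec.span BR = R" "vec.span BN = N"
    using BR BN sub by (metis vec.span_minimal subset_antisym)+
  have fin: "finite BR" "finite BN" using BR BN vec.independent_bound_general by blast+
  obtain I :: "'n set" where I: "card I = card BR"
    using obtain_subset_with_card_n[of "card BR" "UNIV :: 'n set"] dims BR(4) by auto
  have "card (- I) = card BN"
    using I dims BR(4) BN(4) by (simp add: Compl_eq_Diff_UNIV card_Diff_subset)
  then obtain f g where f: "bij_betw f I BR" and g: "bij_betw g (- I) BN"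
    using I fin by (metis finite finite_same_card_bij)
  define b where "b j = (if j \<in> I then f j else g j)" for j
  have bI: "basis_of I b R"
  proof -
    have "b ` I = BR" "inj_on b I" using f by (auto simp: b_def bij_betw_def inj_on_def)
    then show ?thesis using BR(2) spans by (simp add: basis_of_def)
  qed
  have bN: "basis_of (- I) b N"
  proof -
    have "b ` (- I) = BN" "inj_on b (- I)" using g by (auto simp: b_def bij_betw_def inj_on_def)
    then show ?thesis using BN(2) spans by (simp add: basis_of_def)
  qed
  show ?thesis
  proof (rule that[of b I])
    fix k :: "complex ^ 'n" assume k: "(\<Sum>j\<in>UNIV. k $ j *s b j) = 0"
    let ?r = "\<Sum>j\<in>I. k $ j *s b j" and ?n = "\<Sum>j\<in>- I. k $ j *s b j"
    have "?r \<in> R" "?n \<in> N" using basis_of_combination_in[OF bI] basis_of_combination_in[OF bN] by blast+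
    moreover have rn: "?r + ?n = 0" using k by (simp add: sum_split[of _ I])
    ultimately have "P *v ?r = ?r" "P *v ?n = 0" by (simp_all add: R_def N_def)
    then have "P *v (?r + ?n) = ?r" by (simp add: matrix_vector_right_distrib)
    then have "P *v 0 = ?r" using rn by simp
    then have r: "?r = 0" by simp
    then have n: "?n = 0" using rn by simp
    have "k $ j = 0" for j
      using basis_of_combination_0[OF bI r] basis_of_combination_0[OF bN n] by (cases "j \<in> I") auto
    then show "k = 0" by (simp add: vec_eq_iff)
  next
    show "P *v b j = b j" if "j \<in> I" for j
      using bI that vec.span_base[of "b j" "b ` I"] by (auto simp: basis_of_def R_def)
    show "P *v b j = 0" if "j \<notin> I" for j
      using bN that vec.span_base[of "b j" "b ` (- I)"] by (auto simp: basis_of_def N_def)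
  qed
qed

lemma det_holomorphic:
  assumes "\<And>j. vec_holomorphic_on (\<lambda>z. b z j) D"
  shows "(\<lambda>z. det (columns_matrix (b z))) holomorphic_on D"
  using assms unfolding det_def columns_matrix_def vec_holomorphic_on_def
  by (auto intro!: holomorphic_intros)

text \<open>Apply \<open>P(z)\<close> and \<open>1 - P(z)\<close> to the two halves of a basis adapted to
  \<open>P(z0)\<close>. The resulting vectors are holomorphic in \<open>z\<close> and form a basis
  as long as their determinant does not vanish, that is, near \<open>z0\<close>; the first half then
  spans the range of \<open>P(z)\<close>.\<close>

lemma idempotent_grass_analytic:
  fixes P :: "complex \<Rightarrow> complex ^ 'n ^ 'n"
  assumes D: "open D" and P: "mat_holomorphic_on P D" "\<And>z. z \<in> D \<Longrightarrow> P z ** P z = P z"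
  shows "grass_analytic_on (\<lambda>z. {v. P z *v v = v}) D"
  unfolding grass_analytic_on_def
proof
  fix z0 assume z0: "z0 \<in> D"
  obtain I b0 where b0: "\<And>k::complex ^ 'n. (\<Sum>j\<in>UNIV. k $ j *s b0 j) = 0 \<Longrightarrow> k = 0"
    "\<And>j. j \<in> I \<Longrightarrow> P z0 *v b0 j = b0 j" "\<And>j. j \<notin> I \<Longrightarrow> P z0 *v b0 j = 0"
    using idempotent_adapted_basis[OF P(2)[OF z0]] by metis
  define b where "b z j = (if j \<in> I then P z *v b0 j else b0 j - P z *v b0 j)" for z j
  have bh: "vec_holomorphic_on (\<lambda>z. b z j) D" for j
    unfolding b_def
    by (cases "j \<in> I") (simp_all add: vec_holomorphic_on_diff vec_holomorphic_on_mult P(1) vec_holomorphic_on_const)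
  have "b z0 = b0" using b0(2,3) by (auto simp: b_def fun_eq_iff)
  then have d0: "det (columns_matrix (b z0)) \<noteq> 0" using b0(1) by (simp add: columns_matrix_det_iff)
  define U where "U = D \<inter> (\<lambda>z. det (columns_matrix (b z))) -` (- {0})"
  have "open U"
    unfolding U_def
    by (rule continuous_open_preimage[OF holomorphic_on_imp_continuous_on[OF det_holomorphic[OF bh]] D]) auto
  moreover have "z0 \<in> U" using z0 d0 by (simp add: U_def)
  moreover have "basis_of I (b z) {v. P z *v v = v}" if z: "z \<in> U" for z
  proof (rule fixed_space_basis)
    have zD: "z \<in> D" using z by (simp add: U_def)
    have PP: "P z *v (P z *v v) = P z *v v" for v using P(2)[OF zD] by (simp add: matrix_vector_mul_assoc)
    show "P z *v b z j = b z j" if "j \<in> I" for j using that PP by (simp add: b_def)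
    show "P z *v b z j = 0" if "j \<notin> I" for j using that PP by (simp add: b_def mvm.diff_right)
    show "k = 0" if "(\<Sum>j\<in>UNIV. k $ j *s b z j) = 0" for k :: "complex ^ 'n"
      using z that columns_matrix_det_iff[of "b z"] by (simp add: U_def)
  qed
  moreover have "U \<subseteq> D" by (simp add: U_def)
  moreover have "vec_holomorphic_on (\<lambda>z. b z j) U" for j
    using vec_holomorphic_on_subset[OF bh \<open>U \<subseteq> D\<close>] .
  ultimately show "\<exists>U I b. open U \<and> z0 \<in> U \<and> U \<subseteq> D \<and>
        (\<forall>j\<in>I. vec_holomorphic_on (\<lambda>z. b z j) U) \<and> (\<forall>z\<in>U. basis_of I (b z) {v. P z *v v = v})"
    by (intro exI[of _ U] exI[of _ I] exI[of _ b]) blast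
qed

lemma grass_analytic_frame_ball:
  fixes E :: "complex \<Rightarrow> (complex ^ 'n) set"
  assumes "grass_analytic_on E D" "a \<in> D"
  obtains e I b where "0 < e" "ball a e \<subseteq> D" "\<And>j. j \<in> I \<Longrightarrow> vec_holomorphic_on (\<lambda>z. b z j) (ball a e)"
    "\<And>z. z \<in> ball a e \<Longrightarrow> basis_of I (b z) (E z)"
proof -
  have "\<exists>U (I::'n set) b. open U \<and> a \<in> U \<and> U \<subseteq> D \<and>
        (\<forall>j\<in>I. vec_holomorphic_on (\<lambda>z. b z j) U) \<and> (\<forall>z\<in>U. basis_of I (b z) (E z))"
    using assms unfolding grass_analytic_on_def by (rule bspec)
  then obtain U and I :: "'n set" and b where U: "open U" "a \<in> U" "U \<subseteq> D"
    "\<forall>j\<in>I. vec_holomorphic_on (\<lambda>z. b z j) U" "\<forall>z\<in>U. basis_of I (b z) (E z)"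
    by (elim exE conjE) (rule that)
  obtain e where "0 < e" "ball a e \<subseteq> U" using U(1,2) open_contains_ball by blast
  show ?thesis
  proof (rule that[of e I b])
    show "0 < e" "ball a e \<subseteq> D" using \<open>0 < e\<close> \<open>ball a e \<subseteq> U\<close> U(3) by auto
    show "vec_holomorphic_on (\<lambda>z. b z j) (ball a e)" if "j \<in> I" for j
      using U(4) that vec_holomorphic_on_subset[OF _ \<open>ball a e \<subseteq> U\<close>] by blast
    show "basis_of I (b z) (E z)" if "z \<in> ball a e" for z
      using U(5) that \<open>ball a e \<subseteq> U\<close> by blast
  qed
qed

text \<open>The identity theorem for subspaces. For a local frame \<open>b\<close> of \<open>E\<close> the
  functions \<open>P b - b\<close> are holomorphic, so if they vanish near one point of a ball they
  vanish throughout. This gives \<open>E \<subseteq> range P\<close>, and equality because both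
  dimensions are constant on the ball. Hence the set of points near which the two families agree is
  open and closed.\<close>

lemma grass_analytic_eq_on_connected:
  fixes P :: "complex \<Rightarrow> complex ^ 'n ^ 'n"
  assumes D: "open D" "connected D" and P: "mat_holomorphic_on P D" "\<And>z. z \<in> D \<Longrightarrow> P z ** P z = P z"
    and E: "grass_analytic_on E D" and U: "open U" "U \<subseteq> D" "U \<noteq> {}" "\<And>z. z \<in> U \<Longrightarrow> E z = {v. P z *v v = v}"
    and z: "z \<in> D"
  shows "E z = {v. P z *v v = v}"
proof -
  define Q where "Q z \<longleftrightarrow> (\<exists>V. open V \<and> z \<in> V \<and> V \<subseteq> D \<and> (\<forall>w\<in>V. E w = {v. P w *v v = v}))" for z
  obtain a where a: "a \<in> U" using U by blast
  have "Q z"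
  proof (rule connected_induction_simple[OF D(2), of a z Q])
    show "a \<in> D" "z \<in> D" using a U z by auto
    show "Q a" using a U unfolding Q_def by blast
    fix x assume x: "x \<in> D"
    obtain e I b where e: "0 < e" "ball x e \<subseteq> D" "\<And>j. j \<in> I \<Longrightarrow> vec_holomorphic_on (\<lambda>z. b z j) (ball x e)"
      "\<And>z. z \<in> ball x e \<Longrightarrow> basis_of I (b z) (E z)"
      using grass_analytic_frame_ball[OF E x] by metis
    obtain e' J c where e': "0 < e'" "ball x e' \<subseteq> D" "\<And>z. z \<in> ball x e' \<Longrightarrow> basis_of J (c z) {v. P z *v v = v}"
      using grass_analytic_frame_ball[OF idempotent_grass_analytic[OF D(1) P] x] by metis
    define T where "T = ball x (min e e')"
    have T: "open T" "connected T" "x \<in> T" "T \<subseteq> ball x e" "T \<subseteq> ball x e'" "T \<subseteq> D"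
      using e e' by (auto simp: T_def)
    have step: "Q v" if uv: "u \<in> T" "v \<in> T" "Q u" for u v
    proof -
      obtain V where V: "open V" "u \<in> V" "V \<subseteq> D" "\<forall>w\<in>V. E w = {v. P w *v v = v}"
        using uv(3) unfolding Q_def by blast
      have "basis_of I (b u) (E u)" "basis_of J (c u) (E u)"
        using e(4)[of u] e'(3)[of u] T uv(1) V(2,4) by auto
      then have IJ: "card I = card J" using basis_of_dim by metis
      have fixed: "P w *v b w j = b w j" if w: "w \<in> T" and j: "j \<in> I" for w j
      proof (rule vec_eq_on_connected[of "\<lambda>z. P z *v b z j" T "\<lambda>z. b z j" "T \<inter> V" w])
        have bT: "vec_holomorphic_on (\<lambda>z. b z j) T" using e(3)[OF j] T(4) by (rule vec_holomorphic_on_subset)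
        then show "vec_holomorphic_on (\<lambda>z. b z j) T" .
        show "vec_holomorphic_on (\<lambda>z. P z *v b z j) T"
          by (intro vec_holomorphic_on_mult bT mat_holomorphic_on_subset[OF P(1) T(6)])
        show "P y *v b y j = b y j" if y: "y \<in> T \<inter> V" for y
        proof -
          have "b y j \<in> E y"
            using e(4)[of y] T(4) y vec.span_base[of "b y j" "b y ` I"] j by (auto simp: basis_of_def)
          then show ?thesis using V(4) y by auto
        qed
      qed (use T V w uv in auto)
      have "E w = {v. P w *v v = v}" if w: "w \<in> T" for w
      proof (rule vec.subspace_dim_equal)
        have bw: "basis_of I (b w) (E w)" "basis_of J (c w) {v. P w *v v = v}"
          using e(4)[of w] e'(3)[of w] T w by auto
        show "vec.subspace (E w)" "vec.subspace {v. P w *v v = v}" using bw basis_of_subspace by blast+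
        show "vec.dim (E w) \<ge> vec.dim {v. P w *v v = v}"
          using basis_of_dim[OF bw(1)] basis_of_dim[OF bw(2)] IJ by simp
        have "vec.span (b w ` I) \<subseteq> {v. P w *v v = v}"
          by (rule vec.span_minimal) (use fixed[OF w] \<open>vec.subspace {v. P w *v v = v}\<close> in auto)
        then show "E w \<subseteq> {v. P w *v v = v}" using bw(1) by (simp add: basis_of_def)
      qed
      then show "Q v" using T uv(2) unfolding Q_def by blast
    qed
    then show "\<exists>T. openin (top_of_set D) T \<and> x \<in> T \<and> (\<forall>x\<in>T. \<forall>y\<in>T. Q x \<longrightarrow> Q y)"
    proof (intro exI[of _ T] conjI ballI impI)
      show "openin (top_of_set D) T" by (rule open_subset[OF T(6,1)])
      show "Q v" if "u \<in> T" "v \<in> T" "Q u" for u v using that by (rule step)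
    qed (rule T(3))
  qed
  then show ?thesis unfolding Q_def by blast
qed

text \<open>Connectedness of the unit interval, for properties that are locally constant in \<open>t\<close>.\<close>

lemma propagate_along_interval:
  fixes Q :: "real \<Rightarrow> bool"
  assumes "\<And>t. t \<in> {0..1} \<Longrightarrow> \<exists>\<epsilon>>0. \<forall>s\<in>{0..1}. \<bar>s - t\<bar> < \<epsilon> \<longrightarrow> (Q s \<longleftrightarrow> Q t)"
    and "Q 0" "t \<in> {0..1}"
  shows "Q t"
proof (rule connected_induction_simple[of "{0..1}" 0 t Q])
  fix a :: real assume "a \<in> {0..1}"
  then obtain \<epsilon> where "\<epsilon> > 0" "\<forall>s\<in>{0..1}. \<bar>s - a\<bar> < \<epsilon> \<longrightarrow> (Q s \<longleftrightarrow> Q a)" using assms(1) by blast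
  then show "\<exists>T. openin (top_of_set {0..1}) T \<and> a \<in> T \<and> (\<forall>x\<in>T. \<forall>y\<in>T. Q x \<longrightarrow> Q y)"
  proof (intro exI[of _ "{0..1} \<inter> ball a \<epsilon>"] conjI ballI impI)
    show "openin (top_of_set {0..1}) ({0..1} \<inter> ball a \<epsilon>)" by (rule openin_open_Int) simp
    show "a \<in> {0..1} \<inter> ball a \<epsilon>" using \<open>a \<in> {0..1}\<close> \<open>\<epsilon> > 0\<close> by simp
    fix x y assume xy: "x \<in> {0..1} \<inter> ball a \<epsilon>" "y \<in> {0..1} \<inter> ball a \<epsilon>" "Q x"
    have "\<bar>x - a\<bar> < \<epsilon>" "\<bar>y - a\<bar> < \<epsilon>" using xy(1,2) by (simp_all add: dist_real_def abs_minus_commute)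
    then show "Q y" using \<open>\<forall>s\<in>{0..1}. \<bar>s - a\<bar> < \<epsilon> \<longrightarrow> (Q s \<longleftrightarrow> Q a)\<close> xy by blast
  qed
qed (use assms in auto)

lemma discs_overlap:
  assumes \<gamma>: "path \<gamma>" and r: "\<And>t. t \<in> {0..1} \<Longrightarrow> 0 < r t" and t: "t \<in> {0..1}"
  shows "\<exists>\<epsilon>>0. \<forall>s\<in>{0..1}. \<bar>s - t\<bar> < \<epsilon> \<longrightarrow> ball (\<gamma> s) (r s) \<inter> ball (\<gamma> t) (r t) \<noteq> ({} :: complex set)"
proof -
  have "continuous_on {0..1} \<gamma>" using \<gamma> by (simp add: path_def)
  then obtain \<epsilon> where "0 < \<epsilon>" "\<forall>s\<in>{0..1}. dist s t < \<epsilon> \<longrightarrow> dist (\<gamma> s) (\<gamma> t) < r t"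
    using t r[OF t] unfolding continuous_on_iff by blast
  have "\<gamma> s \<in> ball (\<gamma> s) (r s) \<inter> ball (\<gamma> t) (r t)" if "s \<in> {0..1}" "\<bar>s - t\<bar> < \<epsilon>" for s
    using r[OF that(1)] \<open>\<forall>s\<in>{0..1}. dist s t < \<epsilon> \<longrightarrow> dist (\<gamma> s) (\<gamma> t) < r t\<close> that
    by (simp add: dist_real_def dist_commute)
  then show ?thesis using \<open>0 < \<epsilon>\<close> by blast
qed

section \<open>Analytic continuation of subspaces along paths\<close>

text \<open>The overlap condition of analytic continuation along a path.\<close>

definition compatible_along :: "(real \<Rightarrow> complex) \<Rightarrow> (real \<Rightarrow> real) \<Rightarrow> (real \<Rightarrow> complex \<Rightarrow> 'a) \<Rightarrow> bool" where
  "compatible_along \<gamma> r f \<longleftrightarrow> (\<forall>t\<in>{0..1}. \<exists>\<epsilon>>0. \<forall>s\<in>{0..1}. \<bar>s - t\<bar> < \<epsilon> \<longrightarrow>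
     (\<forall>z\<in>ball (\<gamma> s) (r s) \<inter> ball (\<gamma> t) (r t). f s z = f t z))"

lemma compatible_alongI:
  assumes "compatible_along \<gamma> r f" "\<And>s t z. f s z = f t z \<Longrightarrow> h s z = h t z"
  shows "compatible_along \<gamma> r h"
  unfolding compatible_along_def
proof
  fix t :: real assume "t \<in> {0..1}"
  then obtain \<epsilon> where "\<epsilon> > 0" "\<forall>s\<in>{0..1}. \<bar>s - t\<bar> < \<epsilon> \<longrightarrow>
     (\<forall>z\<in>ball (\<gamma> s) (r s) \<inter> ball (\<gamma> t) (r t). f s z = f t z)"
    using assms(1) unfolding compatible_along_def by blast
  then show "\<exists>\<epsilon>>0. \<forall>s\<in>{0..1}. \<bar>s - t\<bar> < \<epsilon> \<longrightarrow>
     (\<forall>z\<in>ball (\<gamma> s) (r s) \<inter> ball (\<gamma> t) (r t). h s z = h t z)"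
    using assms(2) by blast
qed

lemma compatible_along_smaller:
  assumes "compatible_along \<gamma> r f" "\<And>t. r' t \<le> r t"
  shows "compatible_along \<gamma> r' f"
  unfolding compatible_along_def
proof
  have sub: "ball (\<gamma> s) (r' s) \<inter> ball (\<gamma> t) (r' t) \<subseteq> ball (\<gamma> s) (r s) \<inter> ball (\<gamma> t) (r t)" for s t
    by (intro Int_mono subset_ball assms(2))
  fix t :: real assume "t \<in> {0..1}"
  then obtain \<epsilon> where "\<epsilon> > 0" and eq: "\<forall>s\<in>{0..1}. \<bar>s - t\<bar> < \<epsilon> \<longrightarrow>
     (\<forall>z\<in>ball (\<gamma> s) (r s) \<inter> ball (\<gamma> t) (r t). f s z = f t z)"
    using assms(1) unfolding compatible_along_def by blast
  have "f s z = f t z" if "s \<in> {0..1}" "\<bar>s - t\<bar> < \<epsilon>" "z \<in> ball (\<gamma> s) (r' s) \<inter> ball (\<gamma> t) (r' t)" for s z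
    using eq that(1,2) subsetD[OF sub that(3)] by simp
  with \<open>\<epsilon> > 0\<close> show "\<exists>\<epsilon>>0. \<forall>s\<in>{0..1}. \<bar>s - t\<bar> < \<epsilon> \<longrightarrow>
     (\<forall>z\<in>ball (\<gamma> s) (r' s) \<inter> ball (\<gamma> t) (r' t). f s z = f t z)" by blast
qed

lemma compatible_along_Pair:
  assumes "compatible_along \<gamma> r f" "compatible_along \<gamma> r g"
  shows "compatible_along \<gamma> r (\<lambda>t z. (f t z, g t z))"
  unfolding compatible_along_def
proof
  fix t :: real assume t: "t \<in> {0..1}"
  obtain \<epsilon>1 where 1: "\<epsilon>1 > 0" "\<forall>s\<in>{0..1}. \<bar>s - t\<bar> < \<epsilon>1 \<longrightarrow>
     (\<forall>z\<in>ball (\<gamma> s) (r s) \<inter> ball (\<gamma> t) (r t). f s z = f t z)"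
    using assms(1) t unfolding compatible_along_def by blast
  obtain \<epsilon>2 where 2: "\<epsilon>2 > 0" "\<forall>s\<in>{0..1}. \<bar>s - t\<bar> < \<epsilon>2 \<longrightarrow>
     (\<forall>z\<in>ball (\<gamma> s) (r s) \<inter> ball (\<gamma> t) (r t). g s z = g t z)"
    using assms(2) t unfolding compatible_along_def by blast
  show "\<exists>\<epsilon>>0. \<forall>s\<in>{0..1}. \<bar>s - t\<bar> < \<epsilon> \<longrightarrow>
     (\<forall>z\<in>ball (\<gamma> s) (r s) \<inter> ball (\<gamma> t) (r t). (f s z, g s z) = (f t z, g t z))"
    by (intro exI[of _ "min \<epsilon>1 \<epsilon>2"]) (use 1 2 in auto)
qed

text \<open>A property of the elements of a continuation that passes between elements agreeing on overlapping
  discs, in either direction, is locally constant in \<open>t\<close>. The identity theorem supplies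
  the step in the applications.\<close>

lemma propagate_along_discs:
  assumes \<gamma>: "path \<gamma>" and r: "\<And>t. t \<in> {0..1} \<Longrightarrow> 0 < r t" and comp: "compatible_along \<gamma> r f"
    and step: "\<And>a b. a \<in> {0..1} \<Longrightarrow> b \<in> {0..1} \<Longrightarrow> Q a \<Longrightarrow>
      ball (\<gamma> a) (r a) \<inter> ball (\<gamma> b) (r b) \<noteq> {} \<Longrightarrow>
      (\<And>z. z \<in> ball (\<gamma> a) (r a) \<inter> ball (\<gamma> b) (r b) \<Longrightarrow> f a z = f b z) \<Longrightarrow> Q b"
    and start: "Q 0" and t: "t \<in> {0..1}"
  shows "Q t"
proof (rule propagate_along_interval[where Q=Q and t=t, OF _ start t])
  fix t :: real assume t: "t \<in> {0..1}"
  obtain \<epsilon>1 where 1: "\<epsilon>1 > 0" "\<forall>s\<in>{0..1}. \<bar>s - t\<bar> < \<epsilon>1 \<longrightarrow>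
     (\<forall>z\<in>ball (\<gamma> s) (r s) \<inter> ball (\<gamma> t) (r t). f s z = f t z)"
    using comp t unfolding compatible_along_def by blast
  obtain \<epsilon>2 where 2: "\<epsilon>2 > 0" "\<forall>s\<in>{0..1}. \<bar>s - t\<bar> < \<epsilon>2 \<longrightarrow> ball (\<gamma> s) (r s) \<inter> ball (\<gamma> t) (r t) \<noteq> {}"
    using discs_overlap[where \<gamma>=\<gamma> and r=r and t=t, OF \<gamma> r t] by blast
  show "\<exists>\<epsilon>>0. \<forall>s\<in>{0..1}. \<bar>s - t\<bar> < \<epsilon> \<longrightarrow> (Q s \<longleftrightarrow> Q t)"
  proof (intro exI[of _ "min \<epsilon>1 \<epsilon>2"] conjI ballI impI)
    fix s :: real assume s: "s \<in> {0..1}" "\<bar>s - t\<bar> < min \<epsilon>1 \<epsilon>2"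
    have eq: "f s z = f t z" if "z \<in> ball (\<gamma> s) (r s) \<inter> ball (\<gamma> t) (r t)" for z
      using 1 s that by auto
    have ne: "ball (\<gamma> s) (r s) \<inter> ball (\<gamma> t) (r t) \<noteq> {}" using 2 s by auto
    show "Q s \<longleftrightarrow> Q t"
    proof
      show "Q t" if "Q s" by (rule step[OF s(1) t that ne eq])
      show "Q s" if "Q t"
        by (rule step[OF t s(1) that]) (use ne eq in auto)
    qed
  qed (use 1 2 in simp)
qed

lemma idempotent_along_path:
  fixes P :: "real \<Rightarrow> complex \<Rightarrow> complex ^ 'n ^ 'n"
  assumes \<gamma>: "path \<gamma>" and r: "\<And>t. t \<in> {0..1} \<Longrightarrow> 0 < r t"
    and hol: "\<And>t. t \<in> {0..1} \<Longrightarrow> mat_holomorphic_on (P t) (ball (\<gamma> t) (r t))"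
    and comp: "compatible_along \<gamma> r P"
    and start: "\<And>z. z \<in> ball (\<gamma> 0) (r 0) \<Longrightarrow> P 0 z ** P 0 z = P 0 z"
    and t: "t \<in> {0..1}" and z: "z \<in> ball (\<gamma> t) (r t)"
  shows "P t z ** P t z = P t z"
proof -
  define Q where "Q t \<longleftrightarrow> (\<forall>z\<in>ball (\<gamma> t) (r t). P t z ** P t z = P t z)" for t
  have "Q t"
  proof (rule propagate_along_discs[where Q=Q, OF \<gamma> r comp _ _ t])
    show "Q 0" using start by (simp add: Q_def)
    fix a b :: real
    assume ab: "a \<in> {0..1}" "b \<in> {0..1}" "Q a" "ball (\<gamma> a) (r a) \<inter> ball (\<gamma> b) (r b) \<noteq> {}"
      and eq: "\<And>z. z \<in> ball (\<gamma> a) (r a) \<inter> ball (\<gamma> b) (r b) \<Longrightarrow> P a z = P b z"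
    show "Q b"
      unfolding Q_def
    proof
      fix z assume z: "z \<in> ball (\<gamma> b) (r b)"
      show "P b z ** P b z = P b z"
      proof (rule mat_eq_on_connected[where U="ball (\<gamma> a) (r a) \<inter> ball (\<gamma> b) (r b)" and D="ball (\<gamma> b) (r b)"])
        show "mat_holomorphic_on (\<lambda>z. P b z ** P b z) (ball (\<gamma> b) (r b))"
          "mat_holomorphic_on (P b) (ball (\<gamma> b) (r b))"
          using hol[OF ab(2)] by (auto intro: mat_holomorphic_on_mult)
        show "P b w ** P b w = P b w" if w: "w \<in> ball (\<gamma> a) (r a) \<inter> ball (\<gamma> b) (r b)" for w
        proof -
          have "P a w ** P a w = P a w" using ab(3) w unfolding Q_def by blast
          then show ?thesis by (simp only: eq[OF w])
        qed
      qed (use ab(4) z in auto)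
    qed
  qed
  then show ?thesis using z by (simp add: Q_def)
qed

lemma grass_analytic_on_subset:
  fixes E :: "complex \<Rightarrow> (complex ^ 'n) set"
  assumes E: "grass_analytic_on E D" and D': "open D'" "D' \<subseteq> D"
  shows "grass_analytic_on E D'"
proof -
  have "\<exists>U (I::'n set) b. open U \<and> a \<in> U \<and> U \<subseteq> D' \<and>
      (\<forall>j\<in>I. vec_holomorphic_on (\<lambda>z. b z j) U) \<and> (\<forall>z\<in>U. basis_of I (b z) (E z))" if a: "a \<in> D'" for a
  proof -
    have "a \<in> D" using a D'(2) by blast
    then obtain e and I :: "'n set" and b where e: "0 < e" "ball a e \<subseteq> D"
      "\<And>j. j \<in> I \<Longrightarrow> vec_holomorphic_on (\<lambda>z. b z j) (ball a e)" "\<And>z. z \<in> ball a e \<Longrightarrow> basis_of I (b z) (E z)"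
      using grass_analytic_frame_ball[OF E] by metis
    have "\<forall>j\<in>I. vec_holomorphic_on (\<lambda>z. b z j) (ball a e \<inter> D')"
      using e(3) vec_holomorphic_on_subset[OF _ Int_lower1] by blast
    then show ?thesis
      using e a D'(1) by (intro exI[of _ "ball a e \<inter> D'"] exI[of _ I] exI[of _ b]) auto
  qed
  then show ?thesis unfolding grass_analytic_on_def by blast
qed

text \<open>Any continuation of \<open>S\<close> agrees with the ranges of the continued idempotents: the
  agreement holds on the first disc and passes from disc to disc by the identity theorem for
  subspaces. Smaller radii make both families available on common discs.\<close>

lemma grass_continuation_unique:
  fixes P :: "real \<Rightarrow> complex \<Rightarrow> complex ^ 'n ^ 'n"
  assumes \<gamma>: "path \<gamma>" and r: "\<And>t. t \<in> {0..1} \<Longrightarrow> 0 < r t"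
    and hol: "\<And>t. t \<in> {0..1} \<Longrightarrow> mat_holomorphic_on (P t) (ball (\<gamma> t) (r t))"
    and comp: "compatible_along \<gamma> r P"
    and idem: "\<And>t z. t \<in> {0..1} \<Longrightarrow> z \<in> ball (\<gamma> t) (r t) \<Longrightarrow> P t z ** P t z = P t z"
    and start: "\<And>z. z \<in> ball (\<gamma> 0) (r 0) \<Longrightarrow> {v. P 0 z *v v = v} = S z"
    and V: "continues_to grass_analytic_on U S \<gamma> V"
  shows "V = {v. P 1 (\<gamma> 1) *v v = v}"
proof -
  obtain E \<rho> where E: "\<And>t. t \<in> {0..1} \<Longrightarrow> 0 < \<rho> t" "\<And>t. t \<in> {0..1} \<Longrightarrow> grass_analytic_on (E t) (ball (\<gamma> t) (\<rho> t))"
    "\<And>z. z \<in> ball (\<gamma> 0) (\<rho> 0) \<Longrightarrow> E 0 z = S z" "compatible_along \<gamma> \<rho> E" "E 1 (\<gamma> 1) = V"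
    using V unfolding continues_to_def compatible_along_def by blast
  define m where "m t = min (r t) (\<rho> t)" for t
  have m: "0 < m t" if "t \<in> {0..1}" for t using r[OF that] E(1)[OF that] by (simp add: m_def)
  have mb: "ball (\<gamma> t) (m t) \<subseteq> ball (\<gamma> t) (r t)" "ball (\<gamma> t) (m t) \<subseteq> ball (\<gamma> t) (\<rho> t)" for t
    by (auto simp: m_def)
  have both: "compatible_along \<gamma> m (\<lambda>t z. (P t z, E t z))"
    by (intro compatible_along_Pair compatible_along_smaller[OF comp] compatible_along_smaller[OF E(4)])
       (simp_all add: m_def)
  define Q where "Q t \<longleftrightarrow> (\<forall>z\<in>ball (\<gamma> t) (m t). E t z = {v. P t z *v v = v})" for t
  have "Q 1"
  proof (rule propagate_along_discs[where Q=Q, OF \<gamma> m both])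
    show "Q 0" unfolding Q_def
    proof
      fix z assume "z \<in> ball (\<gamma> 0) (m 0)"
      then have "z \<in> ball (\<gamma> 0) (r 0)" "z \<in> ball (\<gamma> 0) (\<rho> 0)" using mb by blast+
      then show "E 0 z = {v. P 0 z *v v = v}" using start E(3) by simp
    qed
    fix a b :: real
    assume ab: "a \<in> {0..1}" "b \<in> {0..1}" "Q a" "ball (\<gamma> a) (m a) \<inter> ball (\<gamma> b) (m b) \<noteq> {}"
      and eq: "\<And>z. z \<in> ball (\<gamma> a) (m a) \<inter> ball (\<gamma> b) (m b) \<Longrightarrow> (P a z, E a z) = (P b z, E b z)"
    show "Q b"
      unfolding Q_def
    proof
      fix z assume z: "z \<in> ball (\<gamma> b) (m b)"
      show "E b z = {v. P b z *v v = v}"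
      proof (rule grass_analytic_eq_on_connected[where U="ball (\<gamma> a) (m a) \<inter> ball (\<gamma> b) (m b)"])
        show "mat_holomorphic_on (P b) (ball (\<gamma> b) (m b))"
          by (rule mat_holomorphic_on_subset[OF hol[OF ab(2)] mb(1)])
        show "grass_analytic_on (E b) (ball (\<gamma> b) (m b))"
          by (rule grass_analytic_on_subset[OF E(2)[OF ab(2)] open_ball mb(2)])
        show "P b w ** P b w = P b w" if "w \<in> ball (\<gamma> b) (m b)" for w
          using idem[OF ab(2)] mb(1) that by blast
        show "E b w = {v. P b w *v v = v}" if w: "w \<in> ball (\<gamma> a) (m a) \<inter> ball (\<gamma> b) (m b)" for w
        proof -
          have "E a w = {v. P a w *v v = v}" using ab(3) w unfolding Q_def by blast
          moreover have "P a w = P b w" "E a w = E b w" using eq[OF w] by (blast dest: prod.inject[THEN iffD1])+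
          ultimately show ?thesis by (simp only:)
        qed
      qed (use ab(4) z in auto)
    qed
  qed simp_all
  then have "E 1 (\<gamma> 1) = {v. P 1 (\<gamma> 1) *v v = v}"
    using m[of 1] by (simp add: Q_def)
  then show ?thesis using E(5) by simp
qed

lemma idempotent_continues_to:
  fixes P :: "real \<Rightarrow> complex \<Rightarrow> complex ^ 'n ^ 'n"
  assumes r: "\<And>t. t \<in> {0..1} \<Longrightarrow> 0 < r t"
    and hol: "\<And>t. t \<in> {0..1} \<Longrightarrow> mat_holomorphic_on (P t) (ball (\<gamma> t) (r t))"
    and comp: "compatible_along \<gamma> r P"
    and idem: "\<And>t z. t \<in> {0..1} \<Longrightarrow> z \<in> ball (\<gamma> t) (r t) \<Longrightarrow> P t z ** P t z = P t z"
    and U: "ball (\<gamma> 0) (r 0) \<subseteq> U" and start: "\<And>z. z \<in> ball (\<gamma> 0) (r 0) \<Longrightarrow> {v. P 0 z *v v = v} = S z"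
  shows "continues_to grass_analytic_on U S \<gamma> {v. P 1 (\<gamma> 1) *v v = v}"
proof -
  define E where "E t z = {v. P t z *v v = v}" for t z
  have "compatible_along \<gamma> r E" by (rule compatible_alongI[OF comp]) (simp add: E_def)
  moreover have "grass_analytic_on (E t) (ball (\<gamma> t) (r t))" if "t \<in> {0..1}" for t
    unfolding E_def using idem[OF that] by (intro idempotent_grass_analytic hol that) auto
  moreover have "E 0 z = S z" if "z \<in> ball (\<gamma> 0) (r 0)" for z using start[OF that] by (simp add: E_def)
  moreover have "E 1 (\<gamma> 1) = {v. P 1 (\<gamma> 1) *v v = v}" by (simp add: E_def)
  ultimately show ?thesis
    using r U unfolding continues_to_def compatible_along_def by blast
qed

lemma idempotent_complement:
  "P ** P = P \<Longrightarrow> (mat 1 - P) ** (mat 1 - P) = mat 1 - (P :: complex ^ 'n ^ 'n)"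
  by (simp add: mmm.diff_left mmm.diff_right)

lemma fixed_space_complement: "{v. (mat 1 - P) *v v = v} = {v. (P :: complex ^ 'n ^ 'n) *v v = 0}"
  by (simp add: mvm.diff_left)

text \<open>This is the converse part in abstract form: \<open>g\<close> determines the projection \<open>P =
  L g R + s\<close> onto \<open>S\<close> along \<open>T\<close> through entire factors
  \<open>L\<close> and \<open>R\<close>. A continuation of \<open>g\<close> thus yields one of
  \<open>P\<close> by idempotents, whose ranges continue \<open>S\<close> and whose kernels, the
  ranges of \<open>P' = 1 - P\<close>, continue \<open>T\<close>.\<close>

lemma continuation_of_projections:
  fixes g L R :: "complex \<Rightarrow> complex ^ 'n ^ 'n" and S T :: "complex \<Rightarrow> (complex ^ 'n) set" and s :: real
  assumes \<gamma>: "path \<gamma>" and U: "U \<subseteq> U'"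
    and LR: "mat_holomorphic_on L UNIV" "mat_holomorphic_on R UNIV"
    and proj: "\<And>z. z \<in> U \<Longrightarrow> projects (L z ** g z ** R z + s *\<^sub>R mat 1) (S z) (T z)"
    and cont: "continuable mat_holomorphic_on U g \<gamma>"
  shows "continuable grass_analytic_on U' S \<gamma>" "continuable grass_analytic_on U' T \<gamma>"
    "continues_to grass_analytic_on U' T \<gamma> V \<Longrightarrow> continues_to grass_analytic_on U' S \<gamma> W \<Longrightarrow> V \<inter> W = {0}"
proof -
  obtain h r where h: "\<And>t. t \<in> {0..1} \<Longrightarrow> 0 < r t" "\<And>t. t \<in> {0..1} \<Longrightarrow> mat_holomorphic_on (h t) (ball (\<gamma> t) (r t))"
    "ball (\<gamma> 0) (r 0) \<subseteq> U" "\<And>z. z \<in> ball (\<gamma> 0) (r 0) \<Longrightarrow> h 0 z = g z" "compatible_along \<gamma> r h"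
    using cont unfolding continuable_def continues_to_def compatible_along_def by blast
  define P where "P t z = L z ** h t z ** R z + s *\<^sub>R mat 1" for t z
  define P' where "P' t z = mat 1 - P t z" for t z
  have LR': "mat_holomorphic_on L X" "mat_holomorphic_on R X" for X
    using LR mat_holomorphic_on_subset by blast+
  have hol: "mat_holomorphic_on (P t) (ball (\<gamma> t) (r t))" if "t \<in> {0..1}" for t
    unfolding P_def by (intro mat_holomorphic_on_add mat_holomorphic_on_mult LR' h(2) mat_holomorphic_on_const that)
  have hol': "mat_holomorphic_on (P' t) (ball (\<gamma> t) (r t))" if "t \<in> {0..1}" for t
    unfolding P'_def by (intro mat_holomorphic_on_diff hol mat_holomorphic_on_const that)
  have comp: "compatible_along \<gamma> r P" by (rule compatible_alongI[OF h(5)]) (simp add: P_def)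
  have comp': "compatible_along \<gamma> r P'" by (rule compatible_alongI[OF comp]) (simp add: P'_def)
  have p0: "projects (P 0 z) (S z) (T z)" if "z \<in> ball (\<gamma> 0) (r 0)" for z
    using proj[of z] that h(3,4) by (auto simp: P_def)
  have idem: "P t z ** P t z = P t z" if "t \<in> {0..1}" "z \<in> ball (\<gamma> t) (r t)" for t z
    by (rule idempotent_along_path[OF \<gamma> h(1) hol comp projects_idem[OF p0] that])
  have idem': "P' t z ** P' t z = P' t z" if "t \<in> {0..1}" "z \<in> ball (\<gamma> t) (r t)" for t z
    using idempotent_complement[OF idem[OF that]] by (simp add: P'_def)
  have start: "{v. P 0 z *v v = v} = S z" if "z \<in> ball (\<gamma> 0) (r 0)" for z
    using projects_range[OF p0[OF that]] .
  have start': "{v. P' 0 z *v v = v} = T z" if "z \<in> ball (\<gamma> 0) (r 0)" for z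
    using projects_kernel[OF p0[OF that]] by (simp add: P'_def fixed_space_complement)
  have U': "ball (\<gamma> 0) (r 0) \<subseteq> U'" using h(3) U by blast
  show "continuable grass_analytic_on U' S \<gamma>"
    unfolding continuable_def
    using idempotent_continues_to[where P=P and r=r, OF h(1) hol comp idem U' start] by blast
  show "continuable grass_analytic_on U' T \<gamma>"
    unfolding continuable_def
    using idempotent_continues_to[where P=P' and r=r, OF h(1) hol' comp' idem' U' start'] by blast
  assume V: "continues_to grass_analytic_on U' T \<gamma> V" and W: "continues_to grass_analytic_on U' S \<gamma> W"
  have "W = {v. P 1 (\<gamma> 1) *v v = v}"
    by (rule grass_continuation_unique[OF \<gamma> h(1) hol comp idem start W])
  moreover have "V = {v. P' 1 (\<gamma> 1) *v v = v}"
    by (rule grass_continuation_unique[OF \<gamma> h(1) hol' comp' idem' start' V])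
  ultimately show "V \<inter> W = {0}"
    by (auto simp: P'_def fixed_space_complement)
qed

lemma iota_columns:
  "iota I w z = (*v) (columns_matrix (\<lambda>j. if j \<in> I then w j z else - w j z))"
proof
  fix u
  show "iota I w z u = columns_matrix (\<lambda>j. if j \<in> I then w j z else - w j z) *v u"
    by (simp add: iota_def columns_matrix_mult sum_split[of _ I] sum_negf)
qed

text \<open>The map \<open>c \<mapsto> - \<Sum>\<^bsub>j \<notin> I\<^esub> (K c)\<^sub>j w\<^sub>j\<close>.
  For \<open>K = \<iota>\<^sup>-\<^sup>1\<close> this is the component of \<open>c\<close> in the
  span of the \<open>w\<^sub>j\<close> with \<open>j \<notin> I\<close>; the sign is that in the
  definition of \<open>\<iota>\<close>.\<close>

definition projection_from_inverse ::
  "'n set \<Rightarrow> ('n \<Rightarrow> complex \<Rightarrow> complex ^ 'n) \<Rightarrow> (complex \<Rightarrow> complex ^ 'n ^ 'n) \<Rightarrow> complex \<Rightarrow> complex ^ 'n ^ 'n" where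
  "projection_from_inverse I w K z = (\<chi> i k. - (\<Sum>j\<in>- I. w j z $ i * K z $ j $ k))"

lemma projection_from_inverse_mult:
  "projection_from_inverse I w K z *v v = - (\<Sum>j\<in>- I. (K z *v v) $ j *s w j z)"
proof -
  have "(projection_from_inverse I w K z *v v) $ i = - (\<Sum>j\<in>- I. (K z *v v) $ j * w j z $ i)" for i
  proof -
    have "(projection_from_inverse I w K z *v v) $ i = - (\<Sum>k\<in>UNIV. \<Sum>j\<in>- I. w j z $ i * K z $ j $ k * v $ k)"
      by (simp add: projection_from_inverse_def matrix_vector_mult_def sum_negf sum_distrib_right)
    also have "(\<Sum>k\<in>UNIV. \<Sum>j\<in>- I. w j z $ i * K z $ j $ k * v $ k) = (\<Sum>j\<in>- I. \<Sum>k\<in>UNIV. w j z $ i * K z $ j $ k * v $ k)"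
      by (rule sum.swap)
    also have "\<dots> = (\<Sum>j\<in>- I. (K z *v v) $ j * w j z $ i)"
      by (simp add: matrix_vector_mult_def sum_distrib_left sum_distrib_right mult_ac)
    finally show ?thesis .
  qed
  then show ?thesis by (simp add: vec_eq_iff)
qed

lemma projection_from_inverse_holomorphic:
  assumes "\<forall>j. vec_holomorphic_on (w j) D" "mat_holomorphic_on K D"
  shows "mat_holomorphic_on (projection_from_inverse I w K) D"
  using assms unfolding mat_holomorphic_on_def vec_holomorphic_on_def projection_from_inverse_def
  by (auto intro!: holomorphic_intros)

text \<open>A linear relation between the columns of \<open>\<iota>\<close> equates a vector of
  \<open>U\<close> with a vector of \<open>S\<close>.\<close>

lemma iota_invertible_of_direct_sum:
  fixes w :: "'n \<Rightarrow> complex \<Rightarrow> complex ^ 'n"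
  assumes b: "basis_of I (\<lambda>j. w j z) U" "basis_of (- I) (\<lambda>j. w j z) S" and d: "S \<inter> U \<subseteq> {0}"
  shows "invertible (matrix (iota I w z))"
proof -
  let ?b = "\<lambda>j. if j \<in> I then w j z else - w j z"
  have "k = 0" if k: "(\<Sum>j\<in>UNIV. k $ j *s ?b j) = 0" for k :: "complex ^ 'n"
  proof -
    let ?u = "\<Sum>j\<in>I. k $ j *s w j z" and ?s = "\<Sum>j\<in>- I. k $ j *s w j z"
    have "?u = ?s" using k by (simp add: sum_split[of _ I] sum_negf)
    moreover have "?u \<in> U" "?s \<in> S"
      using basis_of_combination_in[OF b(1)] basis_of_combination_in[OF b(2)] by blast+
    ultimately have "?u = 0" "?s = 0" using d by auto
    then have "k $ j = 0" for j
      using basis_of_combination_0[OF b(1), of "\<lambda>j. k $ j" j] basis_of_combination_0[OF b(2), of "\<lambda>j. k $ j" j]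
      by (cases "j \<in> I") auto
    then show ?thesis by (simp add: vec_eq_iff)
  qed
  then show ?thesis
    by (simp add: iota_columns invertible_det_nz columns_matrix_det_iff)
qed

text \<open>Solving \<open>\<iota> u = c\<close> splits \<open>c\<close> into its components in
  \<open>U\<close> and \<open>S\<close>.\<close>

lemma projects_from_iota_inverse:
  fixes w :: "'n \<Rightarrow> complex \<Rightarrow> complex ^ 'n"
  assumes b: "basis_of I (\<lambda>j. w j z) U" "basis_of (- I) (\<lambda>j. w j z) S" and d: "S \<inter> U \<subseteq> {0}"
    and K: "K z = matrix_inv (matrix (iota I w z))"
  shows "projects (projection_from_inverse I w K z) S U"
proof -
  let ?C = "matrix (iota I w z)"
  let ?P = "projection_from_inverse I w K z"
  have "?C ** K z = mat 1"
    using iota_invertible_of_direct_sum[where I=I and w=w and z=z, OF b d]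
    unfolding K matrix_inv_def invertible_def by (rule someI2_ex) blast
  then have CK: "?C *v (K z *v v) = v" for v by (simp add: matrix_vector_mul_assoc)
  have C: "?C *v u = iota I w z u" for u by (simp add: iota_columns)
  have split: "v - ?P *v v = (\<Sum>j\<in>I. (K z *v v) $ j *s w j z)" for v
    using CK[of v] by (simp add: C iota_def projection_from_inverse_mult algebra_simps)
  show ?thesis
  proof (rule projectsI[OF basis_of_subspace[OF b(2)] basis_of_subspace[OF b(1)] d])
    show "v - ?P *v v \<in> U" for v unfolding split by (rule basis_of_combination_in[OF b(1)])
    show "?P *v v \<in> S" for v
      unfolding projection_from_inverse_mult
      using basis_of_subspace[OF b(2)] basis_of_combination_in[OF b(2)] vec.subspace_neg by blast
  qed
qed

lemma projects_disjoint: "projects P S U \<Longrightarrow> S \<inter> U \<subseteq> {0}"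
  unfolding projects_def by force

lemma initial_region_subset: "initial_region Ap Am iM \<rho> \<subseteq> same_morse_set Ap Am iM"
  unfolding initial_region_def by (auto dest: connected_component_in)

text \<open>The choice of \<open>P\<close> and \<open>s\<close> below reduces all statements about
  \<open>g\<close> to statements about projections: multiply \<open>g\<close> by
  \<open>\<Phi>(x)\<^sup>-\<^sup>1\<close> and \<open>\<Phi>(y)\<close> and add \<open>s\<close>.\<close>

theorem proposition2p7:
  fixes A :: "real \<Rightarrow> complex \<Rightarrow> complex ^ 'n ^ 'n"
    and Ap Am :: "complex \<Rightarrow> complex ^ 'n ^ 'n"
    and iM :: nat and \<rho> :: real
    and Es Eu :: "real \<Rightarrow> complex \<Rightarrow> (complex ^ 'n) set"
    and G :: "real \<Rightarrow> real \<Rightarrow> complex \<Rightarrow> complex ^ 'n ^ 'n"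
    and \<Omega> B :: "complex set"
    and Fs Fu :: "complex \<Rightarrow> (complex ^ 'n) set"
    and I :: "'n set" and w :: "'n \<Rightarrow> complex \<Rightarrow> complex ^ 'n"
  defines "init \<equiv> initial_region Ap Am iM \<rho>"
  defines "reg \<equiv> {z\<in>init. T_invertible A z}"
  assumes A_continuous: "continuous_on UNIV (\<lambda>p. A (fst p) (snd p))"
    and A_analytic: "\<forall>x. mat_holomorphic_on (A x) UNIV"
    and A_plus: "\<forall>z. ((\<lambda>x. A x z) \<longlongrightarrow> Ap z) at_top"
    and A_minus: "\<forall>z. ((\<lambda>x. A x z) \<longlongrightarrow> Am z) at_bot"
    and T_inv: "\<forall>z. Re z > \<rho> \<longrightarrow> T_invertible A z"
    and morse: "\<forall>z. Re z > \<rho> \<longrightarrow> z \<in> same_morse_set Ap Am iM"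
    and Es: "\<forall>z\<in>init. transported_family A z (\<lambda>x. Es x z) (stable_space (Ap z)) at_top"
    and Eu: "\<forall>z\<in>init. transported_family A z (\<lambda>x. Eu x z) (unstable_space (Am z)) at_bot"
    and G: "\<forall>z. T_invertible A z \<longrightarrow> (\<forall>y. is_green A z y (\<lambda>x. G x y z))"
    and \<Omega>: "open \<Omega>" "connected \<Omega>"
    and B: "open B" "B \<noteq> {}" "B \<subseteq> \<Omega> \<inter> init"
    and Fu: "grass_analytic_on Fu \<Omega>" "\<forall>z\<in>B. Fu z = Eu 0 z"
    and Fs: "grass_analytic_on Fs \<Omega>" "\<forall>z\<in>B. Fs z = Es 0 z"
    and w: "card I = iM" "\<forall>j. vec_holomorphic_on (w j) \<Omega>"
      "\<forall>z\<in>\<Omega>. basis_of I (\<lambda>j. w j z) (Fu z) \<and> basis_of (- I) (\<lambda>j. w j z) (Fs z)"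
  shows "\<forall>x y. \<forall>g\<in>green_values G x y.
     (\<forall>D K. open D \<and> connected D \<and> D \<subseteq> \<Omega> \<and> D \<inter> B \<noteq> {} \<and> mat_holomorphic_on K D \<and>
        (\<forall>z\<in>D \<inter> B. invertible (matrix (iota I w z)) \<longrightarrow> K z = matrix_inv (matrix (iota I w z))) \<longrightarrow>
        (\<exists>H. mat_holomorphic_on H D \<and> (\<forall>z\<in>D \<inter> B. T_invertible A z \<longrightarrow> H z = g z))) \<and>
     (\<forall>\<gamma>. path \<gamma> \<and> pathstart \<gamma> \<in> reg \<longrightarrow>
        (\<not> continuable grass_analytic_on init (Eu 0) \<gamma> \<or>
           \<not> continuable grass_analytic_on init (Es 0) \<gamma> \<longrightarrow>
           \<not> continuable mat_holomorphic_on reg g \<gamma>) \<and>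
        ((\<exists>V W. continues_to grass_analytic_on init (Eu 0) \<gamma> V \<and>
           continues_to grass_analytic_on init (Es 0) \<gamma> W \<and> V \<inter> W \<noteq> {0}) \<longrightarrow>
           \<not> continuable mat_holomorphic_on reg g \<gamma>))"
proof (intro allI ballI)
  fix x y g
  assume g: "g \<in> green_values G x y"
  obtain s :: real where s: "\<And>z P. green_given_by A z (\<lambda>x y. G x y z) P \<Longrightarrow>
      g z = fundamental A x z ** (P - s *\<^sub>R mat 1) ** fundamental_inv A y z"
    using green_value_formula[OF A_continuous g] by blast
  have "\<exists>P. projects P (Es 0 z) (Eu 0 z) \<and>
      g z = fundamental A x z ** (P - s *\<^sub>R mat 1) ** fundamental_inv A y z" if z: "z \<in> reg" for z
  proof -
    have zi: "z \<in> init" "T_invertible A z" using z by (auto simp: reg_def)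
    have "z \<in> same_morse_set Ap Am iM" using zi(1) initial_region_subset unfolding init_def by blast
    then have hyp: "hyperbolic (Ap z)" "hyperbolic (Am z)" by (auto simp: same_morse_set_def)
    have "\<exists>P. projects P (Es 0 z) (Eu 0 z) \<and> green_given_by A z (\<lambda>x y. G x y z) P"
      by (rule green_formula[OF A_continuous A_plus[rule_format] A_minus[rule_format] hyp
          Es[rule_format, OF zi(1)] Eu[rule_format, OF zi(1)] zi(2)]) (use G zi(2) in blast)
    then show ?thesis using s by blast
  qed
  then obtain P where P: "\<And>z. z \<in> reg \<Longrightarrow> projects (P z) (Es 0 z) (Eu 0 z)"
    "\<And>z. z \<in> reg \<Longrightarrow> g z = fundamental A x z ** (P z - s *\<^sub>R mat 1) ** fundamental_inv A y z"
    by metis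
  have hol: "mat_holomorphic_on (fundamental A a) UNIV" "mat_holomorphic_on (fundamental_inv A a) UNIV" for a
    using fundamental_holomorphic[OF A_continuous] fundamental_inv_holomorphic[OF A_continuous] A_analytic
    by blast+
  show "(\<forall>D K. open D \<and> connected D \<and> D \<subseteq> \<Omega> \<and> D \<inter> B \<noteq> {} \<and> mat_holomorphic_on K D \<and>
        (\<forall>z\<in>D \<inter> B. invertible (matrix (iota I w z)) \<longrightarrow> K z = matrix_inv (matrix (iota I w z))) \<longrightarrow>
        (\<exists>H. mat_holomorphic_on H D \<and> (\<forall>z\<in>D \<inter> B. T_invertible A z \<longrightarrow> H z = g z))) \<and>
     (\<forall>\<gamma>. path \<gamma> \<and> pathstart \<gamma> \<in> reg \<longrightarrow>
        (\<not> continuable grass_analytic_on init (Eu 0) \<gamma> \<or>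
           \<not> continuable grass_analytic_on init (Es 0) \<gamma> \<longrightarrow>
           \<not> continuable mat_holomorphic_on reg g \<gamma>) \<and>
        ((\<exists>V W. continues_to grass_analytic_on init (Eu 0) \<gamma> V \<and>
           continues_to grass_analytic_on init (Es 0) \<gamma> W \<and> V \<inter> W \<noteq> {0}) \<longrightarrow>
           \<not> continuable mat_holomorphic_on reg g \<gamma>))"
  proof (intro conjI allI impI)
    fix D K
    assume D: "open D \<and> connected D \<and> D \<subseteq> \<Omega> \<and> D \<inter> B \<noteq> {} \<and> mat_holomorphic_on K D \<and>
        (\<forall>z\<in>D \<inter> B. invertible (matrix (iota I w z)) \<longrightarrow> K z = matrix_inv (matrix (iota I w z)))"
    define H where "H z = fundamental A x z ** (projection_from_inverse I w K z - s *\<^sub>R mat 1) ** fundamental_inv A y z" for z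
    have wD: "\<forall>j. vec_holomorphic_on (w j) D" using w(2) D vec_holomorphic_on_subset by blast
    have "mat_holomorphic_on H D"
      unfolding H_def using D
      by (intro mat_holomorphic_on_mult mat_holomorphic_on_diff mat_holomorphic_on_const
          mat_holomorphic_on_subset[OF hol(1) subset_UNIV] mat_holomorphic_on_subset[OF hol(2) subset_UNIV]
          projection_from_inverse_holomorphic[OF wD]) auto
    moreover have "H z = g z" if z: "z \<in> D \<inter> B" "T_invertible A z" for z
    proof -
      have zr: "z \<in> reg" using z B(3) by (auto simp: reg_def)
      have b: "basis_of I (\<lambda>j. w j z) (Eu 0 z)" "basis_of (- I) (\<lambda>j. w j z) (Es 0 z)"
      proof -
        have "z \<in> \<Omega>" "Fu z = Eu 0 z" "Fs z = Es 0 z" using Fu(2) Fs(2) z(1) B(3) by blast+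
        then show "basis_of I (\<lambda>j. w j z) (Eu 0 z)" "basis_of (- I) (\<lambda>j. w j z) (Es 0 z)"
          using w(3) by fastforce+
      qed
      have d: "Es 0 z \<inter> Eu 0 z \<subseteq> {0}" by (rule projects_disjoint[OF P(1)[OF zr]])
      have "K z = matrix_inv (matrix (iota I w z))"
        using D z(1) iota_invertible_of_direct_sum[where I=I and w=w and z=z, OF b d] by blast
      then have "projection_from_inverse I w K z = P z"
        using projects_unique[OF projects_from_iota_inverse[where I=I and w=w and z=z, OF b d] P(1)[OF zr]] by blast
      then show ?thesis using P(2)[OF zr] by (simp add: H_def)
    qed
    ultimately show "\<exists>H. mat_holomorphic_on H D \<and> (\<forall>z\<in>D \<inter> B. T_invertible A z \<longrightarrow> H z = g z)" by blast
  next
    have sub: "reg \<subseteq> init" by (auto simp: reg_def)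
    have proj: "projects (fundamental_inv A x z ** g z ** fundamental A y z + s *\<^sub>R mat 1) (Es 0 z) (Eu 0 z)"
      if z: "z \<in> reg" for z
    proof -
      have "fundamental_inv A x z ** g z ** fundamental A y z
          = (fundamental_inv A x z ** fundamental A x z) ** (P z - s *\<^sub>R mat 1) ** (fundamental_inv A y z ** fundamental A y z)"
        unfolding P(2)[OF z] by (simp only: matrix_mul_assoc)
      also have "\<dots> = P z - s *\<^sub>R mat 1" by (simp add: fundamental_inverse[OF A_continuous])
      finally show ?thesis using P(1)[OF z] by simp
    qed
    fix \<gamma> assume \<gamma>: "path \<gamma> \<and> pathstart \<gamma> \<in> reg"
    note continuation = continuation_of_projections[OF conjunct1[OF \<gamma>] sub hol(2) hol(1) proj]
    show "\<not> continuable mat_holomorphic_on reg g \<gamma>"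
      if "\<not> continuable grass_analytic_on init (Eu 0) \<gamma> \<or> \<not> continuable grass_analytic_on init (Es 0) \<gamma>"
      using that continuation(1,2) by blast
    show "\<not> continuable mat_holomorphic_on reg g \<gamma>"
      if "\<exists>V W. continues_to grass_analytic_on init (Eu 0) \<gamma> V \<and>
           continues_to grass_analytic_on init (Es 0) \<gamma> W \<and> V \<inter> W \<noteq> {0}"
      using that continuation(3) by blast
  qed
qed

end
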